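(* Let $q=p^e>4$, where $p$ is a prime, and let $\ell$ be a positive integer with $2\ell\mid e$. For each of the following families of data $(\boldsymbol a,n,s,k)$, where $\boldsymbol a=(a_1,\ldots,a_n)$ has distinct entries in $\mathbb F_q$ and $u_j=\prod_{v\ne j}(a_j-a_v)^{-1}$, there exist an $[n+s,k,d]_q$ $\ell$-Galois LCD generalized Roth-Lempel code $C$ and a maximally entangled $[[n+s,k,d;n+s-k]]_q$ EAQECC, with $d$ as indicated: (F1) $s\ge2$, $a_j\ne0$ and $a_j^{-1}u_j\in\mathbb F_{p^\ell}^*$ for all $j$, and $s<k\le\left\lfloor\frac{n+p^\ell}{p^\ell+1}\right\rfloor$; here $d$ is some integer with $d\ge n-k+2$. (F2) $s\ge2$, $\lambda a_j^{\delta-1}u_j\in\mathbb F_{p^\ell}^*$ for all $j$ for some $\delta\in\mathbb Z_{>0}$ and $\lambda\in\mathbb F_q^*$, and $s<k\le\left\lfloor\frac{n+p^\ell-\delta+1}{p^\ell+1}\right\rfloor$; here $d$ is some integer with $d\ge n-k+2$. (F3) $s=2$ and $\boldsymbol a$ lists one of the evaluation sets (R1)--(R10) of the context, with $k\ge3$ in the corresponding range of the context; here $d=n-k+2$, and, if $\Delta_{k-1}(\boldsymbol a)\ne\mathbb F_q$, also $d=n-k+3$ is possible. (F4) $s=2$, $k\ge3$, $\lambda a_j^{\delta-1}u_j\in\mathbb F_{p^\ell}^*$ for all $j$ for some $\delta\in\mathbb Z_{>0}$ and $\lambda\in\mathbb F_q^*$ with $\delta-1+p^\ell(k-1)=n-k$;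 here $d=n-k+3$ if $0\notin\Delta_{k-1}(\boldsymbol a)$ and $d=n-k+2$ if $0\in\Delta_{k-1}(\boldsymbol a)$. (F5) $s=2$, $\boldsymbol a$ lists $\mathbb F_q$ (so $n=q$) and $3\le k\le1+\frac{q-1}{p^\ell+1}$; here $d=q-k+2$. (F6) $s=3$ and $\boldsymbol a$ lists one of the evaluation sets (R1)--(R10) of the context, with $k\ge4$ in the corresponding range of the context; here $d=n-k+4$ if some $A_3\in\operatorname{GL}_3(\mathbb F_q)$ satisfies conditions (M1), (M2) of the context, and $d=n-k+3$ if some $A_3\in\operatorname{GL}_3(\mathbb F_q)$ satisfies conditions (N1), (N2) of the context (each whenever the respective matrix exists). (F7) $s=3$, $k\ge4$, $\lambda a_j^{\delta-1}u_j\in\mathbb F_{p^\ell}^*$ for all $j$ for some $\delta\in\mathbb Z_{>0}$ and $\lambda\in\mathbb F_q^*$ with $\delta-1+p^\ell(k-1)=n-k$; here $d=n-k+4$ if all the conditions (D) of the context hold, and $d=n-k+3$ if at least one condition in (D) fails and $(e_1(J),e_2(J))\ne(0,0)$ for every $J\subseteq\{1,\ldots,n\}$ with $|J|=k-1$. If $e=2\ell$, then in each case $C$ is Hermitian LCD and also yields a maximally entangled $[[n+s,k,d;n+s-k]]_{p^\ell}$ EAQECC. In particular, if $q=p^{2\ell}>4$, then for every $3\le k\le p^\ell$ there exist a $[q+2,k,q-k+2]_q$ AMDS Hermitian LCD generalized Roth-Lempel code with evaluation set $\mathbb F_q$ and a $[[q+2,k,q-k+2;q+2-k]]_{p^\ell}$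 EAQECC.
   Context: Codes. For $0\le\ell\le e-1$, the $\ell$-Galois inner product on $\mathbb F_q^N$ is $\langle\boldsymbol x,\boldsymbol y\rangle_\ell=\sum_i x_iy_i^{p^\ell}$; $C^{\perp_\ell}=\{\boldsymbol x:\langle\boldsymbol c,\boldsymbol x\rangle_\ell=0\ \forall\boldsymbol c\in C\}$. A linear code $C$ is $\ell$-Galois LCD if $C\cap C^{\perp_\ell}=\{0\}$; for $e=2\ell$ this is called Hermitian LCD. An $[N,k,d]_q$ code is a $k$-dimensional subspace of $\mathbb F_q^N$ with minimum Hamming distance $d$; it is AMDS if $d=N-k$. For $1\le s\le k\le n$, $\boldsymbol a\in\mathbb F_q^n$ with distinct entries, $\boldsymbol v\in(\mathbb F_q^* )^n$, $A_s\in\operatorname{GL}_s(\mathbb F_q)$, the generalized Roth-Lempel (GRL) code is the $[n+s,k]_q$ code $$\operatorname{GRL}_k(\boldsymbol a,\boldsymbol v,A_s)=\{(v_1f(a_1),\ldots,v_nf(a_n),(f_{k-s},\ldots,f_{k-1})A_s): f=\textstyle\sum_{j=0}^{k-1}f_jx^j\in\mathbb F_q[x]\}.$$ $\Delta_t(\boldsymbol a)=\{\sum_{i\in I}a_i:I\subseteq\{1,\ldots,n\},|I|=t\}$. Convention $0^0=1$. EAQECCs. A $Q$-ary entanglement-assisted quantum error-correcting code with parameters $[[N,K,d;c]]_Q$ encodes $K$ logical qudits (each $\mathbb C^Q$) into $N$ physical qudits using $c$ maximally entangled pairs shared between sender and receiver, with minimum distance (at least) $d$: there is a unitary $U$ on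 $(\mathbb C^Q)^{\otimes N}$ such that the code space is the image of $|\psi\rangle\mapsto(U\otimes I)(|\psi\rangle\otimes|0\rangle^{\otimes(N-K-c)}\otimes|\Phi\rangle^{\otimes c})$, $|\psi\rangle\in(\mathbb C^Q)^{\otimes K}$, $|\Phi\rangle=Q^{-1/2}\sum_i|i\rangle|i\rangle$, with $U$ acting on the logical qudits, ancillas and the sender's halves of the pairs, $I$ on the receiver's (error-free) halves; and every error $E$ acting nontrivially on at most $d-1$ of the $N$ transmitted qudits satisfies $P(E\otimes I)P=c_EP$ for a scalar $c_E$, with $P$ the projector onto the code space. It is maximally entangled if $c=N-K$. Conditions for $s=3$. Write $A_3=(\boldsymbol a_1,\boldsymbol a_2,\boldsymbol a_3)$ by columns (bold $\boldsymbol a_r\in\mathbb F_q^3$). For $S\subseteq\{1,\ldots,n\}$ let $e_1(S)=\sum_{i\in S}a_i$, $e_2(S)=\sum_{i,j\in S,i<j}a_ia_j$. Always $|I|=k-2$, $|J|=k-1$, $\boldsymbol\omega_I=(1,e_1(I),e_1(I)^2-e_2(I))^T$, $\boldsymbol\gamma_J=(e_2(J),-e_1(J),1)^T$. (M1) $\det(\boldsymbol a_r,\boldsymbol a_t,\boldsymbol\omega_I)\ne0$ for every $I$ and all $1\le r<t\le3$; (M2) $\boldsymbol a_r^T\boldsymbol\gamma_J\ne0$ for every $J$ and all $1\le r\le 3$. (N1) $\det(\boldsymbol a_r,\boldsymbol a_t,\boldsymbol\omega_I)=0$ for some $I$ and $1\le r<t\le3$, or $\boldsymbol a_r^T\boldsymbol\gamma_J=0$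 for some $J$ and $1\le r\le 3$; (N2) for every $J$ at most one of $\boldsymbol a_1^T\boldsymbol\gamma_J,\boldsymbol a_2^T\boldsymbol\gamma_J,\boldsymbol a_3^T\boldsymbol\gamma_J$ is zero. (D) $e_1(I)\ne0$ and $e_1(I)^2-e_2(I)\ne0$ for every $I$; $e_1(J)\ne0$ and $e_2(J)\ne0$ for every $J$. Ranges of $k$ for (R1)--(R10), with $s\in\{2,3\}$: for (R1), (R3), (R5), $s+1\le k\le\lfloor\frac{n+p^\ell}{p^\ell+1}\rfloor$; for (R2), (R4), (R6), (R7), (R8), (R10), $s+1\le k\le\lfloor\frac{n+p^\ell-1}{p^\ell+1}\rfloor$; for (R9), $s+1\le k\le\lfloor\frac{n+p^\ell}{p^\ell+1}\rfloor$ or $s+1\le k\le\lfloor\frac{n+p^\ell-m}{p^\ell+1}\rfloor$. Evaluation sets ($n$ is the number of elements; $\omega$ a primitive element of $\mathbb F_q$): (R1) $n=t\frac{q-1}{p^\ell-1}$, $1\le t\le p^\ell-1$: $\{x\in\mathbb F_q^*:x^{(q-1)/(p^\ell-1)}\in\{b_1,\ldots,b_t\}\}$ for distinct $b_i\in\mathbb F_{p^\ell}^*$. (R2) $n=t\frac{q-1}{p^\ell-1}+1$: a set (R1) together with $0$. (R3) $n=r_1r_2$: $x_1,x_2$ positive integers with $(q-1)\mid\operatorname{lcm}(x_1,x_2)$, $\frac{q-1}{p^\ell-1}\mid x_1$, $\xi_1=\omega^{x_1}$, $\xi_2=\omega^{x_2}$, $r_2=\frac{q-1}{\gcd(x_2,q-1)}$,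 $1\le r_1\le\frac{q-1}{\gcd(x_1,q-1)}$; the set $\{\xi_1^j\xi_2^v:1\le j\le r_1,1\le v\le r_2\}$. (R4) $n=r_1r_2+1$: a set (R3) together with $0$. (R5) $n=rm$: $y=\frac{q-1}{p^\ell-1}$, $m\mid(q-1)$, $m_2=\gcd(m,y)$, $m_1=m/m_2$, $H=\langle\omega^{(q-1)/m}\rangle\le G=\langle\omega^{y/m_2}\rangle$, $1\le r\le\frac{p^\ell-1}{m_1}=|G/H|$; a union of $r$ distinct cosets of $H$ in $G$. (R6) $n=rm+1$: a set (R5) together with $0$. (R7) $n=tp^{e-\ell}$: $B\subseteq\mathbb F_{p^\ell}$ an $\mathbb F_p$-subspace, $1\le t\le|B|$, $b_1=0,b_2,\ldots,b_t\in B$ distinct; $\{x\in\mathbb F_q:\operatorname{Tr}(x)\in\{b_1,\ldots,b_t\}\}$, $\operatorname{Tr}(x)=x+x^{p^\ell}+\cdots+x^{p^{e-\ell}}$. (R8) $n=tp^r$: $V$ an $r$-dimensional $\mathbb F_p$-subspace of $\mathbb F_q$, $L_V(x)=\prod_{v\in V}(x-v)$, $b_1,\ldots,b_t$ ($t\ge1$) distinct elements of $L_V(\mathbb F_q)\cap\mathbb F_{p^\ell}$; $\{x\in\mathbb F_q:L_V(x)\in\{b_1,\ldots,b_t\}\}$. (R9) $n=tmp^r$: $V$ an $r$-dimensional $\mathbb F_p$-subspace of $\mathbb F_{p^\ell}$, $0\le r<\ell$, $m\mid\frac{q-1}{p^\ell-1}$, $\Phi(x)=L_V(x^m)$ with $L_V(x)=\prod_{v\in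 V}(x-v)$, $b_1,\ldots,b_t$ distinct in $L_V(\mathbb F_{p^\ell})\setminus\{0\}$, $1\le t\le p^{\ell-r}-1$; $\{x\in\mathbb F_q:\Phi(x)\in\{b_1,\ldots,b_t\}\}$. (R10) $n=1+m(tp^r-1)$: $V,m,\Phi$ as in (R9), $b_1=0,b_2,\ldots,b_t$ distinct in $L_V(\mathbb F_{p^\ell})$, $1\le t\le p^{\ell-r}$; $\{x\in\mathbb F_q:\Phi(x)\in\{b_1,\ldots,b_t\}\}$. *)

theory Defs
  imports
    "Jordan_Normal_Form.VS_Connect"
    "HOL-Algebra.Embedded_Algebras"
    "HOL-Library.Cardinality"
    Complex_Main
begin

section \<open>Subfields and subspaces of a finite field\<close>

text \<open>The field with \<open>q\<close> elements is a type of class field and finite; \<open>class_ring\<close> is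
  the HOL-Algebra record of its ring structure.\<close>

definition subfield_of_order :: "nat \<Rightarrow> 'a::field set" where
  "subfield_of_order m = (THE K. subfield K (class_ring :: 'a ring) \<and> card K = m)"

definition fp_subspace :: "nat \<Rightarrow> nat \<Rightarrow> 'a::field set \<Rightarrow> bool" where
  "fp_subspace p r V \<longleftrightarrow> ring.dimension (class_ring :: 'a ring) r (subfield_of_order p) V"


section \<open>Linear codes\<close>

definition hamming_dist :: "'a vec \<Rightarrow> 'a vec \<Rightarrow> nat" where
  "hamming_dist x y = card {i. i < dim_vec x \<and> x $ i \<noteq> y $ i}"

definition min_dist :: "'a vec set \<Rightarrow> nat" where
  "min_dist C = Min {hamming_dist x y | x y. x \<in> C \<and> y \<in> C \<and> x \<noteq> y}"

definition linear_code :: "nat \<Rightarrow> nat \<Rightarrow> nat \<Rightarrow> 'a::field vec set \<Rightarrow> bool" where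
  "linear_code N k d C \<longleftrightarrow>
     VectorSpace.subspace class_ring C (module_vec TYPE('a) N) \<and>
     vectorspace.dim class_ring ((module_vec TYPE('a) N)\<lparr>carrier := C\<rparr>) = k \<and>
     min_dist C = d"

definition amds_code :: "nat \<Rightarrow> nat \<Rightarrow> 'a::field vec set \<Rightarrow> bool" where
  "amds_code N k C \<longleftrightarrow> linear_code N k (N - k) C"

definition galois_inner :: "nat \<Rightarrow> nat \<Rightarrow> 'a::field vec \<Rightarrow> 'a vec \<Rightarrow> 'a" where
  "galois_inner p l x y = (\<Sum>i<dim_vec x. x $ i * (y $ i) ^ (p ^ l))"

definition galois_dual :: "nat \<Rightarrow> nat \<Rightarrow> nat \<Rightarrow> 'a::field vec set \<Rightarrow> 'a vec set" where
  "galois_dual p l N C = {x \<in> carrier_vec N. \<forall>c\<in>C. galois_inner p l c x = 0}"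

definition galois_lcd :: "nat \<Rightarrow> nat \<Rightarrow> nat \<Rightarrow> 'a::field vec set \<Rightarrow> bool" where
  "galois_lcd p l N C \<longleftrightarrow> C \<inter> galois_dual p l N C = {0\<^sub>v N}"

definition hermitian_lcd :: "nat \<Rightarrow> nat \<Rightarrow> nat \<Rightarrow> 'a::field vec set \<Rightarrow> bool" where
  "hermitian_lcd p e N C \<longleftrightarrow> even e \<and> galois_lcd p (e div 2) N C"

definition distinct_entries :: "nat \<Rightarrow> 'a vec \<Rightarrow> bool" where
  "distinct_entries n a \<longleftrightarrow> a \<in> carrier_vec n \<and> inj_on (\<lambda>j. a $ j) {..<n}"

definition lists_set :: "nat \<Rightarrow> 'a vec \<Rightarrow> 'a set \<Rightarrow> bool" where
  "lists_set n a S \<longleftrightarrow> distinct_entries n a \<and> set\<^sub>v a = S"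

text \<open>The row vector \<open>(f\<^sub>k\<^sub>-\<^sub>s, \<dots>, f\<^sub>k\<^sub>-\<^sub>1) A\<close> is written as the column vector
  \<open>A\<^sup>T (f\<^sub>k\<^sub>-\<^sub>s, \<dots>, f\<^sub>k\<^sub>-\<^sub>1)\<^sup>T\<close>.\<close>

definition GRL :: "nat \<Rightarrow> nat \<Rightarrow> nat \<Rightarrow> 'a::field vec \<Rightarrow> 'a vec \<Rightarrow> 'a mat \<Rightarrow> 'a vec set" where
  "GRL n s k a v A =
     {vec n (\<lambda>j. v $ j * poly f (a $ j)) @\<^sub>v
        (transpose_mat A *\<^sub>v vec s (\<lambda>i. Polynomial.coeff f (k - s + i))) | f. Polynomial.degree f < k}"

definition GL :: "nat \<Rightarrow> 'a::field mat set" where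
  "GL s = {A \<in> carrier_mat s s. invertible_mat A}"

definition is_GRL_code :: "nat \<Rightarrow> nat \<Rightarrow> nat \<Rightarrow> 'a::field vec \<Rightarrow> 'a vec set \<Rightarrow> bool" where
  "is_GRL_code n s k a C \<longleftrightarrow>
     1 \<le> s \<and> s \<le> k \<and> k \<le> n \<and> distinct_entries n a \<and>
     (\<exists>v A. v \<in> carrier_vec n \<and> (\<forall>j<n. v $ j \<noteq> 0) \<and> A \<in> GL s \<and> C = GRL n s k a v A)"


section \<open>Entanglement-assisted quantum codes\<close>

text \<open>A finite-dimensional Hilbert space is given by a finite set \<open>B\<close> labelling an orthonormal
  basis: states are functions to the complex numbers vanishing outside \<open>B\<close>, and operators are
  matrices indexed by \<open>B\<close>, of which only the entries in \<open>B \<times> B\<close> matter. Tensor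
  products of spaces have the product of the label sets as label set; \<open>N\<close> qudits of dimension
  \<open>Q\<close> are labelled by the words of length \<open>N\<close> over \<open>{..<Q}\<close>.\<close>

type_synonym 'b qstate = "'b \<Rightarrow> complex"
type_synonym 'b qop = "'b \<Rightarrow> 'b \<Rightarrow> complex"

definition qspace :: "'b set \<Rightarrow> 'b qstate set" where
  "qspace B = {\<psi>. \<forall>x. x \<notin> B \<longrightarrow> \<psi> x = 0}"

definition qapply :: "'b set \<Rightarrow> 'b qop \<Rightarrow> 'b qstate \<Rightarrow> 'b qstate" where
  "qapply B M \<psi> = (\<lambda>x. if x \<in> B then \<Sum>y\<in>B. M x y * \<psi> y else 0)"

definition qcomp :: "'b set \<Rightarrow> 'b qop \<Rightarrow> 'b qop \<Rightarrow> 'b qop" where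
  "qcomp B M M' = (\<lambda>x y. \<Sum>z\<in>B. M x z * M' z y)"

definition qadj :: "'b qop \<Rightarrow> 'b qop" where
  "qadj M = (\<lambda>x y. cnj (M y x))"

definition qid :: "'b qop" where
  "qid = (\<lambda>x y. if x = y then 1 else 0)"

definition qtensor :: "'b qop \<Rightarrow> 'c qop \<Rightarrow> ('b \<times> 'c) qop" where
  "qtensor M M' = (\<lambda>(x, b) (y, c). M x y * M' b c)"

definition qop_eq :: "'b set \<Rightarrow> 'b qop \<Rightarrow> 'b qop \<Rightarrow> bool" where
  "qop_eq B M M' \<longleftrightarrow> (\<forall>x\<in>B. \<forall>y\<in>B. M x y = M' x y)"

definition qunitary :: "'b set \<Rightarrow> 'b qop \<Rightarrow> bool" where
  "qunitary B U \<longleftrightarrow> qop_eq B (qcomp B U (qadj U)) qid \<and> qop_eq B (qcomp B (qadj U) U) qid"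

definition projector_onto :: "'b set \<Rightarrow> 'b qop \<Rightarrow> 'b qstate set \<Rightarrow> bool" where
  "projector_onto B P W \<longleftrightarrow>
     qop_eq B (qadj P) P \<and> qop_eq B (qcomp B P P) P \<and> qapply B P ` qspace B = W"

definition qudits :: "nat \<Rightarrow> nat \<Rightarrow> nat list set" where
  "qudits Q N = {x. length x = N \<and> set x \<subseteq> {..<Q}}"

text \<open>\<open>E\<close> is (up to reordering of tensor factors) an operator \<open>F\<close> on the qudits at the
  positions in \<open>T\<close>, tensored with the identity on the remaining ones.\<close>

definition acts_only_on :: "nat \<Rightarrow> nat \<Rightarrow> nat set \<Rightarrow> nat list qop \<Rightarrow> bool" where
  "acts_only_on Q N T E \<longleftrightarrow>
     (\<exists>F :: nat list qop. qop_eq (qudits Q N) E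
        (\<lambda>x y. if \<forall>i<N. i \<notin> T \<longrightarrow> x ! i = y ! i then F (nths x T) (nths y T) else 0))"

definition zero_ancillas :: "nat \<Rightarrow> nat list qstate" where
  "zero_ancillas m w = (if w = replicate m 0 then 1 else 0)"

definition ebits :: "nat \<Rightarrow> nat \<Rightarrow> (nat list \<times> nat list) qstate" where
  "ebits Q c = (\<lambda>(z, b). \<Prod>i<c. if z ! i = b ! i then complex_of_real (1 / sqrt (real Q)) else 0)"

text \<open>The state \<open>\<psi> \<otimes> |0\<rangle>\<^sup>N\<^sup>-\<^sup>K\<^sup>-\<^sup>c \<otimes> |\<Phi>\<rangle>\<^sup>c\<close>. The first component of the label belongs to the
  sender (logical qudits, ancillas, halves of the pairs, in this order), the second one to the
  receiver.\<close>

definition unencoded ::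
  "nat \<Rightarrow> nat \<Rightarrow> nat \<Rightarrow> nat \<Rightarrow> nat list qstate \<Rightarrow> (nat list \<times> nat list) qstate" where
  "unencoded Q N K c \<psi> = (\<lambda>(y, b).
     \<psi> (take K y) * zero_ancillas (N - K - c) (take (N - K - c) (drop K y))
       * ebits Q c (drop (N - c) y, b))"

definition ea_code_space ::
  "nat \<Rightarrow> nat \<Rightarrow> nat \<Rightarrow> nat \<Rightarrow> nat list qop \<Rightarrow> (nat list \<times> nat list) qstate set" where
  "ea_code_space Q N K c U =
     (\<lambda>\<psi>. qapply (qudits Q N \<times> qudits Q c) (qtensor U qid) (unencoded Q N K c \<psi>))
       ` qspace (qudits Q K)"

text \<open>Existence of an \<open>[[N, K, d; c]]\<^sub>Q\<close> code of minimum distance at least \<open>d\<close>.\<close>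

definition eaqecc_exists :: "nat \<Rightarrow> nat \<Rightarrow> nat \<Rightarrow> nat \<Rightarrow> nat \<Rightarrow> bool" where
  "eaqecc_exists Q N K d c \<longleftrightarrow> K + c \<le> N \<and>
     (let B = qudits Q N \<times> qudits Q c in
      \<exists>U P. qunitary (qudits Q N) U \<and> projector_onto B P (ea_code_space Q N K c U) \<and>
        (\<forall>E T. T \<subseteq> {..<N} \<and> card T < d \<and> acts_only_on Q N T E \<longrightarrow>
           (\<exists>\<gamma>. qop_eq B (qcomp B P (qcomp B (qtensor E qid) P)) (\<lambda>x y. \<gamma> * P x y))))"

definition maximally_entangled_eaqecc_exists :: "nat \<Rightarrow> nat \<Rightarrow> nat \<Rightarrow> nat \<Rightarrow> nat \<Rightarrow> bool" where
  "maximally_entangled_eaqecc_exists Q N K d c \<longleftrightarrow> eaqecc_exists Q N K d c \<and> c = N - K"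


section \<open>The evaluation sets\<close>

text \<open>Indices run over \<open>{..<n}\<close> instead of \<open>{1..n}\<close>.\<close>

definition u_coeff :: "nat \<Rightarrow> 'a::field vec \<Rightarrow> nat \<Rightarrow> 'a" where
  "u_coeff n a j = (\<Prod>v\<in>{..<n} - {j}. inverse (a $ j - a $ v))"

definition subset_sums :: "nat \<Rightarrow> 'a::field vec \<Rightarrow> nat \<Rightarrow> 'a set" where
  "subset_sums n a t = {\<Sum>i\<in>I. a $ i | I. I \<subseteq> {..<n} \<and> card I = t}"

definition cyclic_subgroup :: "'a::field \<Rightarrow> 'a set" where
  "cyclic_subgroup g = range (\<lambda>i::int. g powi i)"

definition primitive_element :: "'a::field \<Rightarrow> bool" where
  "primitive_element \<omega> \<longleftrightarrow> cyclic_subgroup \<omega> = UNIV - {0}"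

definition trace_map :: "nat \<Rightarrow> nat \<Rightarrow> nat \<Rightarrow> 'a::field \<Rightarrow> 'a" where
  "trace_map p e l x = (\<Sum>i<e div l. x ^ (p ^ (l * i)))"

definition vanishing_poly :: "'a::field set \<Rightarrow> 'a \<Rightarrow> 'a" where
  "vanishing_poly V x = (\<Prod>v\<in>V. x - v)"

text \<open>In each predicate, \<open>n\<close> is the prescribed number of elements and \<open>S\<close> the
  evaluation set; the set \<open>T\<close> collects the distinct values \<open>b\<^sub>1, \<dots>, b\<^sub>t\<close>.\<close>

definition R1 :: "nat \<Rightarrow> nat \<Rightarrow> nat \<Rightarrow> 'a::{field,finite} set \<Rightarrow> bool" where
  "R1 p l n S \<longleftrightarrow>
     (let q = CARD('a); y = (q - 1) div (p ^ l - 1) in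
      \<exists>t T. 1 \<le> t \<and> t \<le> p ^ l - 1 \<and> T \<subseteq> subfield_of_order (p ^ l) - {0} \<and> card T = t \<and>
        n = t * y \<and> S = {x. x \<noteq> 0 \<and> x ^ y \<in> T})"

definition R3 :: "nat \<Rightarrow> nat \<Rightarrow> nat \<Rightarrow> 'a::{field,finite} set \<Rightarrow> bool" where
  "R3 p l n S \<longleftrightarrow>
     (let q = CARD('a) in
      \<exists>(\<omega>::'a) x1 x2 r1 r2. primitive_element \<omega> \<and> 0 < x1 \<and> 0 < x2 \<and>
        (q - 1) dvd lcm x1 x2 \<and> ((q - 1) div (p ^ l - 1)) dvd x1 \<and>
        r2 = (q - 1) div gcd x2 (q - 1) \<and> 1 \<le> r1 \<and> r1 \<le> (q - 1) div gcd x1 (q - 1) \<and>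
        n = r1 * r2 \<and>
        S = {(\<omega> ^ x1) ^ j * (\<omega> ^ x2) ^ v | j v. j \<in> {1..r1} \<and> v \<in> {1..r2}})"

definition R5 :: "nat \<Rightarrow> nat \<Rightarrow> nat \<Rightarrow> 'a::{field,finite} set \<Rightarrow> bool" where
  "R5 p l n S \<longleftrightarrow>
     (let q = CARD('a); y = (q - 1) div (p ^ l - 1) in
      \<exists>(\<omega>::'a) m m1 m2 H G r \<S>. primitive_element \<omega> \<and> m dvd (q - 1) \<and>
        m2 = gcd m y \<and> m1 = m div m2 \<and>
        H = cyclic_subgroup (\<omega> ^ ((q - 1) div m)) \<and> G = cyclic_subgroup (\<omega> ^ (y div m2)) \<and>
        1 \<le> r \<and> r \<le> (p ^ l - 1) div m1 \<and>
        \<S> \<subseteq> {(\<lambda>h. g * h) ` H | g. g \<in> G} \<and> card \<S> = r \<and>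
        n = r * m \<and> S = \<Union>\<S>)"

definition R7 :: "nat \<Rightarrow> nat \<Rightarrow> nat \<Rightarrow> nat \<Rightarrow> 'a::{field,finite} set \<Rightarrow> bool" where
  "R7 p e l n S \<longleftrightarrow>
     (\<exists>(B :: 'a set) t T. (\<exists>r. fp_subspace p r B) \<and> B \<subseteq> subfield_of_order (p ^ l) \<and>
        1 \<le> t \<and> t \<le> card B \<and> 0 \<in> T \<and> T \<subseteq> B \<and> card T = t \<and>
        n = t * p ^ (e - l) \<and> S = {x. trace_map p e l x \<in> T})"

definition R8 :: "nat \<Rightarrow> nat \<Rightarrow> nat \<Rightarrow> 'a::{field,finite} set \<Rightarrow> bool" where
  "R8 p l n S \<longleftrightarrow>
     (\<exists>(V :: 'a set) r t T. fp_subspace p r V \<and> 1 \<le> t \<and>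
        T \<subseteq> range (vanishing_poly V) \<inter> subfield_of_order (p ^ l) \<and> card T = t \<and>
        n = t * p ^ r \<and> S = {x. vanishing_poly V x \<in> T})"

definition R9 :: "nat \<Rightarrow> nat \<Rightarrow> nat \<Rightarrow> nat \<Rightarrow> 'a::{field,finite} set \<Rightarrow> bool" where
  "R9 p l m n S \<longleftrightarrow>
     (\<exists>(V :: 'a set) r t T. fp_subspace p r V \<and> V \<subseteq> subfield_of_order (p ^ l) \<and> r < l \<and>
        m dvd (CARD('a) - 1) div (p ^ l - 1) \<and>
        T \<subseteq> vanishing_poly V ` subfield_of_order (p ^ l) - {0} \<and> card T = t \<and>
        1 \<le> t \<and> t \<le> p ^ (l - r) - 1 \<and>
        n = t * m * p ^ r \<and> S = {x. vanishing_poly V (x ^ m) \<in> T})"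

definition R10 :: "nat \<Rightarrow> nat \<Rightarrow> nat \<Rightarrow> 'a::{field,finite} set \<Rightarrow> bool" where
  "R10 p l n S \<longleftrightarrow>
     (\<exists>(V :: 'a set) r m t T. fp_subspace p r V \<and> V \<subseteq> subfield_of_order (p ^ l) \<and> r < l \<and>
        m dvd (CARD('a) - 1) div (p ^ l - 1) \<and>
        0 \<in> T \<and> T \<subseteq> vanishing_poly V ` subfield_of_order (p ^ l) \<and> card T = t \<and>
        1 \<le> t \<and> t \<le> p ^ (l - r) \<and>
        n = 1 + m * (t * p ^ r - 1) \<and> S = {x. vanishing_poly V (x ^ m) \<in> T})"

definition with_zero :: "(nat \<Rightarrow> 'a::zero set \<Rightarrow> bool) \<Rightarrow> nat \<Rightarrow> 'a set \<Rightarrow> bool" where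
  "with_zero R n S \<longleftrightarrow> (\<exists>n' S'. R n' S' \<and> n = n' + 1 \<and> S = insert 0 S')"

definition R2 :: "nat \<Rightarrow> nat \<Rightarrow> nat \<Rightarrow> 'a::{field,finite} set \<Rightarrow> bool" where
  "R2 p l = with_zero (R1 p l)"

definition R4 :: "nat \<Rightarrow> nat \<Rightarrow> nat \<Rightarrow> 'a::{field,finite} set \<Rightarrow> bool" where
  "R4 p l = with_zero (R3 p l)"

definition R6 :: "nat \<Rightarrow> nat \<Rightarrow> nat \<Rightarrow> 'a::{field,finite} set \<Rightarrow> bool" where
  "R6 p l = with_zero (R5 p l)"

text \<open>\<open>a\<close> lists one of the evaluation sets, and \<open>k\<close> lies in the range belonging to that
  set.\<close>

definition listed_eval_set ::
  "nat \<Rightarrow> nat \<Rightarrow> nat \<Rightarrow> nat \<Rightarrow> nat \<Rightarrow> nat \<Rightarrow> 'a::{field,finite} vec \<Rightarrow> bool" where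
  "listed_eval_set p e l n s k a \<longleftrightarrow>
     (\<exists>S. lists_set n a S \<and> s + 1 \<le> k \<and>
       (((R1 p l n S \<or> R3 p l n S \<or> R5 p l n S) \<and> k \<le> (n + p ^ l) div (p ^ l + 1)) \<or>
        ((R2 p l n S \<or> R4 p l n S \<or> R6 p l n S \<or> 
          R7 p e l n S \<or> R8 p l n S \<or> R10 p l n S) \<and> k \<le> (n + p ^ l - 1) div (p ^ l + 1)) \<or>
        (\<exists>m. R9 p l m n S \<and>
          (k \<le> (n + p ^ l) div (p ^ l + 1) \<or> k \<le> (n + p ^ l - m) div (p ^ l + 1)))))"


section \<open>Conditions for three additional columns\<close>

definition e1 :: "'a::field vec \<Rightarrow> nat set \<Rightarrow> 'a" where
  "e1 a S = (\<Sum>i\<in>S. a $ i)"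

definition e2 :: "'a::field vec \<Rightarrow> nat set \<Rightarrow> 'a" where
  "e2 a S = (\<Sum>(i, j)\<in>{(i, j). i \<in> S \<and> j \<in> S \<and> i < j}. a $ i * a $ j)"

definition subsets_of_card :: "nat \<Rightarrow> nat \<Rightarrow> nat set set" where
  "subsets_of_card n t = {I. I \<subseteq> {..<n} \<and> card I = t}"

definition omega_vec :: "'a::field vec \<Rightarrow> nat set \<Rightarrow> 'a vec" where
  "omega_vec a I = vec_of_list [1, e1 a I, (e1 a I)\<^sup>2 - e2 a I]"

definition gamma_vec :: "'a::field vec \<Rightarrow> nat set \<Rightarrow> 'a vec" where
  "gamma_vec a J = vec_of_list [e2 a J, - e1 a J, 1]"

definition det_cols :: "'a::field vec \<Rightarrow> 'a mat \<Rightarrow> nat \<Rightarrow> nat \<Rightarrow> nat set \<Rightarrow> 'a" where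
  "det_cols a A r t I = det (mat_of_cols 3 [col A r, col A t, omega_vec a I])"

definition condM1 :: "nat \<Rightarrow> nat \<Rightarrow> 'a::field vec \<Rightarrow> 'a mat \<Rightarrow> bool" where
  "condM1 n k a A \<longleftrightarrow>
     (\<forall>I\<in>subsets_of_card n (k - 2). \<forall>r t. r < t \<and> t < 3 \<longrightarrow> det_cols a A r t I \<noteq> 0)"

definition condM2 :: "nat \<Rightarrow> nat \<Rightarrow> 'a::field vec \<Rightarrow> 'a mat \<Rightarrow> bool" where
  "condM2 n k a A \<longleftrightarrow>
     (\<forall>J\<in>subsets_of_card n (k - 1). \<forall>r<3. col A r \<bullet> gamma_vec a J \<noteq> 0)"

definition condN1 :: "nat \<Rightarrow> nat \<Rightarrow> 'a::field vec \<Rightarrow> 'a mat \<Rightarrow> bool" where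
  "condN1 n k a A \<longleftrightarrow>
     (\<exists>I\<in>subsets_of_card n (k - 2). \<exists>r t. r < t \<and> t < 3 \<and> det_cols a A r t I = 0) \<or>
     (\<exists>J\<in>subsets_of_card n (k - 1). \<exists>r<3. col A r \<bullet> gamma_vec a J = 0)"

definition condN2 :: "nat \<Rightarrow> nat \<Rightarrow> 'a::field vec \<Rightarrow> 'a mat \<Rightarrow> bool" where
  "condN2 n k a A \<longleftrightarrow>
     (\<forall>J\<in>subsets_of_card n (k - 1). card {r. r < 3 \<and> col A r \<bullet> gamma_vec a J = 0} \<le> 1)"

definition condD :: "nat \<Rightarrow> nat \<Rightarrow> 'a::field vec \<Rightarrow> bool" where
  "condD n k a \<longleftrightarrow>
     (\<forall>I\<in>subsets_of_card n (k - 2). e1 a I \<noteq> 0 \<and> (e1 a I)\<^sup>2 - e2 a I \<noteq> 0) \<and>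
     (\<forall>J\<in>subsets_of_card n (k - 1). e1 a J \<noteq> 0 \<and> e2 a J \<noteq> 0)"


section \<open>The conclusion for given data\<close>

definition lcd_GRL_and_eaqecc ::
  "nat \<Rightarrow> nat \<Rightarrow> nat \<Rightarrow> nat \<Rightarrow> nat \<Rightarrow> nat \<Rightarrow> 'a::{field,finite} vec \<Rightarrow> nat \<Rightarrow> bool" where
  "lcd_GRL_and_eaqecc p e l n s k a d \<longleftrightarrow>
     (\<exists>C. is_GRL_code n s k a C \<and> linear_code (n + s) k d C \<and> galois_lcd p l (n + s) C \<and>
        maximally_entangled_eaqecc_exists CARD('a) (n + s) k d (n + s - k) \<and>
        (e = 2 * l \<longrightarrow> hermitian_lcd p e (n + s) C \<and>
           maximally_entangled_eaqecc_exists (p ^ l) (n + s) k d (n + s - k)))"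

end

theory Submission
  imports
    Defs
    "HOL-Library.Function_Algebras"
    "HOL-Library.Product_Plus"
    "HOL-Number_Theory.Residues"
begin

text \<open>
  The minimum distance of a generalized Roth-Lempel code does not depend on the multipliers \<open>v\<close>,
  and every evaluation vector and matrix admit multipliers making the code Galois LCD: with the
  first \<open>k\<close> coordinates as information set, the Gram matrix is a fixed matrix plus the diagonal
  matrix of the norms \<open>v\<^sub>j ^ (p\<^sup>l + 1)\<close>, and as \<open>q > 4\<close> these norms take two nonzero values, between
  which one can choose coordinate by coordinate so that the sum is nonsingular. The distances follow
  from expanding \<open>\<Prod>(x - a\<^sub>i)\<close> over the zeros of a polynomial with at least \<open>k - 2\<close> zeros.

  For the quantum codes, let \<open>C\<close> be an additive code of size \<open>Q ^ (2 K)\<close> with trivial intersection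
  with its symplectic complement \<open>C'\<close>. Take maximal isotropic subgroups of \<open>C\<close> and \<open>C'\<close>; their sum
  is Lagrangian, hence transversal to a product of isotropic lines, one per coordinate, so it is the
  graph of a symmetric map \<open>\<gamma>\<close>. The encoding unitary is then explicit, a Fourier kernel
  multiplied by quadratic phases, and the Knill-Laflamme condition becomes a character sum that
  vanishes unless some \<open>t + \<gamma> t + h\<close> in \<open>C\<close> is supported on the error positions.
  The \<open>q\<close>-ary codes come from \<open>C \<times> C ^ (p\<^sup>l)\<close>, the \<open>p\<^sup>l\<close>-ary ones from the Hermitian form on \<open>C\<close> itself.
\<close>

section \<open>Characters of finite abelian groups\<close>

text \<open>Characters with values on the unit circle replace forms over a prime field, so one
  argument serves two alphabets: pairs over F_q with the determinant form, and F_(r^2) with x y^r -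
  x^r y. In both, one coordinate is a group of order Q^2 with at least Q isotropic subgroups of
  order Q meeting pairwise in 0. An isotropic subgroup has at most Q - 1 nonzero elements, so it
  misses one of these lines; this pigeonhole is the source of transversality, one coordinate at a
  time. Because c = N - K, every qudit that is not logical is half of a pair. The trace over these
  halves kills each error component outside C, and the nonzero elements of C have weight at least d,
  more than an error with fewer than d positions can reach. The bound q > 4 enters through the norm
  x^(r+1), where r^2 \<le> q: in F_4 with r = 2 it is 1 at every nonzero x, whereas q > 4 gives r +
  1 < q - 1 and hence a second value. Distances come from a trade: each root among the evaluation
  points costs one coordinate, but many roots pin down the top coefficients of the polynomial and
  with them the s additional coordinates.\<close>

definition add_subgroup :: "'v::ab_group_add set \<Rightarrow> bool" where
  "add_subgroup H \<longleftrightarrow> 0 \<in> H \<and> (\<forall>x\<in>H. \<forall>y\<in>H. x - y \<in> H)"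

lemma add_subgroupD:
  assumes "add_subgroup H"
  shows "0 \<in> H" "\<And>x y. x \<in> H \<Longrightarrow> y \<in> H \<Longrightarrow> x - y \<in> H"
    "\<And>x. x \<in> H \<Longrightarrow> - x \<in> H" "\<And>x y. x \<in> H \<Longrightarrow> y \<in> H \<Longrightarrow> x + y \<in> H"
proof -
  show 0: "0 \<in> H" and 1: "\<And>x y. x \<in> H \<Longrightarrow> y \<in> H \<Longrightarrow> x - y \<in> H"
    using assms by (auto simp: add_subgroup_def)
  show 2: "- x \<in> H" if "x \<in> H" for x using 1[OF 0 that] by simp
  show "x + y \<in> H" if "x \<in> H" "y \<in> H" for x y using 1[OF that(1) 2[OF that(2)]] by simp
qed

definition set_sum :: "'v::ab_group_add set \<Rightarrow> 'v set \<Rightarrow> 'v set" where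
  "set_sum A B = {x + y | x y. x \<in> A \<and> y \<in> B}"

lemma set_sumI: "x \<in> A \<Longrightarrow> y \<in> B \<Longrightarrow> x + y \<in> set_sum A B"
  by (auto simp: set_sum_def)

lemma set_sumE:
  assumes "z \<in> set_sum A B" obtains x y where "x \<in> A" "y \<in> B" "z = x + y"
  using assms by (auto simp: set_sum_def)

lemma add_subgroup_set_sum:
  assumes "add_subgroup A" "add_subgroup B" shows "add_subgroup (set_sum A B)"
  unfolding add_subgroup_def
proof (intro conjI ballI)
  show "0 \<in> set_sum A B"
    using set_sumI[OF add_subgroupD(1)[OF assms(1)] add_subgroupD(1)[OF assms(2)]] by simp
  fix u v assume "u \<in> set_sum A B" "v \<in> set_sum A B"
  then obtain a b a' b' where "a \<in> A" "b \<in> B" "a' \<in> A" "b' \<in> B" and e: "u = a + b" "v = a' + b'"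
    by (auto elim!: set_sumE)
  then have "(a - a') + (b - b') \<in> set_sum A B"
    by (intro set_sumI add_subgroupD(2)[OF assms(1)] add_subgroupD(2)[OF assms(2)])
  moreover have "(a - a') + (b - b') = u - v" using e by (simp add: algebra_simps)
  ultimately show "u - v \<in> set_sum A B" by simp
qed

lemma direct_sum_inj:
  assumes "add_subgroup A" "add_subgroup B" "A \<inter> B = {0}"
    and "a \<in> A" "a' \<in> A" "b \<in> B" "b' \<in> B" "a + b = a' + b'"
  shows "a = a' \<and> b = b'"
proof -
  have e: "a - a' = b' - b" using assms(8) by (simp add: algebra_simps)
  have "a - a' \<in> A \<inter> B"
    using add_subgroupD(2)[OF assms(1,4,5)] add_subgroupD(2)[OF assms(2,7,6)] e by auto
  then show ?thesis using e assms(3) by auto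
qed

lemma card_set_sum:
  assumes "add_subgroup A" "add_subgroup B" "A \<inter> B = {0}"
  shows "card (set_sum A B) = card A * card B"
proof -
  have "inj_on (\<lambda>(x, y). x + y) (A \<times> B)"
    using direct_sum_inj[OF assms] by (auto intro!: inj_onI)
  moreover have "set_sum A B = (\<lambda>(x, y). x + y) ` (A \<times> B)"
    by (auto simp: set_sum_def)
  ultimately show ?thesis by (simp add: card_image card_cartesian_product)
qed

text \<open>All fibres are translates of the kernel.\<close>

lemma card_image_kernel:
  fixes f :: "'v::ab_group_add \<Rightarrow> 'w::ab_group_add"
  assumes A: "add_subgroup A" "finite A"
    and add: "\<And>x y. x \<in> A \<Longrightarrow> y \<in> A \<Longrightarrow> f (x + y) = f x + f y"
  shows "card A = card (f ` A) * card {x \<in> A. f x = 0}"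
proof -
  have fib: "card {x \<in> A. f x = f a} = card {x \<in> A. f x = 0}" if a: "a \<in> A" for a
  proof (rule bij_betw_same_card[symmetric, of "\<lambda>x. x + a"], rule bij_betw_byWitness[where f' = "\<lambda>x. x - a"])
    have minus: "f (x - a) = f x - f a" if "x \<in> A" for x
      using add[OF add_subgroupD(2)[OF A(1) that a] a] by simp
    show "(\<lambda>x. x + a) ` {x \<in> A. f x = 0} \<subseteq> {x \<in> A. f x = f a}"
      using a add add_subgroupD(4)[OF A(1)] by auto
    show "(\<lambda>x. x - a) ` {x \<in> A. f x = f a} \<subseteq> {x \<in> A. f x = 0}"
      using a minus add_subgroupD(2)[OF A(1)] by auto
  qed auto
  have "card A = (\<Sum>y\<in>f ` A. card {x \<in> A. f x = y})"
    using card_eq_sum sum.image_gen[OF A(2), of "\<lambda>_. 1::nat" f] by simp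
  also have "\<dots> = (\<Sum>y\<in>f ` A. card {x \<in> A. f x = 0})"
    using fib by (intro sum.cong) auto
  finally show ?thesis by simp
qed

text \<open>Translation by a multiplies the sum by \<open>f a\<close>, which is not 1.\<close>

lemma character_sum_zero:
  fixes f :: "'v::ab_group_add \<Rightarrow> complex"
  assumes A: "add_subgroup A"
    and mult: "\<And>x y. x \<in> A \<Longrightarrow> y \<in> A \<Longrightarrow> f (x + y) = f x * f y"
    and a: "a \<in> A" "f a \<noteq> 1"
  shows "sum f A = 0"
proof -
  have "sum f A = (\<Sum>x\<in>A. f (x + a))"
    by (rule sum.reindex_bij_witness[where i = "\<lambda>x. x + a" and j = "\<lambda>x. x - a"])
      (use add_subgroupD[OF A] a in auto)
  also have "\<dots> = f a * sum f A"
    using mult[OF _ a(1)] by (simp add: sum_distrib_left mult.commute)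
  finally have "(1 - f a) * sum f A = 0" by (simp add: algebra_simps)
  then show ?thesis using a by simp
qed

text \<open>A form composed with an additive character: x and y are orthogonal when
  \<open>B x y = 1\<close>. Only additivity is kept, so no base field or basis has to be
  fixed.\<close>

definition bichar :: "('v::ab_group_add \<Rightarrow> 'v \<Rightarrow> complex) \<Rightarrow> bool" where
  "bichar B \<longleftrightarrow> (\<forall>x y z. B (x + y) z = B x z * B y z) \<and>
     (\<forall>x y z. B x (y + z) = B x y * B x z) \<and> (\<forall>x y. cmod (B x y) = 1)"

lemma bicharD:
  assumes "bichar B"
  shows "B (x + y) z = B x z * B y z" "B x (y + z) = B x y * B x z" "cmod (B x y) = 1"
    "B x y \<noteq> 0" "B 0 y = 1" "B x 0 = 1" "B (- x) y = cnj (B x y)" "B x (- y) = cnj (B x y)"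
    "B (x - y) z = B x z * cnj (B y z)" "B x (y - z) = B x y * cnj (B x z)"
    "cnj (B x y) * B x y = 1" "B x y * cnj (B x y) = 1"
proof -
  show 1: "B (x + y) z = B x z * B y z" and 2: "B x (y + z) = B x y * B x z" 
    and 3: "cmod (B x y) = 1" for x y z
    using assms by (auto simp: bichar_def)
  show 4: "B x y \<noteq> 0" for x y using 3[of x y] by auto
  show 5: "B 0 y = 1" for y using 1[of 0 0 y] 4[of 0 y] by simp
  show 6: "B x 0 = 1" for x using 2[of x 0 0] 4[of x 0] by simp
  show 7: "B x y * cnj (B x y) = 1" for x y
    using 3[of x y] complex_norm_square[of "B x y"] by simp
  then show "cnj (B x y) * B x y = 1" by (simp add: mult.commute)
  have inv: "w = cnj (B x y)" if "w * B x y = 1" for w x y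
  proof -
    have "w = w * (B x y * cnj (B x y))" by (simp add: 7)
    also have "\<dots> = (w * B x y) * cnj (B x y)" by (simp only: mult.assoc)
    finally show ?thesis using that by simp
  qed
  show 8: "B (- x) y = cnj (B x y)" for x y
    using 1[of "-x" x y] 5 by (intro inv) simp
  show 9: "B x (- y) = cnj (B x y)" for x y
    using 2[of x "-y" y] 6 by (intro inv) simp
  show "B (x - y) z = B x z * cnj (B y z)" using 1[of x "-y" z] 8 by simp
  show "B x (y - z) = B x y * cnj (B x z)" using 2[of x y "-z"] 9 by simp
qed

text \<open>Double counting of the sum of B over all pairs: each inner sum is a full cardinality or
  0. This stands in for dimension formulas; it gives the size of orthogonal complements, the bound
  on isotropic subgroups and the equality of the left and right radicals.\<close>

lemma pairing_count:
  assumes B: "bichar B" and A: "add_subgroup A" "finite A" and A': "add_subgroup A'" "finite A'"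
  shows "card A * card {y \<in> A'. \<forall>x\<in>A. B x y = 1} = card A' * card {x \<in> A. \<forall>y\<in>A'. B x y = 1}"
proof -
  have 1: "(\<Sum>x\<in>A. B x y) = (if \<forall>x\<in>A. B x y = 1 then of_nat (card A) else 0)" for y
    using character_sum_zero[OF A(1), of "\<lambda>x. B x y"] bicharD(1)[OF B] by auto
  have 2: "(\<Sum>y\<in>A'. B x y) = (if \<forall>y\<in>A'. B x y = 1 then of_nat (card A') else 0)" for x
    using character_sum_zero[OF A'(1), of "\<lambda>y. B x y"] bicharD(2)[OF B] by auto
  have "of_nat (card A * card {y \<in> A'. \<forall>x\<in>A. B x y = 1}) = (\<Sum>y\<in>A'. \<Sum>x\<in>A. B x y)"
    unfolding 1 using A'(2) by (simp add: sum.If_cases Int_def)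
  also have "\<dots> = (\<Sum>x\<in>A. \<Sum>y\<in>A'. B x y)" by (rule sum.swap)
  also have "\<dots> = of_nat (card A' * card {x \<in> A. \<forall>y\<in>A'. B x y = 1})"
    unfolding 2 using A(2) by (simp add: sum.If_cases Int_def)
  finally show ?thesis by (simp only: of_nat_eq_iff)
qed

text \<open>An isotropic subgroup of greatest size contains every y of C orthogonal to it, since
  otherwise y could be adjoined. Being its own annihilator in C is what later makes its size the
  square root of that of C.\<close>

lemma maximal_isotropic_exists:
  assumes B: "bichar B" and alt: "\<And>x. B x x = 1" and C: "add_subgroup C" "finite C"
  obtains L where "add_subgroup L" "L \<subseteq> C" "L = {y \<in> C. \<forall>x\<in>L. B x y = 1}"
proof -
  define iso where "iso L \<longleftrightarrow> add_subgroup L \<and> L \<subseteq> C \<and> (\<forall>x\<in>L. \<forall>y\<in>L. B x y = 1)" for L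
  have sym1: "B y x = 1" if "B x y = 1" for x y
    using alt[of "x + y"] that alt[of x] alt[of y] by (simp add: bicharD(1,2)[OF B])
  have "iso {0}" using add_subgroupD(1)[OF C(1)]
    by (simp add: iso_def add_subgroup_def bicharD(5)[OF B])
  moreover have "card L < Suc (card C)" if "iso L" for L
    using that card_mono[OF C(2)] by (simp add: iso_def less_Suc_eq_le)
  ultimately obtain L where L: "iso L" and max: "\<And>M. iso M \<Longrightarrow> card M \<le> card L"
    using ex_has_greatest_nat[of iso "{0}" card "Suc (card C)"] by metis
  have Liso: "\<And>x y. x \<in> L \<Longrightarrow> y \<in> L \<Longrightarrow> B x y = 1" and LC: "L \<subseteq> C" and Lgrp: "add_subgroup L"
    using L by (simp_all add: iso_def)
  have "y \<in> L" if y: "y \<in> C" and yL: "\<And>x. x \<in> L \<Longrightarrow> B x y = 1" for y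
  proof (rule ccontr)
    assume y_notin: "y \<notin> L"
    define D where "D = {w \<in> C. (\<forall>x\<in>L. B x w = 1) \<and> B y w = 1}"
    \<comment> \<open>the double annihilator of L and y, an isotropic subgroup containing both\<close>
    define M where "M = {z \<in> C. \<forall>w\<in>D. B w z = 1}"
    have MI: "z \<in> M" if "z \<in> C" "\<And>w. w \<in> D \<Longrightarrow> B w z = 1" for z
      using that by (simp add: M_def)
    have MD: "B w z = 1" if "z \<in> M" "w \<in> D" for z w
      using that by (simp add: M_def)
    have LM: "x \<in> M" if "x \<in> L" for x
    proof (rule MI)
      show "x \<in> C" using that LC by (rule subsetD[rotated])
      show "B w x = 1" if "w \<in> D" for w using that \<open>x \<in> L\<close> by (simp add: D_def sym1)
    qed
    have yM: "y \<in> M"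
      by (rule MI[OF y], rule sym1) (simp add: D_def)
    have LD: "x \<in> D" if "x \<in> L" for x
      using that LC Liso sym1[OF yL[OF that]] by (simp add: D_def subset_iff)
    have yD: "y \<in> D" using y yL alt by (simp add: D_def)
    \<comment> \<open>M annihilates D, and D contains L and y, so M lies in D and therefore
      annihilates itself.\<close>
    have "x \<in> D" if "x \<in> M" for x
      using MD[OF that LD] MD[OF that yD] that by (simp add: D_def M_def)
    then have iso: "\<And>x z. x \<in> M \<Longrightarrow> z \<in> M \<Longrightarrow> B x z = 1" using MD by metis
    have MC: "M \<subseteq> C" by (simp add: M_def)
    have "add_subgroup M"
      using add_subgroupD(1,2)[OF C(1)] by (simp add: add_subgroup_def M_def bicharD[OF B])
    then have "card M \<le> card L" using MC iso by (intro max) (simp add: iso_def)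
    moreover have "L \<subset> M" using LM yM y_notin by (metis psubsetI subsetI)
    then have "card L < card M"
      using finite_subset[OF MC C(2)] by (rule psubset_card_mono[rotated])
    ultimately show False by simp
  qed
  then have "L = {y \<in> C. \<forall>x\<in>L. B x y = 1}" using LC Liso by auto
  then show ?thesis by (rule that[OF Lgrp LC])
qed

section \<open>Symplectic groups with isotropic lines\<close>

text \<open>Words of length N are functions that vanish from N on, so the pointwise group structure
  on functions can be used and words supported on the first m coordinates are words of length N as
  well.\<close>

definition box :: "nat \<Rightarrow> (nat \<Rightarrow> 'g::zero set) \<Rightarrow> (nat \<Rightarrow> 'g) set" where
  "box N S = {x. (\<forall>i<N. x i \<in> S i) \<and> (\<forall>i\<ge>N. x i = 0)}"

definition prod_char :: "nat \<Rightarrow> ('g \<Rightarrow> 'g \<Rightarrow> complex) \<Rightarrow> (nat \<Rightarrow> 'g) \<Rightarrow> (nat \<Rightarrow> 'g) \<Rightarrow> complex" where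
  "prod_char N \<beta> x y = (\<Prod>i<N. \<beta> (x i) (y i))"

definition weight :: "nat \<Rightarrow> (nat \<Rightarrow> 'g::zero) \<Rightarrow> nat" where
  "weight N x = card {i. i < N \<and> x i \<noteq> 0}"

lemma box_eq_image:
  "box N S = (\<lambda>f i. if i < N then f i else 0) ` (PiE {..<N} S)"
proof
  show "box N S \<subseteq> (\<lambda>f i. if i < N then f i else 0) ` (PiE {..<N} S)"
  proof
    fix x assume x: "x \<in> box N S"
    then have "x = (\<lambda>i. if i < N then restrict x {..<N} i else 0)"
      by (auto simp: box_def fun_eq_iff)
    moreover have "restrict x {..<N} \<in> PiE {..<N} S" using x by (auto simp: box_def)
    ultimately show "x \<in> (\<lambda>f i. if i < N then f i else 0) ` (PiE {..<N} S)" by blast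
  qed
qed (auto simp: box_def PiE_def)

lemma box_inj: "inj_on (\<lambda>f i. if i < N then f i else 0) (PiE {..<N} S)"
proof (rule inj_onI)
  fix f g assume f: "f \<in> PiE {..<N} S" "g \<in> PiE {..<N} S"
    and e: "(\<lambda>i. if i < N then f i else 0) = (\<lambda>i. if i < N then g i else 0)"
  show "f = g"
  proof (rule PiE_ext[OF f])
    fix i assume "i \<in> {..<N}"
    then show "f i = g i" using fun_cong[OF e, of i] by simp
  qed
qed

lemma card_box: "card (box N S) = (\<Prod>i<N. card (S i))"
  unfolding box_eq_image by (simp add: card_image[OF box_inj] card_PiE)

lemma finite_box:
  fixes S :: "nat \<Rightarrow> 'g::{zero,finite} set"
  shows "finite (box N S)"
  unfolding box_eq_image by (intro finite_imageI finite_PiE) auto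

lemma add_subgroup_box:
  fixes S :: "nat \<Rightarrow> 'g::ab_group_add set"
  assumes "\<And>i. i < N \<Longrightarrow> add_subgroup (S i)"
  shows "add_subgroup (box N S)"
  using assms by (auto simp: add_subgroup_def box_def)

lemma add_subgroup_UNIV: "add_subgroup UNIV"
  by (simp add: add_subgroup_def)

lemma bichar_prod_char: "bichar \<beta> \<Longrightarrow> bichar (prod_char N \<beta>)"
  by (auto simp: bichar_def prod_char_def prod.distrib norm_mult simp flip: prod_norm)

lemma prod_char_single:
  assumes "bichar \<beta>" "\<And>j. j < N \<Longrightarrow> j \<noteq> i \<Longrightarrow> \<beta> (x j) (y j) = 1" "i < N"
  shows "prod_char N \<beta> x y = \<beta> (x i) (y i)"
proof -
  have "prod_char N \<beta> x y = \<beta> (x i) (y i) * (\<Prod>j\<in>{..<N} - {i}. \<beta> (x j) (y j))"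
    unfolding prod_char_def using assms(3) by (intro prod.remove) auto
  also have "(\<Prod>j\<in>{..<N} - {i}. \<beta> (x j) (y j)) = 1"
    using assms(2) by (intro prod.neutral) auto
  finally show ?thesis by simp
qed

definition single :: "nat \<Rightarrow> 'g::zero \<Rightarrow> nat \<Rightarrow> 'g" where
  "single i g = (\<lambda>j. if j = i then g else 0)"

lemma prod_char_single_right:
  assumes "bichar \<beta>" "i < N"
  shows "prod_char N \<beta> x (single i g) = \<beta> (x i) g"
  using prod_char_single[OF assms(1) _ assms(2), of x "single i g"]
  by (simp add: single_def bicharD(6)[OF assms(1)])

lemma prod_char_single_left:
  assumes "bichar \<beta>" "i < N"
  shows "prod_char N \<beta> (single i g) x = \<beta> g (x i)"
  using prod_char_single[OF assms(1) _ assms(2), of "single i g" x]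
  by (simp add: single_def bicharD(5)[OF assms(1)])

lemma bichar_swap:
  assumes "bichar B" "\<And>x. B x x = 1"
  shows "B y x = cnj (B x y)"
proof -
  have "B x y * B y x = 1"
    using assms(2)[of "x + y"] assms(2)[of x] assms(2)[of y]
    by (simp add: bicharD(1,2)[OF assms(1)] mult.commute)
  then have "cnj (B x y) * (B x y * B y x) = cnj (B x y)" by simp
  then show ?thesis by (simp add: bicharD(11)[OF assms(1)] mult.assoc[symmetric])
qed

text \<open>The alphabet of errors at one coordinate. \<open>Lines\<close> is a partial spread of
  maximal isotropic subgroups: the lines y = m x in the plane over F_q, or the F_r-lines in
  F_(r^2).\<close>

locale symplectic_group =
  fixes \<beta> :: "'g::{ab_group_add,finite} \<Rightarrow> 'g \<Rightarrow> complex" and Lines :: "'g set set" and Q :: nat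
  assumes bichar: "bichar \<beta>"
    and alt: "\<beta> g g = 1"
    and nondeg: "(\<And>h. \<beta> g h = 1) \<Longrightarrow> g = 0"
    and card_g: "CARD('g) = Q\<^sup>2"
    and Q2: "2 \<le> Q"
    and lines_card: "Q \<le> card Lines"
    and lines_subgroup: "\<l> \<in> Lines \<Longrightarrow> add_subgroup \<l>"
    and lines_size: "\<l> \<in> Lines \<Longrightarrow> card \<l> = Q"
    and lines_isotropic: "\<l> \<in> Lines \<Longrightarrow> g \<in> \<l> \<Longrightarrow> h \<in> \<l> \<Longrightarrow> \<beta> g h = 1"
    and lines_disjoint: "\<l> \<in> Lines \<Longrightarrow> \<l>' \<in> Lines \<Longrightarrow> \<l> \<noteq> \<l>' \<Longrightarrow> \<l> \<inter> \<l>' = {0}"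
begin

abbreviation "V N \<equiv> box N (\<lambda>_. UNIV :: 'g set)"
abbreviation "B N \<equiv> prod_char N \<beta>"

lemma B_alt: "B N x x = 1"
  by (simp add: prod_char_def alt)

lemma B_bichar: "bichar (B N)"
  by (rule bichar_prod_char[OF bichar])

lemma B_swap: "B N y x = cnj (B N x y)"
  by (rule bichar_swap[OF B_bichar B_alt])

lemma B_sym1: "B N x y = 1 \<Longrightarrow> B N y x = 1"
  using B_swap[of N x y] by simp

lemma V_subgroup: "add_subgroup (V N)"
  by (rule add_subgroup_box) (rule add_subgroup_UNIV)

lemma finite_V: "finite (V N)"
  by (rule finite_box)

lemma card_V: "card (V N) = Q ^ (2 * N)"
  by (simp add: card_box card_g power_mult)

lemma V_nondeg:
  assumes "x \<in> V N" "\<And>y. y \<in> V N \<Longrightarrow> B N x y = 1" shows "x = 0"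
proof
  fix i show "x i = 0 i"
  proof (cases "i < N")
    case True
    have "x i = 0"
    proof (rule nondeg)
      fix h
      have "single i h \<in> V N" using True by (auto simp: box_def single_def)
      from assms(2)[OF this] show "\<beta> (x i) h = 1"
        by (simp add: prod_char_single_right[OF bichar True])
    qed
    then show ?thesis by simp
  qed (use assms(1) in \<open>auto simp: box_def\<close>)
qed

definition perp :: "nat \<Rightarrow> (nat \<Rightarrow> 'g) set \<Rightarrow> (nat \<Rightarrow> 'g) set" where
  "perp N A = {y \<in> V N. \<forall>x\<in>A. B N x y = 1}"

lemma perp_subgroup: "add_subgroup (perp N A)"
  unfolding perp_def add_subgroup_def using V_subgroup[of N, unfolded add_subgroup_def]
  by (auto simp: bicharD[OF B_bichar])

lemma perp_sub: "perp N A \<subseteq> V N"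
  by (auto simp: perp_def)

lemma card_perp:
  assumes "add_subgroup A" "A \<subseteq> V N"
  shows "card A * card (perp N A) = Q ^ (2 * N)"
proof -
  have "{x \<in> A. \<forall>y\<in>V N. B N x y = 1} = {0}"
    using assms V_nondeg add_subgroupD(1)[OF assms(1)] by (auto simp: bicharD[OF B_bichar])
  with pairing_count[OF B_bichar assms(1) finite_subset[OF assms(2) finite_V] V_subgroup finite_V]
  show ?thesis by (simp add: perp_def card_V)
qed

text \<open>A lies in its own annihilator, and the two sizes multiply to Q squared.\<close>

lemma isotropic_card:
  assumes "add_subgroup A" "\<And>g h. g \<in> A \<Longrightarrow> h \<in> A \<Longrightarrow> \<beta> g h = 1"
  shows "card A \<le> Q"
proof -
  have "{x \<in> A. \<forall>y\<in>UNIV. \<beta> x y = 1} = {0}"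
    using nondeg add_subgroupD(1)[OF assms(1)] by (auto simp: bicharD[OF bichar])
  with pairing_count[OF bichar assms(1) _ add_subgroup_UNIV]
  have "card A * card {y. \<forall>x\<in>A. \<beta> x y = 1} = Q\<^sup>2" by (simp add: card_g)
  moreover have "card A \<le> card {y. \<forall>x\<in>A. \<beta> x y = 1}"
    using assms(2) by (intro card_mono) auto
  then have "card A * card A \<le> card A * card {y. \<forall>x\<in>A. \<beta> x y = 1}" by (rule mult_le_mono2)
  ultimately have "(card A)\<^sup>2 \<le> Q\<^sup>2" by (simp add: power2_eq_square)
  then show ?thesis by (simp add: power2_nat_le_eq_le)
qed

text \<open>Otherwise choosing a nonzero element of A on each line would be injective, as different
  lines share only 0, giving Q nonzero elements in a subgroup of order at most Q.\<close>

lemma avoiding_line: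
  assumes "add_subgroup A" "\<And>g h. g \<in> A \<Longrightarrow> h \<in> A \<Longrightarrow> \<beta> g h = 1"
  shows "\<exists>\<l>\<in>Lines. A \<inter> \<l> = {0}"
proof (rule ccontr)
  assume "\<not> ?thesis"
  then have "\<exists>g. g \<in> A \<inter> \<l> - {0}" if "\<l> \<in> Lines" for \<l>
    using that add_subgroupD(1)[OF assms(1)] add_subgroupD(1)[OF lines_subgroup[OF that]] by blast
  then obtain f where f: "\<And>\<l>. \<l> \<in> Lines \<Longrightarrow> f \<l> \<in> A \<inter> \<l> - {0}" by metis
  have "inj_on f Lines"
    using f lines_disjoint by (intro inj_onI) (metis DiffE IntE IntI)
  then have "card Lines \<le> card (A - {0})"
    by (rule card_inj_on_le) (use f in auto)
  also have "\<dots> < card A"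
    using add_subgroupD(1)[OF assms(1)] by (intro psubset_card_mono) auto
  also have "\<dots> \<le> Q" by (rule isotropic_card[OF assms])
  finally show False using lines_card by simp
qed

lemma other_line:
  assumes "\<l> \<in> Lines" shows "\<exists>\<l>'\<in>Lines. \<l> \<inter> \<l>' = {0}"
proof -
  have "Lines - {\<l>} \<noteq> {}"
  proof
    assume "Lines - {\<l>} = {}"
    then have "Lines = {\<l>}" using assms by auto
    then show False using lines_card Q2 by simp
  qed
  then show ?thesis using lines_disjoint[OF assms] by blast
qed

text \<open>The two lines together span the whole group, and g is orthogonal to its own line anyway,
  so nondegeneracy applies.\<close>

lemma line_annihilator:
  assumes "\<l> \<in> Lines" "\<l>' \<in> Lines" "\<l> \<inter> \<l>' = {0}" "g \<in> \<l>" "\<And>h. h \<in> \<l>' \<Longrightarrow> \<beta> g h = 1"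
  shows "g = 0"
proof (rule nondeg)
  fix h
  have "card (set_sum \<l> \<l>') = CARD('g)"
    using card_set_sum[OF lines_subgroup[OF assms(1)] lines_subgroup[OF assms(2)] assms(3)]
    by (simp add: lines_size assms card_g power2_eq_square)
  then have "set_sum \<l> \<l>' = UNIV" by (metis card_subset_eq finite subset_UNIV)
  then obtain a b where "a \<in> \<l>" "b \<in> \<l>'" "h = a + b" by (metis UNIV_I set_sumE)
  then show "\<beta> g h = 1"
    using assms lines_isotropic by (simp add: bicharD[OF bichar])
qed

text \<open>Induction on the number of coordinates already given a line. W consists of the words of
  L that follow the chosen lines before m and vanish after m. Two such words pair trivially at every
  position other than m, so their entries at m form an isotropic subgroup A, and a line avoiding A
  extends the choice: a word of L in the larger box has entry 0 at m and falls back into the smaller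
  one.\<close>

lemma transversal_lines:
  assumes L: "add_subgroup L" "\<And>x y. x \<in> L \<Longrightarrow> y \<in> L \<Longrightarrow> B N x y = 1"
  shows "m \<le> N \<Longrightarrow> \<exists>S. (\<forall>i. S i \<in> Lines) \<and> L \<inter> box m S = {0}"
proof (induction m)
  case 0
  have "Lines \<noteq> {}" using lines_card Q2 by auto
  then obtain \<l> where "\<l> \<in> Lines" by blast
  moreover have "L \<inter> box 0 (\<lambda>_. \<l>) = {0}"
    using add_subgroupD(1)[OF L(1)] by (auto simp: box_def)
  ultimately show ?case by (intro exI[of _ "\<lambda>_. \<l>"] conjI allI)
next
  case (Suc m)
  then obtain S where S: "\<And>i. S i \<in> Lines" "L \<inter> box m S = {0}"
    using Suc_leD by blast
  define W where "W = {u \<in> L. (\<forall>i<m. u i \<in> S i) \<and> (\<forall>i>m. u i = 0)}"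
  define A where "A = (\<lambda>u. u m) ` W"
  have W: "add_subgroup W"
    using L(1) lines_subgroup[OF S(1)] by (simp add: add_subgroup_def W_def)
  have "add_subgroup A"
    unfolding add_subgroup_def
  proof (intro conjI ballI)
    show "0 \<in> A"
      unfolding A_def by (rule image_eqI[OF _ add_subgroupD(1)[OF W]]) simp
    fix x y assume "x \<in> A" "y \<in> A"
    then obtain u v where "u \<in> W" "v \<in> W" "x = u m" "y = v m" by (auto simp: A_def)
    moreover have "(u - v) m \<in> A"
      unfolding A_def by (intro imageI add_subgroupD(2)[OF W] \<open>u \<in> W\<close> \<open>v \<in> W\<close>)
    ultimately show "x - y \<in> A" by simp
  qed
  moreover have "\<beta> g h = 1" if gh: "g \<in> A" "h \<in> A" for g h
  proof -
    obtain u v where uv: "u \<in> W" "v \<in> W" "g = u m" "h = v m" using gh by (auto simp: A_def)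
    have "B N u v = \<beta> (u m) (v m)"
    proof (rule prod_char_single[OF bichar])
      show "m < N" using Suc.prems by simp
      fix j assume "j < N" "j \<noteq> m"
      then show "\<beta> (u j) (v j) = 1"
        using uv lines_isotropic[OF S(1)[of j]] bicharD(5)[OF bichar]
        by (cases "j < m") (auto simp: W_def)
    qed
    then show ?thesis using uv L(2) by (auto simp: W_def)
  qed
  ultimately obtain \<l> where \<l>: "\<l> \<in> Lines" "A \<inter> \<l> = {0}" using avoiding_line by blast
  let ?S = "S(m := \<l>)"
  have "x = 0" if x: "x \<in> L" "x \<in> box (Suc m) ?S" for x
  proof -
    have "x \<in> W" using x by (auto simp: W_def box_def less_Suc_eq)
    then have "x m \<in> A \<inter> \<l>" using x by (auto simp: A_def box_def)
    then have xm: "x m = 0" using \<l> by auto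
    have "x i = 0" if "i \<ge> m" for i
      using xm x(2) that by (cases "i = m") (auto simp: box_def)
    moreover have "x i \<in> S i" if "i < m" for i
      using x(2) that by (auto simp: box_def dest!: spec[of _ i])
    ultimately have "x \<in> box m S" by (simp add: box_def)
    then show "x = 0" using x S(2) by auto
  qed
  moreover have "0 \<in> box (Suc m) ?S"
    using add_subgroupD(1)[OF lines_subgroup] S(1) \<l>(1) by (simp add: box_def)
  ultimately have "L \<inter> box (Suc m) ?S = {0}"
    using add_subgroupD(1)[OF L(1)] by (intro equalityI subsetI) auto
  moreover have "\<forall>i. ?S i \<in> Lines" using S(1) \<l>(1) by simp
  ultimately show ?case by blast
qed

end

section \<open>Lagrangian subgroups and the graph form of a nondegenerate code\<close>

lemma add_subgroup_image:
  assumes A: "add_subgroup A"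
    and f: "\<And>x y. x \<in> A \<Longrightarrow> y \<in> A \<Longrightarrow> f (x - y) = f x - f y"
  shows "add_subgroup (f ` A)"
  unfolding add_subgroup_def
proof (intro conjI ballI)
  note 0 = add_subgroupD(1)[OF A]
  have "f 0 = 0" using f[OF 0 0] by simp
  then show "0 \<in> f ` A" using 0 by (metis imageI)
  fix u v assume "u \<in> f ` A" "v \<in> f ` A"
  then obtain x y where "x \<in> A" "y \<in> A" "u = f x" "v = f y" by blast
  then show "u - v \<in> f ` A" using f add_subgroupD(2)[OF A] by (metis imageI)
qed

lemma set_sum_subset:
  assumes "add_subgroup W" "A \<subseteq> W" "B \<subseteq> W" shows "set_sum A B \<subseteq> W"
proof
  fix z assume "z \<in> set_sum A B"
  then obtain x y where "x \<in> A" "y \<in> B" "z = x + y" by (rule set_sumE)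
  then show "z \<in> W" using add_subgroupD(4)[OF assms(1), of x y] assms(2,3) by auto
qed

context symplectic_group
begin

lemma box_lines_isotropic:
  assumes "\<And>i. S i \<in> Lines" "x \<in> box N S" "y \<in> box N S"
  shows "B N x y = 1"
  unfolding prod_char_def
proof (intro prod.neutral ballI)
  fix i assume "i \<in> {..<N}"
  then show "\<beta> (x i) (y i) = 1"
    using assms(2,3) by (intro lines_isotropic[OF assms(1)[of i]]) (auto simp: box_def)
qed

lemma card_box_lines: "(\<And>i. S i \<in> Lines) \<Longrightarrow> card (box N S) = Q ^ N"
  by (simp add: card_box lines_size)

lemma box_lines_subgroup: "(\<And>i. S i \<in> Lines) \<Longrightarrow> add_subgroup (box N S)"
  by (intro add_subgroup_box lines_subgroup)

lemma box_sub_V: "box N S \<subseteq> V N"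
  by (auto simp: box_def)

lemma box_disjoint:
  assumes "\<And>i. S i \<inter> T i = {0}" shows "box N S \<inter> box N T = {0}"
proof -
  have "x = 0" if x: "x \<in> box N S" "x \<in> box N T" for x
  proof
    fix i show "x i = 0 i"
      using x assms[of i] by (cases "i < N") (auto simp: box_def)
  qed
  moreover have "0 \<in> box N S" "0 \<in> box N T" using assms by (auto simp: box_def)
  ultimately show ?thesis by blast
qed

lemma V_eq_set_sum:
  assumes "add_subgroup A" "add_subgroup A'" "A \<subseteq> V N" "A' \<subseteq> V N" "A \<inter> A' = {0}"
    and "card A * card A' = Q ^ (2 * N)"
  shows "set_sum A A' = V N"
proof (rule card_subset_eq[OF finite_V])
  show "set_sum A A' \<subseteq> V N"
    by (rule set_sum_subset[OF V_subgroup assms(3,4)])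
  show "card (set_sum A A') = card (V N)"
    by (simp add: card_set_sum[OF assms(1,2,5)] card_V assms(6))
qed

text \<open>C and its complement span everything, so a vector orthogonal to both is 0. Thus the
  complement is nondegenerate too, and \<open>lagrangian_exists\<close> applies to it as
  well.\<close>

lemma perp_perp_disjoint:
  assumes C: "add_subgroup C" "C \<subseteq> V N" "C \<inter> perp N C = {0}"
  shows "perp N C \<inter> perp N (perp N C) = {0}"
proof -
  have "x = 0" if x: "x \<in> perp N C" "x \<in> perp N (perp N C)" for x
  proof (rule V_nondeg)
    show "x \<in> V N" using x perp_sub by blast
    fix y assume "y \<in> V N"
    then have "y \<in> set_sum C (perp N C)"
      using V_eq_set_sum[OF C(1) perp_subgroup C(2) perp_sub C(3) card_perp[OF C(1,2)]] by simp
    then obtain c c' where y: "c \<in> C" "c' \<in> perp N C" "y = c + c'" by (rule set_sumE)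
    have "B N c x = 1" "B N c' x = 1" using x y by (auto simp: perp_def)
    then show "B N x y = 1" using y(3) by (simp add: bicharD(2)[OF B_bichar] B_sym1)
  qed
  then show ?thesis using add_subgroupD(1)[OF perp_subgroup] by blast
qed

text \<open>For a maximal isotropic L, \<open>pairing_count\<close> with C reads
  \<open>card L * card L = card C\<close>, because no nonzero element of L is orthogonal to all of
  C.\<close>

lemma lagrangian_exists:
  assumes C: "add_subgroup C" "C \<subseteq> V N" "C \<inter> perp N C = {0}" "card C = Q ^ (2 * K)"
  obtains L where "add_subgroup L" "L \<subseteq> C" "\<And>x y. x \<in> L \<Longrightarrow> y \<in> L \<Longrightarrow> B N x y = 1" "card L = Q ^ K"
proof -
  have fin: "finite C" using C(2) finite_V by (rule finite_subset)
  obtain L where L: "add_subgroup L" "L \<subseteq> C" and eq: "L = {y \<in> C. \<forall>x\<in>L. B N x y = 1}"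
    by (rule maximal_isotropic_exists[OF B_bichar B_alt C(1) fin])
  have iso: "B N x y = 1" if "x \<in> L" "y \<in> L" for x y
    using that(1) subsetD[OF equalityD1[OF eq] that(2)] by simp
  have "x = 0" if x: "x \<in> L" "\<And>y. y \<in> C \<Longrightarrow> B N x y = 1" for x
  proof -
    have "x \<in> C \<inter> perp N C" using x C(2) L(2) B_sym1 by (auto simp: perp_def)
    then show ?thesis using C(3) by simp
  qed
  then have "{x \<in> L. \<forall>y\<in>C. B N x y = 1} = {0}"
    using add_subgroupD(1)[OF L(1)] by (auto simp: bicharD(5)[OF B_bichar])
  with pairing_count[OF B_bichar L(1) finite_subset[OF L(2) fin] C(1) fin, of N]
  have "card L * card L = (Q ^ K) * (Q ^ K)"
    using C(4) by (simp flip: eq add: mult_2 power_add)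
  then have "(card L)\<^sup>2 = (Q ^ K)\<^sup>2" by (simp only: power2_eq_square)
  then have "card L = Q ^ K" by simp
  then show ?thesis using that L iso by blast
qed

text \<open>L1 and L2 are Lagrangian in C and in its complement, and their sum L is the graph of
  \<open>\<gamma>\<close> over \<open>box N T\<close>. The images S1 and S2 of C and its complement,
  projected along L onto \<open>box N S\<close>, will label logical words and halves of pairs. The
  last clause is the only way in which C enters the error condition: a nonvanishing character sum
  over S2 certifies membership in C.\<close>

lemma graph_form:
  assumes C: "add_subgroup C" "C \<subseteq> V N" "C \<inter> perp N C = {0}" "card C = Q ^ (2 * K)" and KN: "K \<le> N"
  obtains S T \<gamma> S1 S2 \<tau> where
    "\<And>i. S i \<in> Lines" "\<And>i. T i \<in> Lines" "\<And>i. S i \<inter> T i = {0}"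
    "\<And>x. x \<in> box N T \<Longrightarrow> \<gamma> x \<in> box N S"
    "\<And>x y. x \<in> box N T \<Longrightarrow> y \<in> box N T \<Longrightarrow> \<gamma> (x + y) = \<gamma> x + \<gamma> y"
    "\<And>x y. x \<in> box N T \<Longrightarrow> y \<in> box N T \<Longrightarrow> B N x (\<gamma> y) = B N y (\<gamma> x)"
    "add_subgroup S1" "add_subgroup S2" "S1 \<subseteq> box N S" "S2 \<subseteq> box N S"
    "card S1 = Q ^ K" "card S2 = Q ^ (N - K)" "S1 \<inter> S2 = {0}"
    "\<And>z. z \<in> S2 \<Longrightarrow> \<tau> z \<in> box N T"
    "\<And>t h. t \<in> box N T \<Longrightarrow> h \<in> S1 \<Longrightarrow> (\<Sum>z\<in>S2. B N t z * B N h (\<tau> z)) \<noteq> 0 \<Longrightarrow> t + \<gamma> t + h \<in> C"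
proof -
  define C' where "C' = perp N C"
  have C': "add_subgroup C'" "C' \<subseteq> V N" "C' \<inter> perp N C' = {0}"
    unfolding C'_def using perp_subgroup perp_sub perp_perp_disjoint[OF C(1-3)] by auto
  have CC': "C \<inter> C' = {0}" using C(3) by (simp add: C'_def)
  have BCC': "B N x y = 1" "B N y x = 1" if "x \<in> C" "y \<in> C'" for x y
    using that B_sym1 by (auto simp: C'_def perp_def)
  have Q0: "0 < Q" using Q2 by simp
  have "Q ^ (2 * K) * card C' = Q ^ (2 * N)"
    using card_perp[OF C(1,2)] by (simp add: C'_def C(4))
  also have "\<dots> = Q ^ (2 * K) * Q ^ (2 * (N - K))"
    using KN by (simp flip: power_add add: algebra_simps)
  finally have cC': "card C' = Q ^ (2 * (N - K))" using Q0 by simp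
  obtain L1 where L1: "add_subgroup L1" "L1 \<subseteq> C" "\<And>x y. x \<in> L1 \<Longrightarrow> y \<in> L1 \<Longrightarrow> B N x y = 1" "card L1 = Q ^ K"
    by (rule lagrangian_exists[OF C(1-4)]) blast
  obtain L2 where L2: "add_subgroup L2" "L2 \<subseteq> C'" "\<And>x y. x \<in> L2 \<Longrightarrow> y \<in> L2 \<Longrightarrow> B N x y = 1" "card L2 = Q ^ (N - K)"
    by (rule lagrangian_exists[OF C' cC']) blast
  define L where "L = set_sum L1 L2"
  have L12: "L1 \<inter> L2 = {0}"
    using CC' L1(2) L2(2) add_subgroupD(1)[OF L1(1)] add_subgroupD(1)[OF L2(1)] by blast
  have L: "add_subgroup L" unfolding L_def by (rule add_subgroup_set_sum[OF L1(1) L2(1)])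
  have cL: "card L = Q ^ N"
    unfolding L_def card_set_sum[OF L1(1) L2(1) L12] L1(4) L2(4) using KN by (simp flip: power_add)
  have Liso: "B N x y = 1" if xy: "x \<in> L" "y \<in> L" for x y
  proof -
    obtain a b where x: "a \<in> L1" "b \<in> L2" "x = a + b" using xy(1) unfolding L_def by (rule set_sumE)
    obtain c d where y: "c \<in> L1" "d \<in> L2" "y = c + d" using xy(2) unfolding L_def by (rule set_sumE)
    have "B N a d = 1" "B N b c = 1" using BCC' x y L1(2) L2(2) by (meson subsetD)+
    then show ?thesis using x y L1(3) L2(3) by (simp add: bicharD(1,2)[OF B_bichar])
  qed
  have LV: "L \<subseteq> V N"
    unfolding L_def using L1(2) L2(2) C(2) C'(2) by (intro set_sum_subset[OF V_subgroup]) auto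
  have LC: "x \<in> L1" if x: "x \<in> L" "x \<in> C" for x
  proof -
    obtain a b where ab: "a \<in> L1" "b \<in> L2" "x = a + b" using x(1) unfolding L_def by (rule set_sumE)
    have "x - a \<in> C" using x(2) ab(1) L1(2) add_subgroupD(2)[OF C(1)] by blast
    then have "b \<in> C \<inter> C'" using ab L2(2) by auto
    then show ?thesis using CC' ab by simp
  qed
  have LC': "x \<in> L2" if x: "x \<in> L" "x \<in> C'" for x
  proof -
    obtain a b where ab: "a \<in> L1" "b \<in> L2" "x = a + b" using x(1) unfolding L_def by (rule set_sumE)
    have "x - b \<in> C'" using x(2) ab(2) L2(2) add_subgroupD(2)[OF C'(1)] by blast
    then have "a \<in> C \<inter> C'" using ab L1(2) by auto
    then show ?thesis using CC' ab by simp
  qed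
  obtain S where S: "\<And>i. S i \<in> Lines" "L \<inter> box N S = {0}"
    using transversal_lines[OF L Liso order_refl] by metis
  obtain T where T: "\<And>i. T i \<in> Lines" "\<And>i. S i \<inter> T i = {0}"
    using other_line[OF S(1)] by metis
  define Sb where "Sb = box N S"
  define X where "X = box N T"
  have Sb: "add_subgroup Sb" "Sb \<subseteq> V N" "card Sb = Q ^ N"
    unfolding Sb_def using box_lines_subgroup card_box_lines box_sub_V S(1) by auto
  have X: "add_subgroup X" "X \<subseteq> V N" "card X = Q ^ N"
    unfolding X_def using box_lines_subgroup card_box_lines box_sub_V T(1) by auto
  have Sbiso: "B N x y = 1" if "x \<in> Sb" "y \<in> Sb" for x y
    using box_lines_isotropic[OF S(1)] that by (simp add: Sb_def)
  have Xiso: "B N x y = 1" if "x \<in> X" "y \<in> X" for x y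
    using box_lines_isotropic[OF T(1)] that by (simp add: X_def)
  have LSb: "L \<inter> Sb = {0}" using S(2) by (simp add: Sb_def)
  have V1: "set_sum L Sb = V N"
    by (rule V_eq_set_sum[OF L Sb(1) LV Sb(2) LSb]) (simp add: cL Sb(3) mult_2 power_add)
  have "X \<inter> Sb = {0}" unfolding X_def Sb_def using box_disjoint[of S T N] T(2) by (simp add: Int_commute)
  then have V2: "set_sum X Sb = V N"
    by (rule V_eq_set_sum[OF X(1) Sb(1) X(2) Sb(2)]) (simp add: X(3) Sb(3) mult_2 power_add)
  have "\<forall>v\<in>V N. \<exists>s\<in>Sb. v - s \<in> L"
  proof
    fix v assume "v \<in> V N"
    then have "v \<in> set_sum L Sb" by (simp add: V1)
    then obtain l s where "l \<in> L" "s \<in> Sb" "v = l + s" by (rule set_sumE)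
    then show "\<exists>s\<in>Sb. v - s \<in> L" by (intro bexI[of _ s]) simp_all
  qed
  \<comment> \<open>Projection onto \<open>Sb\<close> along L; its kernel is L.\<close>
  then obtain \<sigma> where \<sigma>: "\<And>v. v \<in> V N \<Longrightarrow> \<sigma> v \<in> Sb" "\<And>v. v \<in> V N \<Longrightarrow> v - \<sigma> v \<in> L" by metis
  have \<sigma>_unique: "\<sigma> v = s" if "v \<in> V N" "s \<in> Sb" "v - s \<in> L" for v s
  proof -
    have "(v - s) - (v - \<sigma> v) \<in> L" using add_subgroupD(2)[OF L that(3) \<sigma>(2)[OF that(1)]] .
    moreover have "\<sigma> v - s \<in> Sb" using add_subgroupD(2)[OF Sb(1) \<sigma>(1)[OF that(1)] that(2)] .
    ultimately have "\<sigma> v - s \<in> L \<inter> Sb" by simp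
    then show ?thesis using LSb by simp
  qed
  have \<sigma>_diff: "\<sigma> (u - v) = \<sigma> u - \<sigma> v" if uv: "u \<in> V N" "v \<in> V N" for u v
  proof (rule \<sigma>_unique)
    show "u - v \<in> V N" using uv by (rule add_subgroupD(2)[OF V_subgroup])
    show "\<sigma> u - \<sigma> v \<in> Sb" using uv by (intro add_subgroupD(2)[OF Sb(1)] \<sigma>(1))
    have "(u - \<sigma> u) - (v - \<sigma> v) \<in> L" using uv by (intro add_subgroupD(2)[OF L] \<sigma>(2))
    then show "u - v - (\<sigma> u - \<sigma> v) \<in> L" by (simp add: algebra_simps)
  qed
  have \<sigma>_add: "\<sigma> (u + v) = \<sigma> u + \<sigma> v" if uv: "u \<in> V N" "v \<in> V N" for u v
  proof (rule \<sigma>_unique)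
    show "u + v \<in> V N" using uv by (rule add_subgroupD(4)[OF V_subgroup])
    show "\<sigma> u + \<sigma> v \<in> Sb" using uv by (intro add_subgroupD(4)[OF Sb(1)] \<sigma>(1))
    have "(u - \<sigma> u) + (v - \<sigma> v) \<in> L" using uv by (intro add_subgroupD(4)[OF L] \<sigma>(2))
    then show "u + v - (\<sigma> u + \<sigma> v) \<in> L" by (simp add: algebra_simps)
  qed
  have \<sigma>_0: "\<sigma> v = 0 \<longleftrightarrow> v \<in> L" if "v \<in> V N" for v
    using \<sigma>_unique[OF that add_subgroupD(1)[OF Sb(1)]] \<sigma>(2)[OF that] by auto
  have \<sigma>_Sb: "\<sigma> s = s" if "s \<in> Sb" for s
    using \<sigma>_unique[of s s] that Sb(2) add_subgroupD(1)[OF L] by auto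
  \<comment> \<open>The sign makes \<open>x + \<gamma> x = x - \<sigma> x\<close> an element of
    L.\<close>
  define \<gamma> where "\<gamma> x = - \<sigma> x" for x
  have \<gamma>Sb: "\<gamma> x \<in> Sb" if "x \<in> X" for x
    using that X(2) \<sigma>(1) add_subgroupD(3)[OF Sb(1)] by (auto simp: \<gamma>_def)
  have \<gamma>L: "x + \<gamma> x \<in> L" if "x \<in> X" for x
    using \<sigma>(2)[of x] that X(2) by (auto simp: \<gamma>_def)
  have \<gamma>_add: "\<gamma> (x + y) = \<gamma> x + \<gamma> y" if "x \<in> X" "y \<in> X" for x y
    using \<sigma>_add[OF subsetD[OF X(2) that(1)] subsetD[OF X(2) that(2)]] by (simp add: \<gamma>_def)
  \<comment> \<open>Isotropy of L, read off on its graph; the boxes themselves are isotropic, so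
    only the two cross terms survive.\<close>
  have \<gamma>_sym: "B N x (\<gamma> y) = B N y (\<gamma> x)" if xy: "x \<in> X" "y \<in> X" for x y
  proof -
    have "B N (x + \<gamma> x) (y + \<gamma> y) = 1" using xy by (intro Liso \<gamma>L)
    then have "B N x (\<gamma> y) * B N (\<gamma> x) y = 1"
      using Xiso[OF xy] Sbiso[OF \<gamma>Sb \<gamma>Sb, OF xy]
      by (simp add: bicharD(1,2)[OF B_bichar] mult.commute)
    then have "B N x (\<gamma> y) * (B N (\<gamma> x) y * cnj (B N (\<gamma> x) y)) = cnj (B N (\<gamma> x) y)"
      by (simp add: mult.assoc[symmetric])
    then have "B N x (\<gamma> y) = cnj (B N (\<gamma> x) y)" by (simp add: bicharD(12)[OF B_bichar])
    then show ?thesis using B_swap[of N y "\<gamma> x"] by simp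
  qed
  define S1 where "S1 = \<sigma> ` C"
  define S2 where "S2 = \<sigma> ` C'"
  have S1: "add_subgroup S1" "S1 \<subseteq> Sb"
    unfolding S1_def using C(2) \<sigma>(1) by (auto intro!: add_subgroup_image[OF C(1)] \<sigma>_diff)
  have S2: "add_subgroup S2" "S2 \<subseteq> Sb"
    unfolding S2_def using C'(2) \<sigma>(1) by (auto intro!: add_subgroup_image[OF C'(1)] \<sigma>_diff)
  \<comment> \<open>The kernel on C is L1, of size \<open>Q ^ K\<close>, so the image S1 of the
    \<open>Q ^ (2 * K)\<close> elements again has size \<open>Q ^ K\<close>.\<close>
  have "{x \<in> C. \<sigma> x = 0} = L1"
  proof (intro equalityI subsetI)
    fix x assume "x \<in> {x \<in> C. \<sigma> x = 0}"
    then show "x \<in> L1" using \<sigma>_0[of x] C(2) LC[of x] by auto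
  next
    fix x assume x: "x \<in> L1"
    then have "x \<in> L" unfolding L_def using set_sumI[OF x add_subgroupD(1)[OF L2(1)]] by simp
    then show "x \<in> {x \<in> C. \<sigma> x = 0}" using x L1(2) C(2) \<sigma>_0[of x] by auto
  qed
  then have "card C = card S1 * card L1"
    using card_image_kernel[OF C(1) finite_subset[OF C(2) finite_V], of \<sigma>] \<sigma>_add C(2)
    by (simp add: S1_def subset_iff)
  then have cS1: "card S1 = Q ^ K" using Q0 by (simp add: C(4) L1(4) mult_2 power_add)
  have "{x \<in> C'. \<sigma> x = 0} = L2"
  proof (intro equalityI subsetI)
    fix x assume "x \<in> {x \<in> C'. \<sigma> x = 0}"
    then show "x \<in> L2" using \<sigma>_0[of x] C'(2) LC'[of x] by auto
  next
    fix x assume x: "x \<in> L2"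
    then have "x \<in> L" unfolding L_def using set_sumI[OF add_subgroupD(1)[OF L1(1)] x] by simp
    then show "x \<in> {x \<in> C'. \<sigma> x = 0}" using x L2(2) C'(2) \<sigma>_0[of x] by auto
  qed
  then have "card C' = card S2 * card L2"
    using card_image_kernel[OF C'(1) finite_subset[OF C'(2) finite_V], of \<sigma>] \<sigma>_add C'(2)
    by (simp add: S2_def subset_iff)
  then have cS2: "card S2 = Q ^ (N - K)" using Q0 by (simp add: cC' L2(4) mult_2 power_add)
  \<comment> \<open>Preimages c in C and c' in C' of the same s differ by an element of L. Moving
    its L1 part to c and its L2 part to c' makes them equal, hence 0, so c was already in L.\<close>
  have "s = 0" if s: "s \<in> S1" "s \<in> S2" for s
  proof -
    obtain c c' where c: "c \<in> C" "s = \<sigma> c" "c' \<in> C'" "s = \<sigma> c'" using s by (auto simp: S1_def S2_def)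
    have cV: "c \<in> V N" "c' \<in> V N" using c C(2) C'(2) by auto
    then have "c - c' \<in> L" using \<sigma>_0[of "c - c'"] \<sigma>_diff[of c c'] c add_subgroupD(2)[OF V_subgroup] by simp
    then obtain a b where ab: "a \<in> L1" "b \<in> L2" "c - c' = a + b" unfolding L_def by (rule set_sumE)
    have "c - a = c' + b" using ab(3) by (simp add: algebra_simps)
    moreover have "c - a \<in> C" using c(1) ab(1) L1(2) add_subgroupD(2)[OF C(1)] by blast
    moreover have "c' + b \<in> C'" using c(3) ab(2) L2(2) add_subgroupD(4)[OF C'(1)] by blast
    ultimately have "c - a \<in> C \<inter> C'" by simp
    then have "c = a" using CC' by simp
    then have "c \<in> L" unfolding L_def using set_sumI[OF ab(1) add_subgroupD(1)[OF L2(1)]] by simp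
    then show ?thesis using \<sigma>_0[OF cV(1)] c(2) by simp
  qed
  then have S12: "S1 \<inter> S2 = {0}"
    using add_subgroupD(1)[OF S1(1)] add_subgroupD(1)[OF S2(1)] by blast
  \<comment> \<open>Split a preimage c of z as x + s along X and \<open>Sb\<close>; applying
    \<sigma> gives \<open>s = \<gamma> x + z\<close>.\<close>
  have "\<exists>x\<in>X. x + \<gamma> x + z \<in> C'" if z: "z \<in> S2" for z
  proof -
    obtain c where c: "c \<in> C'" "z = \<sigma> c" using z by (auto simp: S2_def)
    then have "c \<in> set_sum X Sb" using V2 C'(2) by auto
    then obtain x s where xs: "x \<in> X" "s \<in> Sb" "c = x + s" by (rule set_sumE)
    have "z = \<sigma> x + s"
      using c(2) xs \<sigma>_add[of x s] \<sigma>_Sb[OF xs(2)] X(2) Sb(2) by auto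
    then have "x + \<gamma> x + z = c" using xs(3) by (simp add: \<gamma>_def)
    then show ?thesis using c(1) xs(1) by metis
  qed
  then obtain \<tau> where \<tau>: "\<And>z. z \<in> S2 \<Longrightarrow> \<tau> z \<in> X" "\<And>z. z \<in> S2 \<Longrightarrow> \<tau> z + \<gamma> (\<tau> z) + z \<in> C'"
    by metis
  have \<sigma>_v: "\<sigma> (t + \<gamma> t + h) = h" if th: "t \<in> X" "h \<in> Sb" for t h
  proof (rule \<sigma>_unique[OF _ th(2)])
    show "t + \<gamma> t + h \<in> V N"
      using th X(2) Sb(2) \<gamma>Sb[OF th(1)] by (intro add_subgroupD(4)[OF V_subgroup]) auto
    show "t + \<gamma> t + h - h \<in> L" using \<gamma>L[OF th(1)] by simp
  qed
  \<comment> \<open>The summand is the character of \<open>v = t + \<gamma> t + h\<close> evaluated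
    at representatives \<open>c z\<close> of C'. It is multiplicative in z, so a nonzero sum forces
    it to be trivial, which makes v orthogonal to C'.\<close>
  have key: "t + \<gamma> t + h \<in> C" if t: "t \<in> X" and h: "h \<in> S1"
    and nz: "(\<Sum>z\<in>S2. B N t z * B N h (\<tau> z)) \<noteq> 0" for t h
  proof -
    define v where "v = t + \<gamma> t + h"
    define c where "c z = \<tau> z + \<gamma> (\<tau> z) + z" for z
    have hSb: "h \<in> Sb" using h S1(2) by auto
    have vV: "v \<in> V N"
      unfolding v_def using t X(2) hSb Sb(2) \<gamma>Sb[OF t] by (intro add_subgroupD(4)[OF V_subgroup]) auto
    have \<sigma>v: "\<sigma> v = h" unfolding v_def by (rule \<sigma>_v[OF t hSb])
    obtain w where w: "w \<in> C" "h = \<sigma> w" using h by (auto simp: S1_def)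
    have wV: "w \<in> V N" using w C(2) by auto
    have vwL: "v - w \<in> L"
      using \<sigma>_0[of "v - w"] \<sigma>_diff[OF vV wV] \<sigma>v w add_subgroupD(2)[OF V_subgroup vV wV] by simp
    have vL2: "B N v l = 1" if l: "l \<in> L2" for l
    proof -
      have "l \<in> L" unfolding L_def using set_sumI[OF add_subgroupD(1)[OF L1(1)] l] by simp
      then have "B N (v - w) l = 1" by (rule Liso[OF vwL])
      moreover have "B N w l = 1" using BCC'(1)[OF w(1)] l L2(2) by auto
      ultimately have "B N ((v - w) + w) l = 1"
        by (simp only: bicharD(1)[OF B_bichar] mult_1_left)
      then show ?thesis by simp
    qed
    have cC: "c z \<in> C'" and cV: "c z \<in> V N" and \<sigma>c: "\<sigma> (c z) = z" if "z \<in> S2" for z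
      using \<tau>(2)[OF that] C'(2) \<sigma>_v[OF \<tau>(1)[OF that], of z] that S2(2) by (auto simp: c_def)
    \<comment> \<open>The remaining factors are 1 because L and \<open>Sb\<close> are
      isotropic.\<close>
    have f: "B N t z * B N h (\<tau> z) = B N v (c z)" if z: "z \<in> S2" for z
    proof -
      have zSb: "z \<in> Sb" using z S2(2) by auto
      have "B N v (c z) = B N (t + \<gamma> t) (\<tau> z + \<gamma> (\<tau> z)) * B N (t + \<gamma> t) z *
          (B N h (\<tau> z) * B N h (\<gamma> (\<tau> z)) * B N h z)"
        unfolding v_def c_def by (simp only: bicharD(1,2)[OF B_bichar] mult_ac)
      moreover have "B N (t + \<gamma> t) (\<tau> z + \<gamma> (\<tau> z)) = 1" by (intro Liso \<gamma>L t \<tau>(1) z)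
      moreover have "B N (t + \<gamma> t) z = B N t z"
        using Sbiso[OF \<gamma>Sb[OF t] zSb] by (simp add: bicharD(1)[OF B_bichar])
      moreover have "B N h (\<gamma> (\<tau> z)) = 1" "B N h z = 1"
        using Sbiso[OF hSb] \<gamma>Sb[OF \<tau>(1)[OF z]] zSb by auto
      ultimately show ?thesis by simp
    qed
    \<comment> \<open>v is orthogonal to L2, the kernel of \<sigma> on C', so its character on C'
      descends to S2.\<close>
    have vC': "B N v x = B N v (c (\<sigma> x))" if x: "x \<in> C'" for x
    proof -
      have z: "\<sigma> x \<in> S2" using x by (simp add: S2_def)
      have xV: "x \<in> V N" using x C'(2) by auto
      have "x - c (\<sigma> x) \<in> L"
        using \<sigma>_0[OF add_subgroupD(2)[OF V_subgroup xV cV[OF z]]] \<sigma>_diff[OF xV cV[OF z]] \<sigma>c[OF z] by simp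
      then have "x - c (\<sigma> x) \<in> L2" using LC' add_subgroupD(2)[OF C'(1) x cC[OF z]] by simp
      then have "B N v ((x - c (\<sigma> x)) + c (\<sigma> x)) = B N v (c (\<sigma> x))"
        unfolding bicharD(2)[OF B_bichar] by (simp add: vL2)
      then show ?thesis by simp
    qed
    have mult: "B N v (c (y + z)) = B N v (c y) * B N v (c z)" if yz: "y \<in> S2" "z \<in> S2" for y z
    proof -
      have "B N v (c y + c z) = B N v (c (\<sigma> (c y + c z)))"
        using yz by (intro vC' add_subgroupD(4)[OF C'(1)] cC)
      moreover have "\<sigma> (c y + c z) = y + z" using \<sigma>_add[OF cV cV, OF yz] \<sigma>c yz by simp
      ultimately show ?thesis by (simp add: bicharD(2)[OF B_bichar])
    qed
    have one: "B N v (c z) = 1" if "z \<in> S2" for z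
    proof (rule ccontr)
      assume "B N v (c z) \<noteq> 1"
      then have "(\<Sum>z\<in>S2. B N v (c z)) = 0"
        using character_sum_zero[OF S2(1), of "\<lambda>z. B N v (c z)"] mult that by blast
      then show False using nz f by simp
    qed
    obtain a b where ab: "a \<in> L1" "b \<in> L2" "v - w = a + b" using vwL unfolding L_def by (rule set_sumE)
    \<comment> \<open>v, w and a are orthogonal to C', hence so is b; as b also lies in C' it
      vanishes, leaving v = w + a in C.\<close>
    have "B N b x = 1" if x: "x \<in> C'" for x
    proof -
      have "B N v x = 1" using vC'[OF x] one x by (simp add: S2_def)
      moreover have "B N w x = 1" "B N a x = 1" using BCC'(1)[OF _ x] w(1) ab(1) L1(2) by auto
      moreover have "b = v - w - a" using ab(3) by (simp add: algebra_simps)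
      ultimately show ?thesis by (simp add: bicharD(9)[OF B_bichar])
    qed
    then have "b \<in> C' \<inter> perp N C'"
      using ab(2) L2(2) C'(2) B_sym1 by (auto simp: perp_def)
    then have "b = 0" using C'(3) by simp
    then have "v = w + a" using ab(3) by (simp add: algebra_simps)
    then show ?thesis using w(1) ab(1) L1(2) add_subgroupD(4)[OF C(1)] unfolding v_def by auto
  qed
  show ?thesis
    by (rule that[of S T \<gamma> S1 S2 \<tau>])
      (use S(1) T \<gamma>Sb \<gamma>_add \<gamma>_sym S1 S2 cS1 cS2 S12 \<tau>(1) key in \<open>simp_all add: X_def Sb_def\<close>)
qed

end

section \<open>Reduction of the code condition to a partial trace\<close>

lemma finite_qudits: "finite (qudits Q N)"
  and card_qudits: "card (qudits Q N) = Q ^ N"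
proof -
  have "qudits Q N = {xs. set xs \<subseteq> {..<Q} \<and> length xs = N}" by (auto simp: qudits_def)
  then show "finite (qudits Q N)" "card (qudits Q N) = Q ^ N"
    by (simp_all add: finite_lists_length_eq card_lists_length_eq)
qed

lemma qudits_append_bij:
  assumes "K \<le> N"
  shows "bij_betw (\<lambda>(u, b). u @ b) (qudits Q K \<times> qudits Q (N - K)) (qudits Q N)"
proof (rule bij_betw_byWitness[where f' = "\<lambda>w. (take K w, drop K w)"])
  show "(\<lambda>w. (take K w, drop K w)) ` qudits Q N \<subseteq> qudits Q K \<times> qudits Q (N - K)"
    using assms by (auto simp: qudits_def dest: in_set_takeD in_set_dropD)
qed (use assms in \<open>auto simp: qudits_def\<close>)

lemma sum_qudits_append:
  assumes "K \<le> N"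
  shows "(\<Sum>w\<in>qudits Q N. f w) = (\<Sum>u\<in>qudits Q K. \<Sum>b\<in>qudits Q (N - K). f (u @ b))"
  by (simp add: sum.reindex_bij_betw[OF qudits_append_bij[OF assms], symmetric] sum.cartesian_product case_prod_unfold)

lemma nths_eq_map: "nths xs T = map ((!) xs) (filter (\<lambda>i. i \<in> T) [0..<length xs])"
proof (induction xs rule: rev_induct)
  case (snoc x xs)
  have "map ((!) (xs @ [x])) (filter (\<lambda>i. i \<in> T) [0..<length xs]) =
      map ((!) xs) (filter (\<lambda>i. i \<in> T) [0..<length xs])"
    by (intro map_cong) (auto simp: nth_append)
  then show ?case using snoc by (simp add: nths_append)
qed simp

lemma nths_cong:
  assumes "length xs = length ys" "\<And>i. i < length xs \<Longrightarrow> i \<in> T \<Longrightarrow> xs ! i = ys ! i"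
  shows "nths xs T = nths ys T"
  unfolding nths_eq_map assms(1)[symmetric] by (intro map_cong) (use assms(2) in auto)

text \<open>The columns of W are orthonormal, so W times its adjoint projects onto the range of
  W.\<close>

lemma projector_of_isometry:
  fixes W :: "'b \<Rightarrow> 'c \<Rightarrow> complex"
  assumes fin: "finite B" "finite A"
    and iso: "\<And>u u'. u \<in> A \<Longrightarrow> u' \<in> A \<Longrightarrow> (\<Sum>z\<in>B. cnj (W z u) * W z u') = (if u = u' then 1 else 0)"
  shows "projector_onto B (\<lambda>z z'. \<Sum>u\<in>A. W z u * cnj (W z' u))
    ((\<lambda>\<psi> z. if z \<in> B then \<Sum>u\<in>A. W z u * \<psi> u else 0) ` qspace A)"
proof -
  let ?P = "\<lambda>z z'. \<Sum>u\<in>A. W z u * cnj (W z' u)"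
  let ?W = "\<lambda>\<psi> z. if z \<in> B then \<Sum>u\<in>A. W z u * \<psi> u else 0"
  have herm: "qop_eq B (qadj ?P) ?P"
    by (simp add: qop_eq_def qadj_def mult.commute)
  have P_apply: "qapply B ?P \<psi> = ?W (\<lambda>u. if u \<in> A then \<Sum>z\<in>B. cnj (W z u) * \<psi> z else 0)" for \<psi>
  proof
    fix z
    have "(\<Sum>y\<in>B. ?P z y * \<psi> y) = (\<Sum>u\<in>A. W z u * (\<Sum>z\<in>B. cnj (W z u) * \<psi> z))"
      unfolding sum_distrib_left sum_distrib_right by (subst sum.swap) (simp add: mult_ac)
    then show "qapply B ?P \<psi> z = ?W (\<lambda>u. if u \<in> A then \<Sum>z\<in>B. cnj (W z u) * \<psi> z else 0) z"
      by (simp add: qapply_def)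
  qed
  have PW: "qapply B ?P (?W \<psi>) = ?W \<psi>" if "\<psi> \<in> qspace A" for \<psi>
  proof -
    have "(\<Sum>z\<in>B. cnj (W z u) * ?W \<psi> z) = \<psi> u" if "u \<in> A" for u
    proof -
      have "(\<Sum>z\<in>B. cnj (W z u) * ?W \<psi> z) = (\<Sum>z\<in>B. \<Sum>u'\<in>A. cnj (W z u) * W z u' * \<psi> u')"
        by (simp add: sum_distrib_left mult_ac)
      also have "\<dots> = (\<Sum>u'\<in>A. (\<Sum>z\<in>B. cnj (W z u) * W z u') * \<psi> u')"
        by (subst sum.swap) (simp add: sum_distrib_right)
      also have "\<dots> = (\<Sum>u'\<in>A. if u = u' then \<psi> u' else 0)"
        using iso[OF that] by (intro sum.cong) auto
      finally show ?thesis using that fin by simp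
    qed
    then have eq: "(\<lambda>u. if u \<in> A then \<Sum>z\<in>B. cnj (W z u) * ?W \<psi> z else 0) = \<psi>"
      using that by (auto simp: qspace_def)
    show ?thesis using arg_cong[OF eq, of ?W] P_apply[of "?W \<psi>"] by (rule trans[rotated])
  qed
  have "qapply B ?P ` qspace B = ?W ` qspace A"
  proof (intro equalityI subsetI)
    fix \<phi> assume "\<phi> \<in> qapply B ?P ` qspace B"
    then obtain \<psi> where "\<phi> = qapply B ?P \<psi>" by auto
    then show "\<phi> \<in> ?W ` qspace A"
      unfolding P_apply by (intro image_eqI[OF _]) (auto simp: qspace_def)
  next
    fix \<phi> assume "\<phi> \<in> ?W ` qspace A"
    then obtain \<psi> where \<psi>: "\<psi> \<in> qspace A" "\<phi> = ?W \<psi>" by auto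
    have W\<psi>: "?W \<psi> \<in> qspace B" by (simp add: qspace_def)
    show "\<phi> \<in> qapply B ?P ` qspace B"
      using image_eqI[where f = "qapply B ?P", OF trans[OF \<psi>(2) PW[OF \<psi>(1), symmetric]] W\<psi>] .
  qed
  moreover have "qop_eq B (qcomp B ?P ?P) ?P"
    unfolding qop_eq_def
  proof (intro ballI)
    fix x y assume x: "x \<in> B" and y: "y \<in> B"
    define \<psi> where "\<psi> u = (if u \<in> A then cnj (W y u) else 0)" for u
    have "\<psi> \<in> qspace A" by (simp add: qspace_def \<psi>_def)
    from fun_cong[OF PW[OF this], of x] have "(\<Sum>z\<in>B. ?P x z * ?W \<psi> z) = ?W \<psi> x"
      using x by (simp add: qapply_def)
    then show "qcomp B ?P ?P x y = ?P x y" using x by (simp add: qcomp_def \<psi>_def)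
  qed
  ultimately show ?thesis using herm by (simp add: projector_onto_def)
qed

lemma sum_rotate: "(\<Sum>x\<in>A. \<Sum>y\<in>B. \<Sum>z\<in>C. f x y z) = (\<Sum>y\<in>B. \<Sum>z\<in>C. \<Sum>x\<in>A. f x y z)"
  by (subst sum.swap, intro sum.cong refl, rule sum.swap)

text \<open>With P the product of W and its adjoint, the middle of P M P is the compression of M by
  W, here a scalar matrix.\<close>

lemma projector_sandwich:
  fixes W :: "'b \<Rightarrow> 'c \<Rightarrow> complex"
  assumes "finite A"
    and \<gamma>: "\<And>u u'. u \<in> A \<Longrightarrow> u' \<in> A \<Longrightarrow>
      (\<Sum>z\<in>B. \<Sum>z'\<in>B. cnj (W z u) * M z z' * W z' u') = (if u = u' then \<gamma> else 0)"
  defines "P \<equiv> (\<lambda>z z'. \<Sum>u\<in>A. W z u * cnj (W z' u))"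
  shows "qcomp B P (qcomp B M P) x y = \<gamma> * P x y"
proof -
  have "qcomp B P (qcomp B M P) x y = (\<Sum>z\<in>B. \<Sum>z'\<in>B. P x z * (M z z' * P z' y))"
    unfolding qcomp_def by (simp add: sum_distrib_left)
  also have "\<dots> =
      (\<Sum>z\<in>B. \<Sum>z'\<in>B. \<Sum>u\<in>A. \<Sum>u'\<in>A. W x u * (cnj (W z u) * M z z' * W z' u') * cnj (W y u'))"
    unfolding P_def sum_distrib_left[of "M _ _"] sum_product by (simp add: mult_ac)
  also have "\<dots> = (\<Sum>z\<in>B. \<Sum>u\<in>A. \<Sum>u'\<in>A. \<Sum>z'\<in>B. W x u * (cnj (W z u) * M z z' * W z' u') * cnj (W y u'))"
    by (intro sum.cong refl sum_rotate)
  also have "\<dots> = (\<Sum>u\<in>A. \<Sum>u'\<in>A. \<Sum>z\<in>B. \<Sum>z'\<in>B. W x u * (cnj (W z u) * M z z' * W z' u') * cnj (W y u'))"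
    by (rule sum_rotate)
  also have "\<dots> = (\<Sum>u\<in>A. \<Sum>u'\<in>A. W x u * (\<Sum>z\<in>B. \<Sum>z'\<in>B. cnj (W z u) * M z z' * W z' u') * cnj (W y u'))"
    by (simp add: sum_distrib_left sum_distrib_right)
  also have "\<dots> = (\<Sum>u\<in>A. \<Sum>u'\<in>A. if u = u' then \<gamma> * (W x u * cnj (W y u')) else 0)"
    using \<gamma> by (intro sum.cong) auto
  also have "\<dots> = \<gamma> * P x y"
    using assms(1) by (simp add: P_def sum_distrib_left)
  finally show ?thesis .
qed

text \<open>For a maximally entangled code the receiver's halves are traced out against the ancillas, so
  the error condition says that the partial trace of \<open>U\<^sup>* E U\<close> over the last qudits is scalar.\<close>

lemma eaqecc_from_unitary:
  assumes Q: "0 < Q" and KN: "K \<le> N" and U: "qunitary (qudits Q N) U"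
    and tr: "\<And>E T. T \<subseteq> {..<N} \<Longrightarrow> card T < d \<Longrightarrow> acts_only_on Q N T E \<Longrightarrow>
      \<exists>\<gamma>. \<forall>u\<in>qudits Q K. \<forall>u'\<in>qudits Q K.
        (\<Sum>b\<in>qudits Q (N - K). \<Sum>x\<in>qudits Q N. \<Sum>x'\<in>qudits Q N. cnj (U x (u @ b)) * E x x' * U x' (u' @ b))
          = (if u = u' then \<gamma> else 0)"
  shows "eaqecc_exists Q N K d (N - K)"
proof -
  define c where "c = N - K"
  define A where "A = qudits Q K"
  define R where "R = qudits Q c"
  define H where "H = qudits Q N"
  define s where "s = complex_of_real (1 / sqrt (real Q)) ^ c"
  \<comment> \<open>The encoded basis state of u. The pairs tie the sender's label to the receiver's
    label b, with common amplitude s equal to Q to the power -c/2, so no sum over ebit labels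
    remains.\<close>
  define W where "W = (\<lambda>(x, b) u. s * U x (u @ b))"
  define P where "P = (\<lambda>z z'. \<Sum>u\<in>A. W z u * cnj (W z' u))"
  have fin: "finite A" "finite R" "finite H" by (simp_all add: A_def R_def H_def finite_qudits)
  have "complex_of_real (1 / sqrt (real Q)) * cnj (complex_of_real (1 / sqrt (real Q))) = 1 / of_nat Q"
    using Q by (simp flip: of_real_mult)
  then have "s * cnj s = (1 / of_nat Q) ^ c"
    unfolding s_def complex_cnj_power power_mult_distrib[symmetric] by simp
  then have ss: "of_nat (card R) * (s * cnj s) = 1"
    using Q by (simp add: R_def card_qudits power_one_over)
  have app: "u @ b \<in> H" if "u \<in> A" "b \<in> R" for u b
    using that KN by (auto simp: A_def R_def H_def c_def qudits_def)
  have U1: "(\<Sum>x\<in>H. cnj (U x w) * U x w') = (if w = w' then 1 else 0)" if "w \<in> H" "w' \<in> H" for w w'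
    using U that by (simp add: qunitary_def qop_eq_def qcomp_def qadj_def qid_def H_def)
  have iso: "(\<Sum>z\<in>H \<times> R. cnj (W z u) * W z u') = (if u = u' then 1 else 0)" if "u \<in> A" "u' \<in> A" for u u'
  proof -
    have "(\<Sum>z\<in>H \<times> R. cnj (W z u) * W z u') =
        (\<Sum>b\<in>R. (s * cnj s) * (\<Sum>x\<in>H. cnj (U x (u @ b)) * U x (u' @ b)))"
      unfolding sum.cartesian_product' W_def
      by (subst sum.swap) (simp add: sum_distrib_left mult_ac)
    also have "\<dots> = (\<Sum>b\<in>R. if u = u' then s * cnj s else 0)"
      using U1[OF app app, OF that(1) _ that(2)] by (intro sum.cong) auto
    finally show ?thesis using ss by simp
  qed
  have eb: "ebits Q c (b, b') = (if b = b' then s else 0)" if "b \<in> R" "b' \<in> R" for b b'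
  proof (cases "b = b'")
    case False
    moreover have "length b = c" "length b' = c"
      using that by (simp_all add: R_def qudits_def)
    ultimately obtain i where "i < c" "b ! i \<noteq> b' ! i"
      by (metis nth_equalityI)
    then show ?thesis using False by (auto simp: ebits_def intro!: prod_zero)
  qed (simp add: ebits_def s_def)
  have enc: "qapply (H \<times> R) (qtensor U qid) (unencoded Q N K c \<psi>) =
      (\<lambda>z. if z \<in> H \<times> R then \<Sum>u\<in>A. W z u * \<psi> u else 0)" for \<psi>
  proof
    fix z :: "nat list \<times> nat list"
    obtain x b where z: "z = (x, b)" by force
    show "qapply (H \<times> R) (qtensor U qid) (unencoded Q N K c \<psi>) z =
        (if z \<in> H \<times> R then \<Sum>u\<in>A. W z u * \<psi> u else 0)"
    proof (cases "z \<in> H \<times> R")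
      case True
      then have b: "b \<in> R" using z by simp
      have "qapply (H \<times> R) (qtensor U qid) (unencoded Q N K c \<psi>) z =
          (\<Sum>y\<in>H. \<Sum>b'\<in>R. U x y * (if b = b' then 1 else 0) * unencoded Q N K c \<psi> (y, b'))"
        using True unfolding qapply_def z
        by (simp add: sum.cartesian_product' qtensor_def qid_def)
      also have "\<dots> = (\<Sum>y\<in>H. \<Sum>b'\<in>R. if b = b' then U x y * unencoded Q N K c \<psi> (y, b') else 0)"
        by (intro sum.cong) auto
      also have "\<dots> = (\<Sum>y\<in>H. U x y * unencoded Q N K c \<psi> (y, b))"
        using b fin by simp
      also have "\<dots> = (\<Sum>u\<in>A. \<Sum>b'\<in>R. U x (u @ b') * unencoded Q N K c \<psi> (u @ b', b))"
        unfolding H_def A_def R_def c_def by (rule sum_qudits_append[OF KN])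
      also have "\<dots> = (\<Sum>u\<in>A. \<Sum>b'\<in>R. if b = b' then U x (u @ b') * (\<psi> u * s) else 0)"
      proof (intro sum.cong refl)
        fix u b' assume ub: "u \<in> A" "b' \<in> R"
        have "length u = K" using ub by (simp add: A_def qudits_def)
        \<comment> \<open>With c = N - K the ancilla register is empty, and
          \<open>zero_ancillas\<close> of the empty word is 1.\<close>
        moreover have "N - c = K" "N - K - c = 0" using KN by (simp_all add: c_def)
        ultimately have "unencoded Q N K c \<psi> (u @ b', b) = \<psi> u * ebits Q c (b', b)"
          by (simp add: unencoded_def zero_ancillas_def)
        then show "U x (u @ b') * unencoded Q N K c \<psi> (u @ b', b) =
            (if b = b' then U x (u @ b') * (\<psi> u * s) else 0)"
          using eb[OF ub(2) b] by simp
      qed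
      also have "\<dots> = (\<Sum>u\<in>A. W z u * \<psi> u)"
        using b fin by (simp add: W_def z mult_ac)
      finally show ?thesis using True by simp
    qed (simp add: qapply_def)
  qed
  have "projector_onto (H \<times> R) P (ea_code_space Q N K c U)"
    using projector_of_isometry[of "H \<times> R" A W] fin iso
    by (simp add: P_def ea_code_space_def enc flip: H_def R_def A_def)
  moreover have "\<exists>\<gamma>. qop_eq (H \<times> R) (qcomp (H \<times> R) P (qcomp (H \<times> R) (qtensor E qid) P)) (\<lambda>x y. \<gamma> * P x y)"
    if E: "T \<subseteq> {..<N}" "card T < d" "acts_only_on Q N T E" for E T
  proof -
    obtain \<gamma> where \<gamma>: "\<And>u u'. u \<in> A \<Longrightarrow> u' \<in> A \<Longrightarrow>
        (\<Sum>b\<in>R. \<Sum>x\<in>H. \<Sum>x'\<in>H. cnj (U x (u @ b)) * E x x' * U x' (u' @ b)) = (if u = u' then \<gamma> else 0)"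
      using tr[OF E] unfolding A_def R_def H_def c_def by blast
    have "(\<Sum>z\<in>H \<times> R. \<Sum>z'\<in>H \<times> R. cnj (W z u) * qtensor E qid z z' * W z' u') =
        (if u = u' then s * cnj s * \<gamma> else 0)" if "u \<in> A" "u' \<in> A" for u u'
    proof -
      have "(\<Sum>z\<in>H \<times> R. \<Sum>z'\<in>H \<times> R. cnj (W z u) * qtensor E qid z z' * W z' u') =
          (\<Sum>x\<in>H. \<Sum>b\<in>R. \<Sum>x'\<in>H. \<Sum>b'\<in>R.
            if b = b' then s * cnj s * (cnj (U x (u @ b)) * E x x' * U x' (u' @ b')) else 0)"
        unfolding sum.cartesian_product' W_def qtensor_def qid_def
        by (intro sum.cong) auto
      also have "\<dots> = (\<Sum>x\<in>H. \<Sum>b\<in>R. \<Sum>x'\<in>H. s * cnj s * (cnj (U x (u @ b)) * E x x' * U x' (u' @ b)))"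
        using fin by (intro sum.cong refl) simp
      also have "\<dots> = s * cnj s * (\<Sum>b\<in>R. \<Sum>x\<in>H. \<Sum>x'\<in>H. cnj (U x (u @ b)) * E x x' * U x' (u' @ b))"
        by (subst sum.swap) (simp add: sum_distrib_left)
      finally show ?thesis using \<gamma>[OF that] by simp
    qed
    from projector_sandwich[where B = "H \<times> R" and W = W and M = "qtensor E qid", OF fin(1) this]
    show ?thesis unfolding qop_eq_def P_def by blast
  qed
  ultimately show ?thesis
    unfolding eaqecc_exists_def Let_def using U KN
    by (intro conjI exI[of _ U] exI[of _ P]) (auto simp: H_def R_def c_def)
qed

section \<open>Codes from symplectic subgroups\<close>

lemma bichar_sum_right:
  assumes "bichar \<beta>"
  shows "\<beta> x (\<Sum>i\<in>I. f i) = (\<Prod>i\<in>I. \<beta> x (f i))"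
  by (induction I rule: infinite_finite_induct) (simp_all add: bicharD(2,6)[OF assms])

lemma character_sum:
  assumes "add_subgroup A" "finite A" "\<And>x y. x \<in> A \<Longrightarrow> y \<in> A \<Longrightarrow> f (x + y) = f x * f y"
  shows "(\<Sum>x\<in>A. f x) = (if \<forall>x\<in>A. f x = 1 then of_nat (card A) else (0::complex))"
  using character_sum_zero[OF assms(1), of f] assms(3) by auto

context symplectic_group
begin

text \<open>A function \<open>\<phi>\<close> with \<open>\<phi> (x + t) = \<phi> x * \<phi> t * B x (\<gamma> t)\<close> need not have an elementary form in
  characteristic 2; dropping the diagonal part of \<open>\<gamma>\<close> makes a triangular product work, and it
  does not change where \<open>t + \<gamma> t + h\<close> is supported.\<close>

lemma quadratic_character:
  assumes T: "\<And>i. T i \<in> Lines"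
    and \<gamma>_add: "\<And>x y. x \<in> box N T \<Longrightarrow> y \<in> box N T \<Longrightarrow> \<gamma> (x + y) = \<gamma> x + \<gamma> y"
    and \<gamma>_sym: "\<And>x y. x \<in> box N T \<Longrightarrow> y \<in> box N T \<Longrightarrow> B N x (\<gamma> y) = B N y (\<gamma> x)"
  obtains \<phi> \<gamma>' where "\<And>x. cmod (\<phi> x) = 1" "\<phi> 0 = 1"
    "\<And>x t. x \<in> box N T \<Longrightarrow> t \<in> box N T \<Longrightarrow> \<phi> (x + t) = \<phi> x * \<phi> t * B N x (\<gamma>' t)"
    "\<And>j t. t \<in> box N T \<Longrightarrow> j < N \<Longrightarrow> t j = 0 \<Longrightarrow> \<gamma>' t j = \<gamma> t j"
    "\<gamma>' 0 = 0"
proof -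
  \<comment> \<open>The entry of \<gamma> from coordinate i to coordinate j, an additive map on the
    line \<open>T i\<close>.\<close>
  define g where "g i j a = \<gamma> (single i a) j" for i j a
  have zeroT: "0 \<in> T i" for i using add_subgroupD(1)[OF lines_subgroup[OF T]] .
  have zero_box: "0 \<in> box N T" using zeroT by (simp add: box_def)
  have sb: "single i a \<in> box N T" if "i < N" "a \<in> T i" for i a
    using that zeroT by (auto simp: box_def single_def)
  have xT: "x i \<in> T i" if "x \<in> box N T" "i < N" for x i using that by (simp add: box_def)
  have g_add: "g i j (a + b) = g i j a + g i j b" if "i < N" "a \<in> T i" "b \<in> T i" for i j a b
  proof -
    have "single i (a + b) = single i a + single i b" by (auto simp: single_def)
    then show ?thesis using \<gamma>_add[OF sb sb, of i a i b] that by (simp add: g_def)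
  qed
  have \<gamma>0: "\<gamma> 0 = 0" using \<gamma>_add[OF zero_box zero_box] by simp
  have g0: "g i j 0 = 0" for i j
  proof -
    have "single i (0::'g) = 0" by (auto simp: single_def)
    then show ?thesis by (simp add: g_def \<gamma>0)
  qed
  have g_sym: "\<beta> b (g i j a) = \<beta> a (g j i b)" if "i < N" "j < N" "a \<in> T i" "b \<in> T j" for i j a b
    using \<gamma>_sym[OF sb sb, of i a j b] that by (simp add: g_def prod_char_single_left[OF bichar])
  have \<gamma>_eq: "\<gamma> t j = (\<Sum>i<N. g i j (t i))" if t: "t \<in> box N T" for t j
  proof -
    define r where "r m = (\<lambda>i. if i < m then t i else 0)" for m
    have rb: "r m \<in> box N T" for m using t zeroT by (auto simp: box_def r_def)
    have "\<gamma> (r m) j = (\<Sum>i<m. g i j (t i))" if "m \<le> N" for m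
      using that
    proof (induction m)
      case 0
      have r0: "r 0 = 0" by (auto simp: r_def)
      have "\<gamma> (r 0) = 0" unfolding r0 by (rule \<gamma>0)
      then show ?case by simp
    next
      case (Suc m)
      have "r (Suc m) = r m + single m (t m)" by (auto simp: r_def single_def less_Suc_eq)
      then have "\<gamma> (r (Suc m)) = \<gamma> (r m) + \<gamma> (single m (t m))"
        using \<gamma>_add[OF rb sb] Suc.prems t xT[of t m] by simp
      then show ?case using Suc by (simp add: g_def)
    qed
    moreover have "r N = t" using t by (auto simp: r_def box_def)
    ultimately show ?thesis by auto
  qed
  \<comment> \<open>Only pairs i < j enter. In \<phi> (x + t) the two mixed terms of such a pair are
    the pairing of x with the entries of \<gamma> t from i to j and, by symmetry, from j to i.
    Together they give all of \<gamma> off the diagonal, which is \<gamma>'.\<close>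
  define \<phi> where "\<phi> x = (\<Prod>j<N. \<Prod>i<N. if i < j then \<beta> (x j) (g i j (x i)) else 1)" for x
  define \<gamma>' where "\<gamma>' t j = (if j < N then \<Sum>i<N. if i \<noteq> j then g i j (t i) else 0 else 0)" for t j
  have "cmod (\<phi> x) = 1" for x
    unfolding \<phi>_def prod_norm[symmetric] by (intro prod.neutral ballI) (simp add: bicharD(3)[OF bichar])
  moreover have "\<phi> 0 = 1"
    unfolding \<phi>_def by (intro prod.neutral ballI) (simp add: bicharD(5)[OF bichar])
  moreover have "\<phi> (x + t) = \<phi> x * \<phi> t * B N x (\<gamma>' t)" if x: "x \<in> box N T" and t: "t \<in> box N T" for x t
  proof -
    define h where "h i j = \<beta> (x j) (g i j (t i))" for i j
    have "\<phi> (x + t) = (\<Prod>j<N. \<Prod>i<N. (if i < j then \<beta> (x j) (g i j (x i)) else 1) *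
        (if i < j then \<beta> (t j) (g i j (t i)) else 1) * ((if i < j then h i j else 1) * (if i < j then h j i else 1)))"
      unfolding \<phi>_def
    proof (intro prod.cong refl)
      fix i j assume "j \<in> {..<N}" "i \<in> {..<N}"
      then have ij: "j < N" "i < N" by auto
      then show "(if i < j then \<beta> ((x + t) j) (g i j ((x + t) i)) else 1) =
        (if i < j then \<beta> (x j) (g i j (x i)) else 1) *
        (if i < j then \<beta> (t j) (g i j (t i)) else 1) * ((if i < j then h i j else 1) * (if i < j then h j i else 1))"
        using g_add[OF ij(2) xT[OF x ij(2)] xT[OF t ij(2)], of j]
          g_sym[OF ij(2,1) xT[OF x ij(2)] xT[OF t ij(1)]]
        by (simp add: h_def bicharD(1,2)[OF bichar] mult_ac)
    qed
    also have "\<dots> = \<phi> x * \<phi> t * ((\<Prod>j<N. \<Prod>i<N. if i < j then h i j else 1) * (\<Prod>j<N. \<Prod>i<N. if i < j then h j i else 1))"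
      by (simp add: \<phi>_def prod.distrib)
    also have "(\<Prod>j<N. \<Prod>i<N. if i < j then h j i else 1) = (\<Prod>j<N. \<Prod>i<N. if j < i then h i j else 1)"
      by (rule prod.swap)
    also have "(\<Prod>j<N. \<Prod>i<N. if i < j then h i j else 1) * (\<Prod>j<N. \<Prod>i<N. if j < i then h i j else 1) =
        (\<Prod>j<N. \<Prod>i<N. if i \<noteq> j then h i j else 1)"
      unfolding prod.distrib[symmetric] by (intro prod.cong refl) auto
    also have "\<dots> = B N x (\<gamma>' t)"
      unfolding prod_char_def \<gamma>'_def
      by (intro prod.cong refl) (auto simp: bichar_sum_right[OF bichar] h_def bicharD(6)[OF bichar] intro!: prod.cong)
    finally show ?thesis .
  qed
  moreover have "\<gamma>' t j = \<gamma> t j" if "t \<in> box N T" "j < N" "t j = 0" for j t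
    unfolding \<gamma>_eq[OF that(1)] \<gamma>'_def using that(2,3) by (auto simp: g0 intro!: sum.cong)
  moreover have "\<gamma>' 0 = 0" by (rule ext) (auto simp: \<gamma>'_def g0 intro!: sum.neutral)
  ultimately show ?thesis by (rule that[of \<phi> \<gamma>']) 
qed

section \<open>Orthogonality of dual boxes, the partial trace and the encoding unitary\<close>

lemma box_annihilator:
  assumes S: "\<And>i. S i \<in> Lines" and T: "\<And>i. T i \<in> Lines" and ST: "\<And>i. S i \<inter> T i = {0}"
    and x: "x \<in> box N T" and one: "\<And>s. s \<in> box N S \<Longrightarrow> B N x s = 1"
  shows "x = 0"
proof
  fix i show "x i = 0 i"
  proof (cases "i < N")
    case True
    have zeroS: "0 \<in> S i" for i using add_subgroupD(1)[OF lines_subgroup[OF S]] .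
    have "x i = 0"
    proof (rule line_annihilator[OF T S])
      show "T i \<inter> S i = {0}" using ST by blast
      show "x i \<in> T i" using x True by (simp add: box_def)
      fix h assume "h \<in> S i"
      then have "single i h \<in> box N S" using True zeroS by (auto simp: box_def single_def)
      from one[OF this] show "\<beta> (x i) h = 1" by (simp add: prod_char_single_right[OF bichar True])
    qed
    then show ?thesis by simp
  qed (use x in \<open>simp add: box_def\<close>)
qed

text \<open>Complementary boxes are character groups of each other; this is the orthogonality of the
  Fourier kernel behind unitarity.\<close>

lemma box_character_sum:
  assumes S: "\<And>i. S i \<in> Lines" and T: "\<And>i. T i \<in> Lines" and ST: "\<And>i. S i \<inter> T i = {0}"
    and x: "x \<in> box N T" "y \<in> box N T"
  shows "(\<Sum>s\<in>box N S. cnj (B N x s) * B N y s) = (if x = y then of_nat (Q ^ N) else 0)"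
proof -
  have e: "cnj (B N x s) * B N y s = B N (y - x) s" for s
    by (simp add: bicharD(9)[OF B_bichar] mult.commute)
  have "(\<forall>s\<in>box N S. B N (y - x) s = 1) \<longleftrightarrow> x = y"
  proof
    assume "\<forall>s\<in>box N S. B N (y - x) s = 1"
    then have "y - x = 0"
      using box_annihilator[OF S T ST add_subgroupD(2)[OF box_lines_subgroup[OF T] x(2,1)]] by blast
    then show "x = y" by simp
  qed (simp add: bicharD(5)[OF B_bichar])
  moreover have "(\<Sum>s\<in>box N S. B N (y - x) s) =
      (if \<forall>s\<in>box N S. B N (y - x) s = 1 then of_nat (card (box N S)) else 0)"
    by (rule character_sum[OF box_lines_subgroup[OF S] finite_box]) (rule bicharD(2)[OF B_bichar])
  ultimately show ?thesis unfolding e by (simp add: card_box_lines[OF S])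
qed

text \<open>Put x' = x + t and h = y' - y. The sum splits into a phase, a sum G over S2 and a sum F
  over positions. G nonzero puts \<open>v = t + \<gamma> t + h\<close> into C. F nonzero makes t
  vanish off I by E1, and by invariance under shifts off I (E2) makes \<open>\<gamma>' t + h\<close>
  vanish there too. Then v is supported on I, so its weight is below d and v = 0, whence t = 0 and h
  = 0.\<close>

lemma partial_trace:
  assumes S: "\<And>i. S i \<in> Lines" and T: "\<And>i. T i \<in> Lines" and ST: "\<And>i. S i \<inter> T i = {0}"
    and \<gamma>_box: "\<And>x. x \<in> box N T \<Longrightarrow> \<gamma> x \<in> box N S"
    and S1: "add_subgroup S1" and S1b: "S1 \<subseteq> box N S" 
    and key: "\<And>t h. t \<in> box N T \<Longrightarrow> h \<in> S1 \<Longrightarrow> (\<Sum>z\<in>S2. B N t z * B N h (\<tau> z)) \<noteq> 0 \<Longrightarrow> t + \<gamma> t + h \<in> C"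
    and \<phi>: "\<And>x. cmod (\<phi> x) = 1" "\<phi> 0 = 1"
    and \<phi>_add: "\<And>x t. x \<in> box N T \<Longrightarrow> t \<in> box N T \<Longrightarrow> \<phi> (x + t) = \<phi> x * \<phi> t * B N x (\<gamma>' t)"
    and \<gamma>': "\<And>j t. t \<in> box N T \<Longrightarrow> j < N \<Longrightarrow> t j = 0 \<Longrightarrow> \<gamma>' t j = \<gamma> t j" "\<gamma>' 0 = 0"
    and C: "\<And>x. x \<in> C \<Longrightarrow> x \<noteq> 0 \<Longrightarrow> d \<le> weight N x"
    and I: "I \<subseteq> {..<N}" "card I < d"
    and E1: "\<And>x x' i. x \<in> box N T \<Longrightarrow> x' \<in> box N T \<Longrightarrow> E x x' \<noteq> 0 \<Longrightarrow> i < N \<Longrightarrow> i \<notin> I \<Longrightarrow> x i = x' i"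
    and E2: "\<And>x x' r. x \<in> box N T \<Longrightarrow> x' \<in> box N T \<Longrightarrow> r \<in> box N T \<Longrightarrow> (\<And>i. i \<in> I \<Longrightarrow> r i = 0) \<Longrightarrow>
        E (x + r) (x' + r) = E x x'"
    and y: "y \<in> S1" "y' \<in> S1"
  shows "(\<Sum>z\<in>S2. \<Sum>x\<in>box N T. \<Sum>x'\<in>box N T.
      cnj (\<phi> x * B N x (y + z) * B N y (\<tau> z)) * E x x' * (\<phi> x' * B N x' (y' + z) * B N y' (\<tau> z))) =
    (if y = y' then of_nat (card S2) * (\<Sum>x\<in>box N T. E x x) else 0)"
proof -
  define X where "X = box N T"
  define h where "h = y' - y"
  have X: "add_subgroup X" unfolding X_def by (rule box_lines_subgroup[OF T])
  have zeroX: "0 \<in> X" by (rule add_subgroupD(1)[OF X])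
  have finX: "finite X" unfolding X_def by (rule finite_box)
  have hS1: "h \<in> S1" unfolding h_def by (rule add_subgroupD(2)[OF S1 y(2,1)])
  define G where "G t = (\<Sum>z\<in>S2. B N t z * B N h (\<tau> z))" for t
  define F where "F t = (\<Sum>x\<in>X. E x (x + t) * B N x (\<gamma>' t + h))" for t
  define k where "k t = \<phi> t * B N t y'" for t
  have \<phi>1: "cnj (\<phi> x) * \<phi> x = 1" for x
    using \<phi>(1)[of x] complex_norm_square[of "\<phi> x"] by (simp add: mult.commute)
  have "(\<Sum>z\<in>S2. \<Sum>x\<in>X. \<Sum>x'\<in>X.
      cnj (\<phi> x * B N x (y + z) * B N y (\<tau> z)) * E x x' * (\<phi> x' * B N x' (y' + z) * B N y' (\<tau> z))) =
    (\<Sum>z\<in>S2. \<Sum>x\<in>X. \<Sum>t\<in>X. k t * (B N t z * B N h (\<tau> z)) * (E x (x + t) * B N x (\<gamma>' t + h)))"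
  proof (rule sum.cong[OF refl], rule sum.cong[OF refl])
    fix z x assume "z \<in> S2" and x: "x \<in> X"
    have "(\<Sum>x'\<in>X. cnj (\<phi> x * B N x (y + z) * B N y (\<tau> z)) * E x x' * (\<phi> x' * B N x' (y' + z) * B N y' (\<tau> z))) =
      (\<Sum>t\<in>X. cnj (\<phi> x * B N x (y + z) * B N y (\<tau> z)) * E x (x + t) *
        (\<phi> (x + t) * B N (x + t) (y' + z) * B N y' (\<tau> z)))"
      by (rule sum.reindex_bij_witness[where i = "\<lambda>t. x + t" and j = "\<lambda>x'. x' - x"])
        (use x add_subgroupD[OF X] in auto)
    also have "\<dots> = (\<Sum>t\<in>X. k t * (B N t z * B N h (\<tau> z)) * (E x (x + t) * B N x (\<gamma>' t + h)))"
    proof (intro sum.cong refl)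
      fix t assume t: "t \<in> X"
      have "cnj (\<phi> x * B N x (y + z) * B N y (\<tau> z)) * E x (x + t) *
          (\<phi> (x + t) * B N (x + t) (y' + z) * B N y' (\<tau> z)) =
        (cnj (\<phi> x) * \<phi> x) * (cnj (B N x z) * B N x z) * (\<phi> t * B N t y') * (B N t z * (B N y' (\<tau> z) * cnj (B N y (\<tau> z)))) *
          (E x (x + t) * (B N x (\<gamma>' t) * (B N x y' * cnj (B N x y))))"
        using \<phi>_add[of x t] x t by (simp add: X_def bicharD(1,2)[OF B_bichar] mult_ac)
      then show "cnj (\<phi> x * B N x (y + z) * B N y (\<tau> z)) * E x (x + t) *
          (\<phi> (x + t) * B N (x + t) (y' + z) * B N y' (\<tau> z)) =
        k t * (B N t z * B N h (\<tau> z)) * (E x (x + t) * B N x (\<gamma>' t + h))"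
        unfolding \<phi>1 bicharD(11)[OF B_bichar] k_def h_def bicharD(9,10)[OF B_bichar] bicharD(2)[OF B_bichar]
        by simp
    qed
    finally show "(\<Sum>x'\<in>X. cnj (\<phi> x * B N x (y + z) * B N y (\<tau> z)) * E x x' * (\<phi> x' * B N x' (y' + z) * B N y' (\<tau> z))) =
      (\<Sum>t\<in>X. k t * (B N t z * B N h (\<tau> z)) * (E x (x + t) * B N x (\<gamma>' t + h)))" .
  qed
  also have "\<dots> = (\<Sum>t\<in>X. \<Sum>z\<in>S2. \<Sum>x\<in>X. k t * (B N t z * B N h (\<tau> z)) * (E x (x + t) * B N x (\<gamma>' t + h)))"
    by (rule sum_rotate[symmetric])
  also have "\<dots> = (\<Sum>t\<in>X. k t * (G t * F t))"
    unfolding G_def F_def sum_product by (simp add: sum_distrib_left mult_ac)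
  also have "\<dots> = (\<Sum>t\<in>X. if t = 0 then (if h = 0 then of_nat (card S2) * (\<Sum>x\<in>X. E x x) else 0) else 0)"
  proof (intro sum.cong refl)
    fix t assume t: "t \<in> X"
    show "k t * (G t * F t) = (if t = 0 then (if h = 0 then of_nat (card S2) * (\<Sum>x\<in>X. E x x) else 0) else 0)"
    proof (cases "t = 0 \<and> h = 0")
      case True
      then show ?thesis by (simp add: k_def G_def F_def \<phi>(2) \<gamma>'(2) bicharD(5,6)[OF B_bichar])
    next
      case False
      have "G t * F t = 0"
      proof (rule ccontr)
        assume "G t * F t \<noteq> 0"
        then have G: "G t \<noteq> 0" and F: "F t \<noteq> 0" by auto
        define v where "v = t + \<gamma> t + h"
        have vC: "v \<in> C" unfolding v_def using key[of t h] t hS1 G by (simp add: X_def G_def)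
        from F obtain x where "x \<in> X" "E x (x + t) \<noteq> 0" unfolding F_def
          by (metis (no_types, lifting) mult_eq_0_iff sum.neutral)
        then have "x i = (x + t) i" if "i < N" "i \<notin> I" for i
          using E1[of x "x + t" i] that t add_subgroupD(4)[OF X] by (simp add: X_def)
        then have tI: "t i = 0" if "i < N" "i \<notin> I" for i using that by auto
        \<comment> \<open>Shifting x by r leaves the entries of E alone and multiplies F by this
          character value; F is not 0.\<close>
        have B1: "B N r (\<gamma>' t + h) = 1" if r: "r \<in> X" "\<And>i. i \<in> I \<Longrightarrow> r i = 0" for r
        proof -
          have "F t = (\<Sum>x\<in>X. E (x + r) (x + r + t) * B N (x + r) (\<gamma>' t + h))"
            unfolding F_def
            by (rule sum.reindex_bij_witness[where i = "\<lambda>x. x + r" and j = "\<lambda>x. x - r"])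
              (use r add_subgroupD[OF X] in auto)
          also have "\<dots> = (\<Sum>x\<in>X. B N r (\<gamma>' t + h) * (E x (x + t) * B N x (\<gamma>' t + h)))"
          proof (intro sum.cong refl)
            fix x assume x: "x \<in> X"
            have "E (x + r) ((x + t) + r) = E x (x + t)"
              using x t r add_subgroupD(4)[OF X x t] unfolding X_def by (intro E2) auto
            then show "E (x + r) (x + r + t) * B N (x + r) (\<gamma>' t + h) =
                B N r (\<gamma>' t + h) * (E x (x + t) * B N x (\<gamma>' t + h))"
              by (simp add: bicharD(1)[OF B_bichar] add_ac mult_ac)
          qed
          also have "\<dots> = B N r (\<gamma>' t + h) * F t" by (simp add: F_def sum_distrib_left)
          finally show ?thesis using F by simp
        qed
        have "v i = 0" if i: "i < N" "i \<notin> I" for i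
        proof -
          have \<gamma>i: "\<gamma>' t i = \<gamma> t i" using \<gamma>'(1)[of t i] t i(1) tI[OF i] by (simp add: X_def)
          \<comment> \<open>The left side lies in \<open>S i\<close> and pairs trivially with all of
            \<open>T i\<close>, by B1 for words supported at i. Here \<gamma>' may be replaced by
            \<gamma> because \<open>t i = 0\<close>.\<close>
          have "\<gamma> t i + h i = 0"
          proof (rule line_annihilator[OF S T ST[of i]])
            have "\<gamma> t i \<in> S i" "h i \<in> S i"
              using \<gamma>_box[of t] t hS1 S1b i(1) by (auto simp: X_def box_def)
            then show "\<gamma> t i + h i \<in> S i" by (rule add_subgroupD(4)[OF lines_subgroup[OF S]])
            fix b assume b: "b \<in> T i"
            have "single i b \<in> X"
              using b i(1) add_subgroupD(1)[OF lines_subgroup[OF T]] by (auto simp: X_def box_def single_def)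
            moreover have "single i b j = 0" if "j \<in> I" for j using that i(2) by (auto simp: single_def)
            ultimately have "B N (single i b) (\<gamma>' t + h) = 1" by (rule B1)
            then have "\<beta> b (\<gamma> t i + h i) = 1" by (simp add: prod_char_single_left[OF bichar i(1)] \<gamma>i)
            then show "\<beta> (\<gamma> t i + h i) b = 1"
              using bichar_swap[OF bichar alt, of "\<gamma> t i + h i" b] by simp
          qed
          then show ?thesis using tI[OF i] by (simp add: v_def)
        qed
        then have "{i. i < N \<and> v i \<noteq> 0} \<subseteq> I" by auto
        then have "weight N v \<le> card I"
          unfolding weight_def using I(1) finite_subset by (intro card_mono) auto
        then have v0: "v = 0" using C[OF vC] I(2) by fastforce
        have "\<gamma> t + h \<in> box N S"
          using \<gamma>_box[of t] t hS1 S1b add_subgroupD(4)[OF box_lines_subgroup[OF S]] by (auto simp: X_def)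
        \<comment> \<open>So t lies in both complementary boxes.\<close>
        moreover have e: "t = - (\<gamma> t + h)"
          using v0 unfolding v_def by (metis add.assoc eq_neg_iff_add_eq_0)
        ultimately have "t \<in> box N S"
          using add_subgroupD(3)[OF box_lines_subgroup[OF S], of "\<gamma> t + h" N] by (simp only: e[symmetric])
        then have t0: "t = 0" using box_disjoint[of S T N] ST t by (auto simp: X_def)
        \<comment> \<open>For t = 0 this is read off from \<open>\<gamma>' 0 = 0\<close>.\<close>
        have "\<gamma> t i = 0" for i
          using \<gamma>'(1)[of t i] \<gamma>'(2) \<gamma>_box[of t] t t0 by (cases "i < N") (auto simp: X_def box_def)
        then have "\<gamma> t = 0" by auto
        then have "h = 0" using e t0 by simp
        then show False using False t0 by simp
      qed
      then show ?thesis using False by auto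
    qed
  qed
  also have "\<dots> = (if h = 0 then of_nat (card S2) * (\<Sum>x\<in>X. E x x) else 0)"
    using finX zeroX by simp
  finally show ?thesis unfolding X_def h_def by auto
qed


text \<open>The column of U for the word w is a plane wave on \<open>box N T\<close> with frequency
  \<open>m w\<close> in \<open>box N S\<close>, times the quadratic phase \<phi>. S1 and S2 together
  exhaust \<open>box N S\<close>, so U is square; the error condition is
  \<open>partial_trace\<close> with y, y' the labels of two logical words.\<close>

theorem eaqecc_of_symplectic_code:
  assumes C: "add_subgroup C" "C \<subseteq> V N" "C \<inter> perp N C = {0}" "card C = Q ^ (2 * K)" and KN: "K \<le> N"
    and d: "\<And>x. x \<in> C \<Longrightarrow> x \<noteq> 0 \<Longrightarrow> d \<le> weight N x"
  shows "eaqecc_exists Q N K d (N - K)"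
proof -
  obtain S T \<gamma> S1 S2 \<tau> where S: "\<And>i. S i \<in> Lines" and T: "\<And>i. T i \<in> Lines" and ST: "\<And>i. S i \<inter> T i = {0}"
    and \<gamma>: "\<And>x. x \<in> box N T \<Longrightarrow> \<gamma> x \<in> box N S"
    "\<And>x y. x \<in> box N T \<Longrightarrow> y \<in> box N T \<Longrightarrow> \<gamma> (x + y) = \<gamma> x + \<gamma> y"
    "\<And>x y. x \<in> box N T \<Longrightarrow> y \<in> box N T \<Longrightarrow> B N x (\<gamma> y) = B N y (\<gamma> x)"
    and S12: "add_subgroup S1" "add_subgroup S2" "S1 \<subseteq> box N S" "S2 \<subseteq> box N S"
    "card S1 = Q ^ K" "card S2 = Q ^ (N - K)" "S1 \<inter> S2 = {0}"
    and \<tau>: "\<And>z. z \<in> S2 \<Longrightarrow> \<tau> z \<in> box N T"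
    and key: "\<And>t h. t \<in> box N T \<Longrightarrow> h \<in> S1 \<Longrightarrow> (\<Sum>z\<in>S2. B N t z * B N h (\<tau> z)) \<noteq> 0 \<Longrightarrow> t + \<gamma> t + h \<in> C"
    by (rule graph_form[OF C KN]) blast
  obtain \<phi> \<gamma>' where \<phi>: "\<And>x. cmod (\<phi> x) = 1" "\<phi> 0 = 1"
    "\<And>x t. x \<in> box N T \<Longrightarrow> t \<in> box N T \<Longrightarrow> \<phi> (x + t) = \<phi> x * \<phi> t * B N x (\<gamma>' t)"
    and \<gamma>': "\<And>j t. t \<in> box N T \<Longrightarrow> j < N \<Longrightarrow> t j = 0 \<Longrightarrow> \<gamma>' t j = \<gamma> t j" "\<gamma>' 0 = 0"
    by (rule quadratic_character[where T = T and N = N and \<gamma> = \<gamma>, OF T \<gamma>(2,3)]) blast+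
  have Q0: "0 < Q" using Q2 by simp
  have finS: "finite S1" "finite S2"
    using finite_subset[OF S12(3) finite_box] finite_subset[OF S12(4) finite_box] by simp_all
  have "\<exists>f. bij_betw f {..<Q} (T i)" for i
    using lines_size[OF T] by (intro finite_same_card_bij) auto
  \<comment> \<open>Labelling line by line keeps positions: an error on the qudits in I is an error
    on the coordinates in I.\<close>
  then obtain f where f: "\<And>i. bij_betw (f i) {..<Q} (T i)" by metis
  obtain Y where Y: "bij_betw Y (qudits Q K) S1"
    using finite_same_card_bij[OF finite_qudits finS(1)] S12(5) card_qudits by metis
  obtain Z where Z: "bij_betw Z (qudits Q (N - K)) S2"
    using finite_same_card_bij[OF finite_qudits finS(2)] S12(6) card_qudits by metis
  define X where "X x = (\<lambda>i. if i < N then f i (x ! i) else 0)" for x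
  have Xinj: "inj_on X (qudits Q N)"
  proof (rule inj_onI)
    fix x y assume x: "x \<in> qudits Q N" and y: "y \<in> qudits Q N" and e: "X x = X y"
    show "x = y"
    proof (rule nth_equalityI)
      show "length x = length y" using x y by (simp add: qudits_def)
      fix i assume "i < length x"
      then have i: "i < N" using x by (simp add: qudits_def)
      then have "f i (x ! i) = f i (y ! i)" using fun_cong[OF e, of i] by (simp add: X_def)
      moreover have "x ! i \<in> {..<Q}" "y ! i \<in> {..<Q}"
        using x y i unfolding qudits_def by (metis (mono_tags, lifting) mem_Collect_eq nth_mem subsetD)+
      ultimately show "x ! i = y ! i"
        using bij_betw_imp_inj_on[OF f[of i]] by (metis inj_onD)
    qed
  qed
  have Xsub: "X ` qudits Q N \<subseteq> box N T"
  proof -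
    have "f i (x ! i) \<in> T i" if "x \<in> qudits Q N" "i < N" for x i
    proof -
      have "x ! i \<in> {..<Q}"
        using that unfolding qudits_def by (metis (mono_tags, lifting) mem_Collect_eq nth_mem subsetD)
      then show ?thesis using f[of i] by (auto simp: bij_betw_def)
    qed
    then show ?thesis by (auto simp: X_def box_def)
  qed
  have X: "bij_betw X (qudits Q N) (box N T)"
    unfolding bij_betw_def using Xinj Xsub
    by (auto intro!: card_subset_eq[OF finite_box] simp: card_image card_qudits card_box_lines[OF T])
  define Xi where "Xi = inv_into (qudits Q N) X"
  have Xi: "Xi x \<in> qudits Q N" "X (Xi x) = x" if "x \<in> box N T" for x
    using bij_betw_inv_into_right[OF X that] bij_betw_apply[OF bij_betw_inv_into[OF X] that]
    by (auto simp: Xi_def)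
  have XiX: "Xi (X x) = x" if "x \<in> qudits Q N" for x
    using bij_betw_inv_into_left[OF X that] by (simp add: Xi_def)
  define s where "s = complex_of_real (1 / sqrt (real (Q ^ N)))"
  have ss: "cnj s * s = 1 / of_nat (Q ^ N)"
    using Q0 unfolding s_def by (simp flip: of_real_mult of_nat_power)
  define m where "m w = Y (take K w) + Z (drop K w)" for w
  \<comment> \<open>A unimodular column factor, hence harmless for unitarity. It supplies the factor
    \<open>B N h (\<tau> z)\<close>, so that the trace over pairs becomes exactly the sum over S2
    from \<open>graph_form\<close>.\<close>
  define r where "r w = B N (Y (take K w)) (\<tau> (Z (drop K w)))" for w
  define U where "U x w = s * (\<phi> (X x) * B N (X x) (m w) * r w)" for x w
  have r1: "cnj (r w) * r w = 1" for w unfolding r_def by (rule bicharD(11)[OF B_bichar])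
  have \<phi>1: "cnj (\<phi> x) * \<phi> x = 1" for x
    using \<phi>(1)[of x] complex_norm_square[of "\<phi> x"] by (simp add: mult.commute)
  have m: "bij_betw m (qudits Q N) (box N S)"
  proof -
    have inj: "inj_on m (qudits Q N)"
    proof (rule inj_onI)
      fix w w' assume w: "w \<in> qudits Q N" "w' \<in> qudits Q N" and e: "m w = m w'"
      have q: "take K w \<in> qudits Q K" "take K w' \<in> qudits Q K" "drop K w \<in> qudits Q (N - K)" "drop K w' \<in> qudits Q (N - K)"
        using w KN by (auto simp: qudits_def dest: in_set_takeD in_set_dropD)
      have "Y (take K w) = Y (take K w') \<and> Z (drop K w) = Z (drop K w')"
        using q bij_betw_apply[OF Y] bij_betw_apply[OF Z] e
        by (intro direct_sum_inj[OF S12(1,2,7)]) (auto simp: m_def)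
      then have "take K w = take K w'" "drop K w = drop K w'"
        using q bij_betw_imp_inj_on[OF Y] bij_betw_imp_inj_on[OF Z] by (meson inj_onD)+
      then show "w = w'" by (metis append_take_drop_id)
    qed
    have "m w \<in> box N S" if w: "w \<in> qudits Q N" for w
    proof -
      have q: "take K w \<in> qudits Q K" "drop K w \<in> qudits Q (N - K)"
        using w KN by (auto simp: qudits_def dest: in_set_takeD in_set_dropD)
      then have "Y (take K w) \<in> box N S" "Z (drop K w) \<in> box N S"
        using bij_betw_apply[OF Y] bij_betw_apply[OF Z] S12(3,4) by auto
      then show ?thesis unfolding m_def by (rule add_subgroupD(4)[OF box_lines_subgroup[OF S]])
    qed
    then show ?thesis
      unfolding bij_betw_def using inj
      by (auto intro!: card_subset_eq[OF finite_box] simp: card_image card_qudits card_box_lines[OF S])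
  qed
  have TS: "\<And>i. T i \<inter> S i = {0}" using ST by (simp add: Int_commute)
  have "qunitary (qudits Q N) U"
    unfolding qunitary_def qop_eq_def qcomp_def qadj_def qid_def
  proof (intro conjI ballI)
    fix x x' assume x: "x \<in> qudits Q N" "x' \<in> qudits Q N"
    have "(\<Sum>w\<in>qudits Q N. U x w * cnj (U x' w)) =
        (\<Sum>w\<in>qudits Q N. (cnj s * s * \<phi> (X x) * cnj (\<phi> (X x'))) * (cnj (r w) * r w) * (cnj (B N (X x') (m w)) * B N (X x) (m w)))"
      unfolding U_def by (simp add: mult_ac)
    also have "\<dots> = (cnj s * s * \<phi> (X x) * cnj (\<phi> (X x'))) * (\<Sum>z\<in>box N S. cnj (B N (X x') z) * B N (X x) z)"
      unfolding r1 sum.reindex_bij_betw[OF m, symmetric] by (simp add: sum_distrib_left)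
    also have "\<dots> = (cnj s * s * \<phi> (X x) * cnj (\<phi> (X x'))) * (if X x' = X x then of_nat (Q ^ N) else 0)"
      using box_character_sum[where S = S and T = T, OF S T ST, of "X x'" N "X x"] x Xsub by (simp add: image_subset_iff)
    also have "\<dots> = (if x = x' then 1 else 0)"
      using inj_on_eq_iff[OF Xinj x(2,1)] \<phi>1[of "X x"] ss Q0 by (auto simp: mult_ac)
    finally show "(\<Sum>z\<in>qudits Q N. U x z * cnj (U x' z)) = (if x = x' then 1 else 0)" .
  next
    fix w w' assume w: "w \<in> qudits Q N" "w' \<in> qudits Q N"
    have "(\<Sum>x\<in>qudits Q N. cnj (U x w) * U x w') =
        (\<Sum>x\<in>qudits Q N. (cnj s * s * cnj (r w) * r w') * (cnj (\<phi> (X x)) * \<phi> (X x)) * (B N (m w) (X x) * cnj (B N (m w') (X x))))"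
      unfolding U_def by (simp add: mult_ac B_swap[of N "m w" "X _"] B_swap[of N "m w'" "X _"])
    also have "\<dots> = (cnj s * s * cnj (r w) * r w') * (\<Sum>z\<in>box N T. cnj (B N (m w') z) * B N (m w) z)"
      unfolding \<phi>1 sum.reindex_bij_betw[OF X, symmetric] by (simp add: sum_distrib_left mult_ac)
    also have "\<dots> = (cnj s * s * cnj (r w) * r w') * (if m w' = m w then of_nat (Q ^ N) else 0)"
      using box_character_sum[where S = T and T = S, OF T S TS, of "m w'" N "m w"] w bij_betw_apply[OF m] by simp
    also have "\<dots> = (if w = w' then 1 else 0)"
      using inj_on_eq_iff[OF bij_betw_imp_inj_on[OF m] w(2,1)] r1[of w] ss Q0 by (auto simp: mult_ac)
    finally show "(\<Sum>z\<in>qudits Q N. cnj (U z w) * U z w') = (if w = w' then 1 else 0)" .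
  qed
  then show ?thesis
  proof (rule eaqecc_from_unitary[OF Q0 KN])
    fix E I assume I: "I \<subseteq> {..<N}" "card I < d" and E: "acts_only_on Q N I E"
    obtain F where F: "\<And>x y. x \<in> qudits Q N \<Longrightarrow> y \<in> qudits Q N \<Longrightarrow>
        E x y = (if \<forall>i<N. i \<notin> I \<longrightarrow> x ! i = y ! i then F (nths x I) (nths y I) else 0)"
      using E unfolding acts_only_on_def qop_eq_def by blast
    define E' where "E' x y = E (Xi x) (Xi y)" for x y
    have Xn: "x i = f i (Xi x ! i)" if "x \<in> box N T" "i < N" for x i
      using fun_cong[OF Xi(2)[OF that(1)], of i] that(2) by (simp add: X_def)
    have finj: "Xi x ! i = Xi y ! i \<longleftrightarrow> x i = y i" if "x \<in> box N T" "y \<in> box N T" "i < N" for x y i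
    proof -
      have "Xi x ! i \<in> {..<Q}" "Xi y ! i \<in> {..<Q}"
        using Xi(1)[OF that(1)] Xi(1)[OF that(2)] that(3) unfolding qudits_def
        by (metis (mono_tags, lifting) mem_Collect_eq nth_mem subsetD)+
      then show ?thesis
        unfolding Xn[OF that(1,3)] Xn[OF that(2,3)]
        using inj_on_eq_iff[OF bij_betw_imp_inj_on[OF f[of i]]] by metis
    qed
    have E1: "x i = x' i" if "x \<in> box N T" "x' \<in> box N T" "E' x x' \<noteq> 0" "i < N" "i \<notin> I" for x x' i
      using that F[OF Xi(1)[OF that(1)] Xi(1)[OF that(2)]] finj[OF that(1,2,4)]
      by (auto simp: E'_def split: if_splits)
    have E2: "E' (x + r) (x' + r) = E' x x'"
      if x: "x \<in> box N T" "x' \<in> box N T" and r: "r \<in> box N T" "\<And>i. i \<in> I \<Longrightarrow> r i = 0" for x x' r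
    proof -
      note xr = add_subgroupD(4)[OF box_lines_subgroup[OF T] x(1) r(1)]
        add_subgroupD(4)[OF box_lines_subgroup[OF T] x(2) r(1)]
      have len: "length (Xi x) = N" if "x \<in> box N T" for x
        using Xi(1)[OF that] by (simp add: qudits_def)
      have n: "nths (Xi (y + r)) I = nths (Xi y) I" if y: "y \<in> box N T" "y + r \<in> box N T" for y
        using finj[OF y(2,1)] r(2) len[OF y(1)] len[OF y(2)] by (intro nths_cong) auto
      have "(\<forall>i<N. i \<notin> I \<longrightarrow> Xi (x + r) ! i = Xi (x' + r) ! i) \<longleftrightarrow> (\<forall>i<N. i \<notin> I \<longrightarrow> Xi x ! i = Xi x' ! i)"
        using finj[OF xr] finj[OF x] by simp
      then show ?thesis
        unfolding E'_def F[OF Xi(1)[OF xr(1)] Xi(1)[OF xr(2)]] F[OF Xi(1)[OF x(1)] Xi(1)[OF x(2)]]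
        using n[OF x(1) xr(1)] n[OF x(2) xr(2)] by auto
    qed
    define \<kappa> where "\<kappa> = cnj s * s * (of_nat (card S2) * (\<Sum>x\<in>box N T. E' x x))"
    have "(\<Sum>b\<in>qudits Q (N - K). \<Sum>x\<in>qudits Q N. \<Sum>x'\<in>qudits Q N. cnj (U x (u @ b)) * E x x' * U x' (u' @ b)) =
        (if u = u' then \<kappa> else 0)" if u: "u \<in> qudits Q K" "u' \<in> qudits Q K" for u u'
    proof -
      have len: "length u = K" "length u' = K" using u by (auto simp: qudits_def)
      have "(\<Sum>b\<in>qudits Q (N - K). \<Sum>x\<in>qudits Q N. \<Sum>x'\<in>qudits Q N. cnj (U x (u @ b)) * E x x' * U x' (u' @ b)) =
          (\<Sum>b\<in>qudits Q (N - K). \<Sum>x\<in>qudits Q N. \<Sum>x'\<in>qudits Q N. cnj s * s *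
            (cnj (\<phi> (X x) * B N (X x) (Y u + Z b) * B N (Y u) (\<tau> (Z b))) * E' (X x) (X x') *
              (\<phi> (X x') * B N (X x') (Y u' + Z b) * B N (Y u') (\<tau> (Z b)))))"
        using len by (intro sum.cong refl) (simp add: U_def m_def r_def E'_def XiX mult_ac)
      also have "\<dots> = cnj s * s * (\<Sum>z\<in>S2. \<Sum>x\<in>box N T. \<Sum>x'\<in>box N T.
          cnj (\<phi> x * B N x (Y u + z) * B N (Y u) (\<tau> z)) * E' x x' * (\<phi> x' * B N x' (Y u' + z) * B N (Y u') (\<tau> z)))"
        unfolding sum.reindex_bij_betw[OF X, symmetric] sum.reindex_bij_betw[OF Z, symmetric]
        by (simp only: sum_distrib_left)
      also have "\<dots> = cnj s * s * (if Y u = Y u' then of_nat (card S2) * (\<Sum>x\<in>box N T. E' x x) else 0)"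
      proof (rule arg_cong[where f = "\<lambda>x. cnj s * s * x"],
          rule partial_trace[where S = S and T = T and \<gamma> = \<gamma> and C = C and d = d and I = I and \<gamma>' = \<gamma>'])
        show "Y u \<in> S1" "Y u' \<in> S1" using bij_betw_apply[OF Y] u by auto
      qed fact+
      also have "\<dots> = (if u = u' then \<kappa> else 0)"
        using inj_on_eq_iff[OF bij_betw_imp_inj_on[OF Y] u] by (simp add: \<kappa>_def)
      finally show ?thesis .
    qed
    then show "\<exists>\<gamma>. \<forall>u\<in>qudits Q K. \<forall>u'\<in>qudits Q K.
        (\<Sum>b\<in>qudits Q (N - K). \<Sum>x\<in>qudits Q N. \<Sum>x'\<in>qudits Q N. cnj (U x (u @ b)) * E x x' * U x' (u' @ b))
          = (if u = u' then \<gamma> else 0)"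
      by blast
  qed
qed

end

section \<open>Additive characters and forms over finite fields\<close>

lemma finite_field_power_card:
  fixes x :: "'a::{field,finite}"
  shows "x ^ CARD('a) = x"
proof (cases "x = 0")
  case False
  have "(\<Prod>y\<in>UNIV - {0}. x * y) = (\<Prod>y\<in>UNIV - {0}. y)"
    by (rule prod.reindex_bij_witness[of _ "\<lambda>y. y / x" "\<lambda>y. x * y"]) (use False in auto)
  then have "x ^ (CARD('a) - 1) * (\<Prod>y\<in>UNIV - {0}. y) = 1 * (\<Prod>y\<in>UNIV - {0::'a}. y)"
    by (simp add: prod.distrib)
  moreover have "(\<Prod>y\<in>UNIV - {0::'a}. y) \<noteq> 0" by simp
  ultimately have "x ^ (CARD('a) - 1) = 1" by (metis mult_right_cancel)
  then have "x ^ Suc (CARD('a) - 1) = x" by (simp only: power_Suc mult_1_right)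
  moreover have "Suc (CARD('a) - 1) = CARD('a)" using zero_less_card_finite[where 'a = 'a] by simp
  ultimately show ?thesis by (simp only:)
qed (simp add: zero_power)

lemma finite_field_CHAR:
  assumes "prime p" "CARD('a::{field,finite}) = p ^ e"
  shows "CHAR('a) = p"
proof -
  have "CHAR('a) > 0" by (rule finite_imp_CHAR_pos) simp
  then have "prime CHAR('a)" by (rule prime_CHAR_semidom)
  moreover have "CHAR('a) dvd p ^ e" using CHAR_dvd_CARD[where 'a = 'a] assms(2) by simp
  ultimately show ?thesis using assms(1) by (metis prime_dvd_power primes_dvd_imp_eq)
qed

text \<open>Take a subgroup H of greatest size avoiding 1. Adjoining the multiples of any x outside
  H must capture 1, so every x is congruent modulo H to a multiple of 1, unique modulo p. The
  quotient is cyclic of order p, generated by 1, and a p-th root of unity other than 1 gives the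
  character.\<close>

lemma nontrivial_additive_character:
  assumes p: "prime p" and char: "of_nat p = (0::'a::{field,finite})"
  obtains \<chi> :: "'a::{field,finite} \<Rightarrow> complex" where "\<And>x y. \<chi> (x + y) = \<chi> x * \<chi> y" "\<And>x. cmod (\<chi> x) = 1" "\<chi> 1 \<noteq> 1"
proof -
  have p2: "2 \<le> p" using p prime_ge_2_nat by blast
  have cong: "of_nat a = (of_nat b :: 'a)" if "[a = b] (mod p)" for a b
  proof -
    have "of_nat a = (of_nat (a mod p) :: 'a)" for a
      by (subst mult_div_mod_eq[of p a, symmetric]) (simp only: of_nat_add of_nat_mult char mult_zero_left add_0_left)
    then show ?thesis using that unfolding cong_def by metis
  qed
  have inverse: "\<exists>m'. of_nat (m' * m) = (1::'a)" if "\<not> p dvd m" for m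
  proof -
    have "coprime m p" using p that by (metis coprime_commute prime_imp_coprime)
    then obtain m' where "[m * m' = 1] (mod p)" using cong_solve_coprime_nat by auto
    then show ?thesis using cong by (metis mult.commute of_nat_1)
  qed
  define P where "P H \<longleftrightarrow> add_subgroup H \<and> (1::'a) \<notin> H" for H
  have "P {0}" by (simp add: P_def add_subgroup_def)
  moreover have "card H < Suc CARD('a)" if "P H" for H
    by (simp add: card_mono less_Suc_eq_le)
  ultimately obtain H where PH: "P H" and max: "\<And>M. P M \<Longrightarrow> card M \<le> card H"
    using ex_has_greatest_nat[of P "{0}" card "Suc CARD('a)"] by metis
  have H: "add_subgroup H" and H1: "1 \<notin> H" using PH by (simp_all add: P_def)
  have Hmult: "of_nat m * h \<in> H" if "h \<in> H" for m h
    using add_subgroupD(1,4)[OF H] that by (induction m) (simp_all add: algebra_simps)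
  have "\<exists>j. x - of_nat j \<in> H" for x
  proof (cases "x \<in> H")
    case True
    then show ?thesis by (intro exI[of _ 0]) simp
  next
    case False
    define M where "M = {h + of_nat m * x | h m. h \<in> H}"
    have MI: "h + of_nat m * x \<in> M" if "h \<in> H" for h m using that unfolding M_def by blast
    have "add_subgroup M"
      unfolding add_subgroup_def
    proof (intro conjI ballI)
      show "0 \<in> M" using MI[OF add_subgroupD(1)[OF H], of 0] by simp
      fix u v assume "u \<in> M" "v \<in> M"
      then obtain h m h' m' where u: "h \<in> H" "u = h + of_nat m * x" and v: "h' \<in> H" "v = h' + of_nat m' * x"
        unfolding M_def by blast
      \<comment> \<open>Lets natural-number coefficients be subtracted: p - 1 stands for -1.\<close>
      have "of_nat (p - 1) = (- 1 :: 'a)" using p2 char by (simp add: of_nat_diff)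
      then have e: "of_nat (m + (p - 1) * m') = (of_nat m - of_nat m' :: 'a)" by simp
      have "u - v = (h - h') + of_nat (m + (p - 1) * m') * x"
        unfolding e u(2) v(2) by (simp add: algebra_simps)
      then show "u - v \<in> M" using MI add_subgroupD(2)[OF H u(1) v(1)] by metis
    qed
    moreover have "H \<subset> M"
    proof -
      have "x \<in> M" using MI[OF add_subgroupD(1)[OF H], of 1] by simp
      moreover have "H \<subseteq> M" using MI[of _ 0] by auto
      ultimately show ?thesis using False by blast
    qed
    then have "card H < card M" by (intro psubset_card_mono) auto
    then have "\<not> P M" using max by (metis not_le)
    ultimately have "1 \<in> M" by (simp add: P_def)
    then obtain h m where hm: "h \<in> H" "1 = h + of_nat m * x" unfolding M_def by blast
    have "\<not> p dvd m"
    proof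
      assume "p dvd m"
      then have "of_nat m = (0::'a)" using char by (metis dvdE mult_zero_left of_nat_mult)
      then show False using hm H1 by simp
    qed
    then obtain m' where "of_nat (m' * m) = (1::'a)" using inverse by blast
    then have "of_nat m' * (of_nat m * x) = x" by (simp flip: mult.assoc)
    moreover have "of_nat m' * (1::'a) = of_nat m' * h + of_nat m' * (of_nat m * x)"
      by (subst hm(2)) (simp add: algebra_simps)
    ultimately have e: "of_nat m' = of_nat m' * h + x" by (simp only: mult_1_right)
    have "x - of_nat m' = - (of_nat m' * h)" by (subst e) simp
    then show ?thesis using add_subgroupD(3)[OF H Hmult[OF hm(1)]] by metis
  qed
  then obtain j where j: "\<And>x. x - of_nat (j x) \<in> H" by metis
  have dvd_diff: "p dvd b - a" if "a \<le> b" "of_nat b - of_nat a \<in> H" for a b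
  proof (rule ccontr)
    assume "\<not> p dvd b - a"
    then obtain m' where "of_nat (m' * (b - a)) = (1::'a)" using inverse by blast
    moreover have "of_nat m' * of_nat (b - a) \<in> H" using that by (intro Hmult) (simp add: of_nat_diff)
    ultimately show False using H1 by simp
  qed
  have uniq: "[a = b] (mod p)" if "x - of_nat a \<in> H" "x - of_nat b \<in> H" for x a b
  proof -
    have "(x - of_nat b) - (x - of_nat a) \<in> H" "(x - of_nat a) - (x - of_nat b) \<in> H"
      using add_subgroupD(2)[OF H] that by blast+
    then have "of_nat a - of_nat b \<in> H" "of_nat b - of_nat a \<in> H" by simp_all
    then have "a \<le> b \<Longrightarrow> [b = a] (mod p)" "b \<le> a \<Longrightarrow> [a = b] (mod p)"
      using dvd_diff[of a b] dvd_diff[of b a] by (simp_all add: cong_altdef_nat)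
    then show ?thesis by (metis cong_sym nle_le)
  qed
  have "card {z::complex. z ^ p = 1} = p" using p2 by (intro card_roots_unity_eq) simp
  then have "{z::complex. z ^ p = 1} \<noteq> {1}" using p2 by (metis One_nat_def card.empty card.insert empty_iff finite.emptyI not_less_eq_eq numeral_2_eq_2 order_refl)
  then obtain \<zeta> :: complex where \<zeta>: "\<zeta> ^ p = 1" "\<zeta> \<noteq> 1" by auto
  have n\<zeta>: "cmod \<zeta> = 1"
    using power_eq_imp_eq_norm[of \<zeta> p 1] \<zeta>(1) p2 by simp
  have \<zeta>_cong: "\<zeta> ^ a = \<zeta> ^ b" if "[a = b] (mod p)" for a b
  proof -
    have "\<zeta> ^ a = \<zeta> ^ (a mod p)" for a
      by (subst mult_div_mod_eq[of p a, symmetric]) (simp only: power_add power_mult \<zeta>(1) power_one mult_1_left)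
    then show ?thesis using that unfolding cong_def by metis
  qed
  define \<chi> where "\<chi> x = \<zeta> ^ j x" for x
  have "\<chi> (x + y) = \<chi> x * \<chi> y" for x y
  proof -
    have "(x - of_nat (j x)) + (y - of_nat (j y)) \<in> H" by (intro add_subgroupD(4)[OF H] j)
    then have "(x + y) - of_nat (j x + j y) \<in> H" by (simp add: algebra_simps)
    from \<zeta>_cong[OF uniq[OF j this]] show ?thesis by (simp add: \<chi>_def power_add)
  qed
  moreover have "cmod (\<chi> x) = 1" for x by (simp add: \<chi>_def norm_power n\<zeta>)
  moreover have "\<chi> 1 \<noteq> 1"
  proof -
    have "1 - of_nat 1 \<in> H" using add_subgroupD(1)[OF H] by simp
    from \<zeta>_cong[OF uniq[OF j this]] show ?thesis using \<zeta>(2) by (simp add: \<chi>_def)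
  qed
  ultimately show ?thesis by (rule that)
qed

locale galois_field =
  fixes p e l r :: nat and F :: "'a::{field,finite} itself"
  assumes p: "prime p" and card_a: "CARD('a) = p ^ e" and l: "0 < l" and le: "l \<le> e" and r: "r = p ^ l"
begin

lemma CHAR_a: "CHAR('a) = p"
  using finite_field_CHAR[OF p card_a] .

lemma r_pos: "0 < r" using p r by (simp add: prime_gt_0_nat)

lemma frob_add: "(x + y :: 'a) ^ r = x ^ r + y ^ r"
  using freshmans_dream'[where 'a = 'a, of r l x y] p r by (simp add: CHAR_a)

lemma frob_diff: "(x - y :: 'a) ^ r = x ^ r - y ^ r"
  using frob_add[of "x - y" y] by simp

lemma frob_sum: "(\<Sum>i\<in>I. f i :: 'a) ^ r = (\<Sum>i\<in>I. f i ^ r)"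
  using freshmans_dream_sum'[where 'a = 'a, of r l f I] p r by (simp add: CHAR_a)

lemma frob_0: "(x :: 'a) ^ r = 0 \<longleftrightarrow> x = 0"
  using r_pos by simp

lemma frob_inj: "(x :: 'a) ^ r = y ^ r \<longleftrightarrow> x = y"
  using frob_diff[of x y] frob_0[of "x - y"] by auto

lemma frob_surj: "\<exists>x. x ^ r = (y :: 'a)"
proof -
  have "inj (\<lambda>x::'a. x ^ r)" by (rule injI) (simp add: frob_inj)
  then have "surj (\<lambda>x::'a. x ^ r)" by (intro finite_UNIV_inj_surj) auto
  then show ?thesis by (metis surjD)
qed

lemma additive_character:
  obtains \<chi> :: "'a \<Rightarrow> complex" where "\<And>x y. \<chi> (x + y) = \<chi> x * \<chi> y" "\<And>x. cmod (\<chi> x) = 1" "\<chi> 1 \<noteq> 1"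
    "\<chi> 0 = 1" "\<And>(I :: nat set) f. (\<Prod>i\<in>I. \<chi> (f i)) = \<chi> (\<Sum>i\<in>I. f i)"
proof -
  have "of_nat p = (0::'a)" using of_nat_CHAR[where 'a = 'a] by (simp add: CHAR_a)
  then obtain \<chi> :: "'a \<Rightarrow> complex" where \<chi>: "\<And>x y. \<chi> (x + y) = \<chi> x * \<chi> y" "\<And>x. cmod (\<chi> x) = 1" "\<chi> 1 \<noteq> 1"
    using nontrivial_additive_character[OF p] by metis
  have \<chi>0: "\<chi> 0 = 1" using \<chi>(1)[of 0 0] \<chi>(2)[of 0] by auto
  have \<chi>_sum: "(\<Prod>i\<in>I. \<chi> (f i)) = \<chi> (\<Sum>i\<in>I. f i)" for I :: "nat set" and f
    by (induction I rule: infinite_finite_induct) (simp_all add: \<chi>0 \<chi>(1))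
  show ?thesis by (rule that[OF \<chi> \<chi>0 \<chi>_sum])
qed

lemma card_ge_2: "2 \<le> CARD('a)"
proof -
  have "{0, 1} \<subseteq> (UNIV :: 'a set)" by simp
  from card_mono[OF _ this] show ?thesis by simp
qed

end

text \<open>The code as functions vanishing from N on, ready to sit inside \<open>box N\<close>.
  \<open>D_lcd\<close> is the one-sided statement that no nonzero codeword lies in the Galois
  dual.\<close>

locale lcd_function_code = galois_field p e l r F
  for p e l r and F :: "'a::{field,finite} itself" +
  fixes N K d :: nat and D :: "(nat \<Rightarrow> 'a) set"
  assumes D_box: "D \<subseteq> box N (\<lambda>_. UNIV)"
    and D_zero: "(\<lambda>_. 0) \<in> D"
    and D_add: "x \<in> D \<Longrightarrow> y \<in> D \<Longrightarrow> (\<lambda>i. x i + y i) \<in> D"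
    and D_scale: "x \<in> D \<Longrightarrow> (\<lambda>i. a * x i) \<in> D"
    and D_card: "card D = CARD('a) ^ K"
    and D_lcd: "y \<in> D \<Longrightarrow> (\<And>c. c \<in> D \<Longrightarrow> (\<Sum>i<N. c i * y i ^ r) = 0) \<Longrightarrow> y = (\<lambda>_. 0)"
    and D_weight: "x \<in> D \<Longrightarrow> x \<noteq> (\<lambda>_. 0) \<Longrightarrow> d \<le> weight N x"
    and KN: "K \<le> N"
begin

lemma zero_fun_eq: "(0 :: nat \<Rightarrow> 'b::zero) = (\<lambda>_. 0)"
  by (rule ext) simp

lemma D_subgroup: "add_subgroup D"
  unfolding add_subgroup_def
proof (intro conjI ballI)
  show "0 \<in> D" using D_zero by (simp add: zero_fun_eq)
  fix x y assume "x \<in> D" "y \<in> D"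
  then have "(\<lambda>i. x i + (- 1) * y i) \<in> D" by (intro D_add D_scale)
  moreover have "(\<lambda>i. x i + (- 1) * y i) = x - y" by (rule ext) simp
  ultimately show "x - y \<in> D" by simp
qed

lemma finite_D: "finite D"
  using D_box finite_box by (rule finite_subset)

definition form :: "(nat \<Rightarrow> 'a) \<Rightarrow> (nat \<Rightarrow> 'a) \<Rightarrow> 'a" where
  "form x y = (\<Sum>i<N. x i * y i ^ r)"

lemma form_scale: "form (\<lambda>i. a * x i) y = a * form x y"
  by (simp add: form_def sum_distrib_left mult_ac)

lemma form_scale_right: "form x (\<lambda>i. a * y i) = a ^ r * form x y"
  by (simp add: form_def sum_distrib_left power_mult_distrib mult_ac)

lemma form_add: "form (x + x') y = form x y + form x' y" "form x (y + y') = form x y + form x y'"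
  by (simp_all add: form_def frob_add algebra_simps sum.distrib)

text \<open>For general l the form has no symmetry relating its two arguments. On D its right
  radical is 0 by assumption, and \<open>pairing_count\<close> shows that the left radical has the
  same size.\<close>

lemma D_lcd_left:
  assumes c: "c \<in> D" "\<And>y. y \<in> D \<Longrightarrow> form c y = 0"
  shows "c = (\<lambda>_. 0)"
proof -
  obtain \<chi> :: "'a \<Rightarrow> complex" where \<chi>: "\<And>x y. \<chi> (x + y) = \<chi> x * \<chi> y" "\<And>x. cmod (\<chi> x) = 1" "\<chi> 1 \<noteq> 1"
    and \<chi>0: "\<chi> 0 = 1" and \<chi>_sum: "\<And>(I :: nat set) f. (\<Prod>i\<in>I. \<chi> (f i)) = \<chi> (\<Sum>i\<in>I. f i)"
    by (rule additive_character) blast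
  define b where "b x y = \<chi> (form x y)" for x y
  have b: "bichar b" by (simp add: bichar_def b_def form_add \<chi>)
  have right: "y = (\<lambda>_. 0)" if y: "y \<in> D" "\<forall>x\<in>D. b x y = 1" for y
  proof (rule D_lcd[OF y(1)])
    fix x assume x: "x \<in> D"
    show "(\<Sum>i<N. x i * y i ^ r) = 0"
    proof (rule ccontr)
      assume "(\<Sum>i<N. x i * y i ^ r) \<noteq> 0"
      then have nz: "form x y \<noteq> 0" by (simp add: form_def)
      have "b (\<lambda>i. inverse (form x y) * x i) y = 1" using y(2) D_scale[OF x] by blast
      then show False using nz \<chi>(3) by (simp add: b_def form_scale)
    qed
  qed
  have f0: "form x (\<lambda>_. 0) = 0" "form (\<lambda>_. 0) x = 0" for x
    using r_pos by (simp_all add: form_def)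
  have "{y \<in> D. \<forall>x\<in>D. b x y = 1} = {\<lambda>_. 0}"
  proof (intro equalityI subsetI)
    fix y assume "y \<in> {y \<in> D. \<forall>x\<in>D. b x y = 1}"
    then show "y \<in> {\<lambda>_. 0}" using right[of y] by blast
  next
    fix y :: "nat \<Rightarrow> 'a" assume "y \<in> {\<lambda>_. 0}"
    then show "y \<in> {y \<in> D. \<forall>x\<in>D. b x y = 1}" using D_zero by (simp add: b_def f0 \<chi>0)
  qed
  with pairing_count[OF b D_subgroup finite_D D_subgroup finite_D]
  have "card {x \<in> D. \<forall>y\<in>D. b x y = 1} = 1"
    using D_card card_ge_2 by simp
  then obtain w where "{x \<in> D. \<forall>y\<in>D. b x y = 1} = {w}" by (rule card_1_singletonE)
  moreover have "c \<in> {x \<in> D. \<forall>y\<in>D. b x y = 1}" using c by (simp add: b_def \<chi>0)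
  moreover have "(\<lambda>_. 0) \<in> {x \<in> D. \<forall>y\<in>D. b x y = 1}" using D_zero f0 by (simp add: b_def \<chi>0)
  ultimately show ?thesis by (metis singletonD)
qed

text \<open>Applying the Frobenius power to the second half of a pair turns the determinant form of
  (c, y) and (c', y') into \<open>form c y' - form c' y\<close>. Its radical vanishes by
  \<open>D_lcd\<close> for y and \<open>D_lcd_left\<close> for c, and a nonzero pair has at least
  the weight of a nonzero component.\<close>

theorem eaqecc_same_field: "eaqecc_exists CARD('a) N K d (N - K)"
proof -
  obtain \<chi> :: "'a \<Rightarrow> complex" where \<chi>: "\<And>x y. \<chi> (x + y) = \<chi> x * \<chi> y" "\<And>x. cmod (\<chi> x) = 1" "\<chi> 1 \<noteq> 1"
    and \<chi>0: "\<chi> 0 = 1" and \<chi>_sum: "\<And>(I :: nat set) f. (\<Prod>i\<in>I. \<chi> (f i)) = \<chi> (\<Sum>i\<in>I. f i)"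
    by (rule additive_character) blast
  define \<beta> where "\<beta> g h = \<chi> (fst g * snd h - fst h * snd g)" for g h :: "'a \<times> 'a"
  define Lines where "Lines = range (\<lambda>m. range (\<lambda>x::'a. (x, m * x)))"
  have line_mem: "(a, b) \<in> range (\<lambda>x::'a. (x, m * x)) \<longleftrightarrow> b = m * a" for a b m by auto
  interpret symplectic_group \<beta> Lines "CARD('a)"
  proof
    show "bichar \<beta>"
      unfolding bichar_def \<beta>_def using \<chi>(2) by (simp flip: \<chi>(1) add: algebra_simps)
    show "\<beta> g g = 1" for g by (simp add: \<beta>_def \<chi>0)
    show "g = 0" if g: "\<And>h. \<beta> g h = 1" for g
    proof (rule ccontr)
      assume "g \<noteq> 0"
      then consider "fst g \<noteq> 0" | "snd g \<noteq> 0" by (metis prod.collapse zero_prod_def)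
      then show False
      proof cases
        case 1
        then show False using g[of "(0, inverse (fst g))"] \<chi>(3) by (simp add: \<beta>_def)
      next
        case 2
        then show False using g[of "(- inverse (snd g), 0)"] \<chi>(3) by (simp add: \<beta>_def)
      qed
    qed
    show "CARD('a \<times> 'a) = (CARD('a))\<^sup>2" by (simp add: power2_eq_square)
    show "2 \<le> CARD('a)" by (rule card_ge_2)
    have "inj (\<lambda>m. range (\<lambda>x::'a. (x, m * x)))"
    proof (rule injI)
      fix m m' :: 'a assume "range (\<lambda>x. (x, m * x)) = range (\<lambda>x. (x, m' * x))"
      then have "(1, m) \<in> range (\<lambda>x::'a. (x, m' * x))" using line_mem[of 1 m m] by simp
      then show "m = m'" using line_mem[of 1 m m'] by simp
    qed
    then show "CARD('a) \<le> card Lines" by (simp add: Lines_def card_image)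
    show "add_subgroup \<l>" if \<l>L: "\<l> \<in> Lines" for \<l>
    proof -
      obtain m where \<l>: "\<l> = range (\<lambda>x. (x, m * x))" using \<l>L by (auto simp: Lines_def)
      have "0 \<in> \<l>" unfolding \<l> zero_prod_def line_mem by simp
      moreover have "x - y \<in> \<l>" if "x \<in> \<l>" "y \<in> \<l>" for x y
        using that unfolding \<l> by (cases x; cases y) (auto simp only: line_mem diff_Pair algebra_simps)
      ultimately show ?thesis by (simp add: add_subgroup_def)
    qed
    show "card \<l> = CARD('a)" if \<l>: "\<l> \<in> Lines" for \<l>
    proof -
      obtain m where \<l>: "\<l> = range (\<lambda>x. (x, m * x))" using \<l> by (auto simp: Lines_def)
      show ?thesis unfolding \<l> by (intro card_image) (simp add: inj_def)
    qed
    show "\<beta> g h = 1" if "\<l> \<in> Lines" "g \<in> \<l>" "h \<in> \<l>" for \<l> g h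
      using that by (auto simp: Lines_def \<beta>_def mult_ac \<chi>0)
    show "\<l> \<inter> \<l>' = {0}" if \<l>: "\<l> \<in> Lines" "\<l>' \<in> Lines" "\<l> \<noteq> \<l>'" for \<l> \<l>'
    proof -
      obtain m m' where m: "\<l> = range (\<lambda>x. (x, m * x))" "\<l>' = range (\<lambda>x. (x, m' * x))"
        using \<l> by (auto simp: Lines_def)
      then have "m \<noteq> m'" using \<l>(3) by auto
      then show ?thesis unfolding m by (auto simp: zero_prod_def)
    qed
  qed
  define f where "f = (\<lambda>(c :: nat \<Rightarrow> 'a, y :: nat \<Rightarrow> 'a). (\<lambda>i. (c i, y i ^ r)))"
  have f_diff: "f (c - c', y - y') = f (c, y) - f (c', y')" for c c' y y'
    by (rule ext) (simp add: f_def frob_diff)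
  have f0: "0 \<in> f ` (D \<times> D)"
    using f_diff[of 0 0 0 0] add_subgroupD(1)[OF D_subgroup] by (intro image_eqI[of _ f "(0, 0)"]) simp_all
  have Bf: "B N (f (c, y)) (f (c', y')) = \<chi> (form c y' - form c' y)" for c y c' y'
    unfolding prod_char_def \<beta>_def f_def form_def by (simp add: \<chi>_sum sum_subtractf)
  show ?thesis
  proof (rule eaqecc_of_symplectic_code[of "f ` (D \<times> D)"])
    show "add_subgroup (f ` (D \<times> D))"
      unfolding add_subgroup_def
    proof (intro conjI ballI)
      show "0 \<in> f ` (D \<times> D)" by (rule f0)
      fix u v assume "u \<in> f ` (D \<times> D)" "v \<in> f ` (D \<times> D)"
      then obtain c y c' y' where "c \<in> D" "y \<in> D" "c' \<in> D" "y' \<in> D" "u = f (c, y)" "v = f (c', y')" by blast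
      then show "u - v \<in> f ` (D \<times> D)"
        by (intro image_eqI[of _ f "(c - c', y - y')"])
          (simp_all only: f_diff mem_Sigma_iff add_subgroupD(2)[OF D_subgroup] simp_thms)
    qed
    show "f ` (D \<times> D) \<subseteq> V N"
      using D_box r_pos by (auto simp: f_def box_def zero_prod_def subset_iff)
    have "inj f"
      by (rule injI) (auto simp: f_def fun_eq_iff frob_inj)
    then show "card (f ` (D \<times> D)) = CARD('a) ^ (2 * K)"
      by (simp add: card_image inj_on_subset card_cartesian_product D_card mult_2 power_add)
    show "f ` (D \<times> D) \<inter> perp N (f ` (D \<times> D)) = {0}"
    proof -
      have "x = 0" if x: "x \<in> f ` (D \<times> D)" "x \<in> perp N (f ` (D \<times> D))" for x
      proof -
        obtain c y where cy: "c \<in> D" "y \<in> D" "x = f (c, y)" using x(1) by auto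
        have one: "\<chi> (form c' y - form c y') = 1" if "c' \<in> D" "y' \<in> D" for c' y'
        proof -
          have "B N (f (c', y')) x = 1" using x(2) that by (auto simp: perp_def)
          then show ?thesis by (simp only: cy(3) Bf)
        qed
        have form0: "form c (\<lambda>_. 0) = 0" "form (\<lambda>_. 0) y = 0"
          using r_pos by (simp_all add: form_def)
        \<comment> \<open>D is closed under scalars, so a nonzero value could be scaled to 1, where
          \<chi> is not 1.\<close>
        have "form c' y = 0" if c': "c' \<in> D" for c'
        proof (rule ccontr)
          assume nz: "form c' y \<noteq> 0"
          have "\<chi> (form (\<lambda>i. inverse (form c' y) * c' i) y - form c (\<lambda>_. 0)) = 1"
            by (intro one D_scale c' D_zero)
          then show False using nz \<chi>(3) by (simp add: form_scale form0)
        qed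
        then have y0: "y = (\<lambda>_. 0)" by (intro D_lcd[OF cy(2)]) (simp add: form_def)
        have "form c y' = 0" if y': "y' \<in> D" for y'
        proof (rule ccontr)
          assume nz: "form c y' \<noteq> 0"
          \<comment> \<open>A scalar leaves the second argument as its r-th power, and the sign
            offsets the minus in the pairing.\<close>
          obtain a where a: "a ^ r = - inverse (form c y')" using frob_surj by metis
          have "\<chi> (form (\<lambda>_. 0) y - form c (\<lambda>i. a * y' i)) = 1"
            by (intro one D_scale y' D_zero)
          then show False using nz \<chi>(3) by (simp add: form_scale_right form0 a)
        qed
        then have "c = (\<lambda>_. 0)" by (rule D_lcd_left[OF cy(1)])
        then show ?thesis using y0 cy(3) r_pos by (auto simp: f_def zero_prod_def)
      qed
      moreover note f0
      moreover have "0 \<in> perp N (f ` (D \<times> D))" by (rule add_subgroupD(1)[OF perp_subgroup])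
      ultimately show ?thesis by blast
    qed
    fix x assume x: "x \<in> f ` (D \<times> D)" "x \<noteq> 0"
    then obtain c y where cy: "c \<in> D" "y \<in> D" "x = f (c, y)" by auto
    have w: "weight N c \<le> weight N x" "weight N y \<le> weight N x"
      unfolding weight_def cy(3) f_def by (auto intro!: card_mono simp: zero_prod_def r_pos)
    show "d \<le> weight N x"
    proof (cases "c = (\<lambda>_. 0)")
      case True
      have "y \<noteq> (\<lambda>_. 0)" 
      proof
        assume "y = (\<lambda>_. 0)"
        then have "x = 0" using True cy(3) r_pos by (auto simp: f_def zero_prod_def)
        then show False using x(2) by simp
      qed
      then show ?thesis using D_weight[OF cy(2)] w(2) by simp
    qed (use D_weight[OF cy(1)] w(1) in simp)
  qed (rule KN)
qed

end

context lcd_function_code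
begin

text \<open>For q = r^2 the expression x y^r - x^r y is alternating on F_q itself, and it vanishes
  on each line over the subfield K0 of order r. So a single copy of D lives over an alphabet with Q
  = r; that D meets its symplectic complement trivially follows from \<open>D_lcd\<close> by
  scaling.\<close>

theorem eaqecc_hermitian:
  assumes e: "e = 2 * l"
  shows "eaqecc_exists r N K d (N - K)"
proof -
  have card_r: "CARD('a) = r\<^sup>2" using card_a e r by (simp add: power_mult[symmetric] mult.commute)
  have r2: "2 \<le> r"
  proof -
    have "p ^ 1 \<le> p ^ l" using l prime_ge_1_nat[OF p] by (intro power_increasing) simp_all
    then show ?thesis using r prime_ge_2_nat[OF p] by simp
  qed
  have frob_frob: "(x ^ r) ^ r = x" for x :: 'a
    using finite_field_power_card[of x] by (simp add: card_r power2_eq_square power_mult)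
  define K0 where "K0 = {x::'a. x ^ r = x}"
  have K0_sub: "add_subgroup K0"
    using r_pos by (auto simp: K0_def add_subgroup_def frob_diff)
  have root_bound: "card {x. poly q x = 0} \<le> r" if "q \<noteq> 0" "Polynomial.degree q = r" for q :: "'a poly"
    using card_poly_roots_bound[OF that(1)] that(2) by simp
  text \<open>\<open>x \<mapsto> x ^ r - x\<close> is additive with kernel \<open>K0\<close>, and its image consists of roots of \<open>X ^ r + X\<close>;
    both have at most \<open>r\<close> elements, so both have exactly \<open>r\<close>.\<close>
  have "card K0 = r"
  proof -
    define q1 where "q1 = Polynomial.monom (1::'a) r - Polynomial.monom 1 1"
    define q2 where "q2 = Polynomial.monom (1::'a) r + Polynomial.monom 1 1"
    have "Polynomial.coeff q1 r = 1" "Polynomial.coeff q2 r = 1" using r2 by (simp_all add: q1_def q2_def)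
    then have nz: "q1 \<noteq> 0" "q2 \<noteq> 0" by auto
    have "Polynomial.degree q1 \<le> r" "Polynomial.degree q2 \<le> r" unfolding q1_def q2_def
      using r2 by (auto intro!: degree_diff_le degree_add_le order_trans[OF degree_monom_le])
    moreover have "r \<le> Polynomial.degree q1" "r \<le> Polynomial.degree q2"
      using \<open>Polynomial.coeff q1 r = 1\<close> \<open>Polynomial.coeff q2 r = 1\<close> by (auto intro!: le_degree)
    ultimately have deg: "Polynomial.degree q1 = r" "Polynomial.degree q2 = r" by auto
    have "K0 = {x. poly q1 x = 0}" by (auto simp: K0_def q1_def poly_monom)
    then have le: "card K0 \<le> r" using root_bound[OF nz(1) deg(1)] by simp
    have "card (range (\<lambda>x::'a. x ^ r - x)) \<le> r"
    proof -
      have "range (\<lambda>x::'a. x ^ r - x) \<subseteq> {x. poly q2 x = 0}"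
        by (auto simp: q2_def poly_monom frob_diff frob_frob)
      then have "card (range (\<lambda>x::'a. x ^ r - x)) \<le> card {x. poly q2 x = 0}" by (intro card_mono) auto
      then show ?thesis using root_bound[OF nz(2) deg(2)] by simp
    qed
    then have "card (range (\<lambda>x::'a. x ^ r - x)) * card K0 \<le> r * card K0" by (rule mult_le_mono1)
    moreover have "r * r = card (range (\<lambda>x::'a. x ^ r - x)) * card K0"
      using card_image_kernel[OF add_subgroup_UNIV, of "\<lambda>x::'a. x ^ r - x"]
      by (simp add: card_r power2_eq_square frob_add K0_def algebra_simps)
    ultimately have "r * r \<le> r * card K0" by (simp only:)
    then have "r \<le> card K0" using r_pos by simp
    then show ?thesis using le by simp
  qed
  then have "card K0 < CARD('a)" using r2 by (simp add: card_r power2_eq_square)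
  then obtain w :: 'a where w: "w ^ r \<noteq> w" unfolding K0_def
    by (metis (mono_tags, lifting) UNIV_eq_I less_irrefl mem_Collect_eq)
  \<comment> \<open>\<chi> might be trivial on all values z - z^r; the factor \<kappa> moves the
    value at w to 1, where \<chi> is not.\<close>
  define \<kappa> where "\<kappa> = inverse (w - w ^ r)"
  obtain \<chi> :: "'a \<Rightarrow> complex" where \<chi>: "\<And>x y. \<chi> (x + y) = \<chi> x * \<chi> y" "\<And>x. cmod (\<chi> x) = 1" "\<chi> 1 \<noteq> 1"
    and \<chi>0: "\<chi> 0 = 1" and \<chi>_sum: "\<And>(I :: nat set) f. (\<Prod>i\<in>I. \<chi> (f i)) = \<chi> (\<Sum>i\<in>I. f i)"
    by (rule additive_character) blast
  have \<chi>_nontriv: "\<chi> (\<kappa> * (w - w ^ r)) \<noteq> 1" using \<chi>(3) w by (simp add: \<kappa>_def)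
  define \<beta> where "\<beta> x y = \<chi> (\<kappa> * (x * y ^ r - x ^ r * y))" for x y
  define Lines where "Lines = (\<lambda>x. (\<lambda>k. x * k) ` K0) ` (UNIV - {0})"
  have K0_mult: "x * y \<in> K0" "inverse x \<in> K0" if "x \<in> K0" "y \<in> K0" for x y
    using that by (auto simp: K0_def power_mult_distrib power_inverse)
  have line_size: "card ((\<lambda>k. x * k) ` K0) = r" if "x \<noteq> 0" for x
    using that \<open>card K0 = r\<close> by (subst card_image) (auto simp: inj_on_def)
  interpret symplectic_group \<beta> Lines r
  proof
    show "bichar \<beta>"
      unfolding bichar_def \<beta>_def using \<chi>(2) by (simp flip: \<chi>(1) add: frob_add algebra_simps)
    show "\<beta> g g = 1" for g by (simp add: \<beta>_def \<chi>0 mult.commute)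
    show "g = 0" if g: "\<And>h. \<beta> g h = 1" for g
    proof (rule ccontr)
      assume g0: "g \<noteq> 0"
      \<comment> \<open>Then g y^r = w and g^r y = w^r, so the pairing takes the value singled out
        by \<kappa>.\<close>
      obtain y where y: "y ^ r = w / g" using frob_surj by metis
      have "g ^ r * y = (g * y ^ r) ^ r" by (simp add: power_mult_distrib frob_frob)
      then show False using g[of y] \<chi>_nontriv g0 y by (simp add: \<beta>_def)
    qed
    show "CARD('a) = r\<^sup>2" by (rule card_r)
    show "2 \<le> r" by (rule r2)
    show "r \<le> card Lines"
    proof -
      \<comment> \<open>The lines cover the r^2 - 1 nonzero elements, r - 1 at a time, so there are
        at least r + 1 of them.\<close>
      have "UNIV - {0} \<subseteq> (\<Union>\<l>\<in>Lines. \<l> - {0})"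
      proof
        fix x :: 'a assume x: "x \<in> UNIV - {0}"
        have "1 \<in> K0" by (simp add: K0_def)
        then have "x \<in> (\<lambda>k. x * k) ` K0 - {0}" using x by (auto intro: image_eqI[of _ _ 1])
        then show "x \<in> (\<Union>\<l>\<in>Lines. \<l> - {0})" using x unfolding Lines_def by blast
      qed
      then have "card (UNIV - {0::'a}) \<le> card (\<Union>\<l>\<in>Lines. \<l> - {0})" by (intro card_mono) auto
      also have "\<dots> \<le> (\<Sum>\<l>\<in>Lines. card (\<l> - {0}))" by (intro card_UN_le) simp
      also have "\<dots> = (\<Sum>\<l>\<in>Lines. r - 1)"
      proof (intro sum.cong refl)
        fix \<l> assume "\<l> \<in> Lines"
        then obtain x where x: "x \<noteq> 0" "\<l> = (\<lambda>k. x * k) ` K0" by (auto simp: Lines_def)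
        have "0 \<in> \<l>" using x add_subgroupD(1)[OF K0_sub] by (auto intro: image_eqI[of _ _ 0])
        then show "card (\<l> - {0}) = r - 1" using line_size[OF x(1)] x(2) by (simp add: card_Diff_singleton)
      qed
      finally have "r\<^sup>2 - 1 \<le> card Lines * (r - 1)" by (simp add: card_Diff_singleton card_r)
      moreover obtain m where m: "r = Suc m" "0 < m" using r2 by (cases r) auto
      moreover have "(Suc m)\<^sup>2 - 1 = (m + 2) * m" by (simp add: power2_eq_square)
      ultimately have "(m + 2) * m \<le> card Lines * m" by (simp only: diff_Suc_1)
      then have "m + 2 \<le> card Lines" using m(2) by (simp only: mult_le_cancel2)
      then show ?thesis using m(1) by simp
    qed
    show "add_subgroup \<l>" if \<l>L: "\<l> \<in> Lines" for \<l>
    proof -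
      obtain x where x: "\<l> = (\<lambda>k. x * k) ` K0" using \<l>L by (auto simp: Lines_def)
      show ?thesis unfolding x by (rule add_subgroup_image[OF K0_sub]) (simp add: algebra_simps)
    qed
    show "card \<l> = r" if "\<l> \<in> Lines" for \<l> using that line_size by (auto simp: Lines_def)
    show "\<beta> g h = 1" if \<l>: "\<l> \<in> Lines" "g \<in> \<l>" "h \<in> \<l>" for \<l> g h
    proof -
      obtain x k k' where "k \<in> K0" "k' \<in> K0" "g = x * k" "h = x * k'" using \<l> by (auto simp: Lines_def)
      then show ?thesis by (simp add: \<beta>_def K0_def power_mult_distrib mult_ac \<chi>0)
    qed
    show "\<l> \<inter> \<l>' = {0}" if \<l>: "\<l> \<in> Lines" "\<l>' \<in> Lines" "\<l> \<noteq> \<l>'" for \<l> \<l>'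
    proof -
      obtain x y where xy: "x \<noteq> 0" "y \<noteq> 0" "\<l> = (\<lambda>k. x * k) ` K0" "\<l>' = (\<lambda>k. y * k) ` K0"
        using \<l> by (auto simp: Lines_def)
      have sub: "(\<lambda>k. x * k) ` K0 \<subseteq> (\<lambda>k. y * k) ` K0" 
        if xy: "k \<in> K0" "k' \<in> K0" "k \<noteq> 0" "x * k = y * k'" for x y k k'
      proof
        fix z assume "z \<in> (\<lambda>k. x * k) ` K0"
        then obtain m where m: "m \<in> K0" "z = x * m" by auto
        have "x = y * (k' * inverse k)" using xy(3,4) by (simp add: field_simps)
        then have "z = y * (k' * inverse k * m)" using m by simp
        moreover have "k' * inverse k * m \<in> K0"
          by (rule K0_mult(1)[OF K0_mult(1)[OF xy(2) K0_mult(2)[OF xy(1,1)]] m(1)])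
        ultimately show "z \<in> (\<lambda>k. y * k) ` K0" by blast
      qed
      have "z = 0" if z: "z \<in> \<l>" "z \<in> \<l>'" for z
      proof (rule ccontr)
        assume "z \<noteq> 0"
        moreover obtain k k' where k: "k \<in> K0" "k' \<in> K0" "z = x * k" "z = y * k'" using z xy by auto
        ultimately have k0: "k \<noteq> 0" "k' \<noteq> 0" and e: "x * k = y * k'" by auto
        have "\<l> = \<l>'"
          unfolding xy by (rule equalityI[OF sub[OF k(1,2) k0(1) e] sub[OF k(2,1) k0(2) e[symmetric]]])
        then show False using \<l>(3) by simp
      qed
      moreover have "0 \<in> \<l>" "0 \<in> \<l>'"
        unfolding xy using add_subgroupD(1)[OF K0_sub] by (auto intro: image_eqI[of _ _ 0])
      ultimately show ?thesis by blast
    qed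
  qed
  have Bf: "B N x y = \<chi> (\<kappa> * (form x y - form x y ^ r))" for x y
    unfolding prod_char_def \<beta>_def \<chi>_sum form_def frob_sum power_mult_distrib frob_frob
    by (simp add: sum_distrib_left right_diff_distrib sum_subtractf)
  show ?thesis
  proof (rule eaqecc_of_symplectic_code[OF D_subgroup D_box])
    show "card D = r ^ (2 * K)" by (simp add: D_card card_r power_mult)
    show "D \<inter> perp N D = {0}"
    proof -
      have "y = 0" if y: "y \<in> D" "y \<in> perp N D" for y
        unfolding zero_fun_eq
      proof (rule D_lcd[OF y(1)])
        fix c assume c: "c \<in> D"
        have "form c y = 0"
        proof (rule ccontr)
          assume nz: "form c y \<noteq> 0"
          \<comment> \<open>The scaled word has form value w against y, where the character is
            nontrivial.\<close>
          have "B N (\<lambda>i. (w / form c y) * c i) y = 1"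
            using y(2) D_scale[OF c, of "w / form c y"] unfolding perp_def by blast
          then show False using nz \<chi>_nontriv unfolding Bf form_scale by simp
        qed
        then show "(\<Sum>i<N. c i * y i ^ r) = 0" by (simp add: form_def)
      qed
      then show ?thesis
        using add_subgroupD(1)[OF D_subgroup] add_subgroupD(1)[OF perp_subgroup] by blast
    qed
    show "K \<le> N" by (rule KN)
    show "d \<le> weight N x" if "x \<in> D" "x \<noteq> 0" for x
      using D_weight that unfolding zero_fun_eq by blast
  qed
qed

end

section \<open>Galois LCD generalized Roth-Lempel codes\<close>

lemma linear_injective_image:
  fixes f :: "'a::field vec \<Rightarrow> 'a vec"
  assumes f: "\<And>x. x \<in> carrier_vec k \<Longrightarrow> f x \<in> carrier_vec N"
    and f_add: "\<And>x y. x \<in> carrier_vec k \<Longrightarrow> y \<in> carrier_vec k \<Longrightarrow> f (x + y) = f x + f y"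
    and f_smult: "\<And>c x. x \<in> carrier_vec k \<Longrightarrow> f (c \<cdot>\<^sub>v x) = c \<cdot>\<^sub>v f x"
    and inj: "inj_on f (carrier_vec k)"
  shows "VectorSpace.subspace class_ring (f ` carrier_vec k) (module_vec TYPE('a) N)"
    and "vectorspace.dim class_ring ((module_vec TYPE('a) N)\<lparr>carrier := f ` carrier_vec k\<rparr>) = k"
proof -
  interpret V: vec_space "TYPE('a)" k .
  interpret W: vec_space "TYPE('a)" N .
  interpret lm: linear_map class_ring "module_vec TYPE('a) k" "module_vec TYPE('a) N" f
    by (intro_locales, unfold mod_hom_axioms_def LinearCombinations.module_hom_def)
      (auto simp: module_vec_simps f f_add f_smult)
  have im: "lm.im = f ` carrier_vec k" by (simp add: lm.im_def module_vec_simps)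
  show "VectorSpace.subspace class_ring (f ` carrier_vec k) (module_vec TYPE('a) N)"
    using lm.imT_is_subspace by (simp add: im)
  have "inj_on f (carrier (module_vec TYPE('a) k))" using inj by (simp add: module_vec_simps)
  from lm.rank_nullity[OF V.fin_dim] lm.inj_imp_dim_ker0[OF this]
  show "vectorspace.dim class_ring ((module_vec TYPE('a) N)\<lparr>carrier := f ` carrier_vec k\<rparr>) = k"
    by (simp add: im V.dim_is_n)
qed

lemma min_dist_eqI:
  fixes C :: "'a::{ring_1,finite} vec set"
  assumes C: "C \<subseteq> carrier_vec N" "0\<^sub>v N \<in> C" "\<And>x y. x \<in> C \<Longrightarrow> y \<in> C \<Longrightarrow> x - y \<in> C"
    and lower: "\<And>x. x \<in> C \<Longrightarrow> x \<noteq> 0\<^sub>v N \<Longrightarrow> d \<le> card {i. i < N \<and> x $ i \<noteq> 0}"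
    and attained: "x0 \<in> C" "x0 \<noteq> 0\<^sub>v N" "card {i. i < N \<and> x0 $ i \<noteq> 0} = d"
  shows "min_dist C = d"
proof -
  let ?S = "{hamming_dist x y | x y. x \<in> C \<and> y \<in> C \<and> x \<noteq> y}"
  have ham: "hamming_dist x y = card {i. i < N \<and> (x - y) $ i \<noteq> 0}" if "x \<in> C" "y \<in> C" for x y
  proof -
    have "dim_vec x = N" "dim_vec y = N" using that C(1) by auto
    then have "{i. i < dim_vec x \<and> x $ i \<noteq> y $ i} = {i. i < N \<and> (x - y) $ i \<noteq> 0}" by auto
    then show ?thesis by (simp add: hamming_dist_def)
  qed
  have "?S \<subseteq> {..N}"
  proof
    fix h assume "h \<in> ?S"
    then obtain x y where h: "x \<in> C" "y \<in> C" "h = hamming_dist x y" by auto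
    have "card {i. i < N \<and> (x - y) $ i \<noteq> 0} \<le> card {..<N}" by (intro card_mono) auto
    then show "h \<in> {..N}" using ham[OF h(1,2)] h(3) by simp
  qed
  then have fin: "finite ?S" by (rule finite_subset) simp
  have "x0 - 0\<^sub>v N = x0" using attained(1) C(1) by auto
  then have "hamming_dist x0 (0\<^sub>v N) = d" using ham[OF attained(1) C(2)] attained(3) by simp
  then have "d \<in> ?S" using attained(1,2) C(2) by blast
  moreover have "d \<le> h" if hS: "h \<in> ?S" for h
  proof -
    obtain x y where h: "x \<in> C" "y \<in> C" "x \<noteq> y" "h = hamming_dist x y" using hS by auto
    have "x - y \<noteq> 0\<^sub>v N"
    proof
      assume e: "x - y = 0\<^sub>v N"
      have "x = y"
      proof (rule eq_vecI)
        show "dim_vec x = dim_vec y" by (metis C(1) carrier_vecD h(1,2) subsetD)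
        fix i assume i: "i < dim_vec y"
        then have "(x - y) $ i = 0" using e h C(1) by auto
        then show "x $ i = y $ i" using i by simp
      qed
      then show False using h(3) by simp
    qed
    then show ?thesis using lower[OF C(3)[OF h(1,2)]] ham[OF h(1,2)] h(4) by simp
  qed
  ultimately show ?thesis unfolding min_dist_def using fin by (intro Min_eqI) auto
qed

text \<open>The determinant is affine in the last diagonal entry, its slope being the determinant of
  the smaller system, so at most one value of that entry is bad. In the proof, kernel vectors for
  both \<alpha> and \<beta> are scaled to last coordinate 1. Their difference solves the smaller
  system and is 0, and then the last rows give \<alpha> = \<beta>.\<close>

lemma diagonal_shift_nonsingular:
  fixes M :: "nat \<Rightarrow> nat \<Rightarrow> 'a::field"
  assumes "\<alpha> \<noteq> \<beta>"
  shows "\<exists>w. (\<forall>i. w i \<in> {\<alpha>, \<beta>}) \<and>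
    (\<forall>x. (\<forall>i<k. w i * x i + (\<Sum>j<k. M i j * x j) = 0) \<longrightarrow> (\<forall>i<k. x i = 0))"
proof (induction k)
  case (Suc k)
  then obtain w where w: "\<And>i. w i \<in> {\<alpha>, \<beta>}"
    and inj: "\<And>x. (\<And>i. i < k \<Longrightarrow> w i * x i + (\<Sum>j<k. M i j * x j) = 0) \<Longrightarrow> (\<forall>i<k. x i = 0)"
    by auto
  let ?L = "\<lambda>c x i. (if i = k then c else w i) * x i + (\<Sum>j<Suc k. M i j * x j)"
  show ?case
  proof (rule ccontr)
    assume neg: "\<not> ?case"
    have ex: "\<exists>x. (\<forall>i<Suc k. ?L c x i = 0) \<and> x k = 1" if c: "c \<in> {\<alpha>, \<beta>}" for c
    proof -
      have "\<forall>i. (w(k := c)) i \<in> {\<alpha>, \<beta>}" using w c by simp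
      then obtain x where x: "\<forall>i<Suc k. (w(k := c)) i * x i + (\<Sum>j<Suc k. M i j * x j) = 0" "\<not> (\<forall>i<Suc k. x i = 0)"
        using neg by blast
      have L: "?L c x i = 0" if "i < Suc k" for i using x(1) that by (simp split: if_splits)
      have xk: "x k \<noteq> 0"
      proof
        assume 0: "x k = 0"
        have "\<forall>i<k. x i = 0"
        proof (rule inj)
          fix i assume "i < k"
          then show "w i * x i + (\<Sum>j<k. M i j * x j) = 0" using L[of i] 0 by simp
        qed
        then show False using x(2) 0 by (auto simp: less_Suc_eq)
      qed
      have "?L c (\<lambda>i. x i / x k) i = 0" if "i < Suc k" for i
      proof -
        have "?L c (\<lambda>i. x i / x k) i = ?L c x i / x k"
          by (simp add: sum_divide_distrib add_divide_distrib)
        then show ?thesis using L[OF that] by simp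
      qed
      then show ?thesis using xk by (intro exI[of _ "\<lambda>i. x i / x k"]) simp
    qed
    obtain x where x: "\<And>i. i < Suc k \<Longrightarrow> ?L \<alpha> x i = 0" "x k = 1"
      using ex[OF insertI1] by blast
    obtain y where y: "\<And>i. i < Suc k \<Longrightarrow> ?L \<beta> y i = 0" "y k = 1"
      using ex[OF insertI2[OF singletonI]] by blast
    have eq: "\<forall>i<k. x i - y i = 0"
    proof (rule inj)
      fix i assume i: "i < k"
      have e: "w i * (x i - y i) + (\<Sum>j<k. M i j * (x j - y j)) = ?L \<alpha> x i - ?L \<beta> y i"
        using i x(2) y(2) by (simp add: sum_subtractf algebra_simps)
      have "?L \<alpha> x i = 0" "?L \<beta> y i = 0" using i x(1)[of i] y(1)[of i] by simp_all
      then show "w i * (x i - y i) + (\<Sum>j<k. M i j * (x j - y j)) = 0" unfolding e by (simp only: diff_self)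
    qed
    have "?L \<alpha> x k - ?L \<beta> y k = (\<alpha> - \<beta>) + (\<Sum>j<k. M k j * (x j - y j))"
      using x(2) y(2) by (simp add: sum_subtractf algebra_simps)
    also have "(\<Sum>j<k. M k j * (x j - y j)) = 0" using eq by (intro sum.neutral) auto
    finally show False using x(1)[of k] y(1)[of k] assms by simp
  qed
qed auto

text \<open>A codeword entry with the multiplier removed. Weights are read from it, so they can be
  settled before the multipliers are chosen.\<close>

definition grl_coord :: "nat \<Rightarrow> nat \<Rightarrow> nat \<Rightarrow> 'a::field vec \<Rightarrow> 'a mat \<Rightarrow> 'a poly \<Rightarrow> nat \<Rightarrow> 'a" where
  "grl_coord n s k a A f j = (if j < n then poly f (a $ j)
     else \<Sum>i<s. A $$ (i, j - n) * Polynomial.coeff f (k - s + i))"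

definition grl_word :: "nat \<Rightarrow> nat \<Rightarrow> nat \<Rightarrow> 'a::field vec \<Rightarrow> 'a vec \<Rightarrow> 'a mat \<Rightarrow> 'a poly \<Rightarrow> 'a vec" where
  "grl_word n s k a v A f = vec n (\<lambda>j. v $ j * poly f (a $ j)) @\<^sub>v
     (transpose_mat A *\<^sub>v vec s (\<lambda>i. Polynomial.coeff f (k - s + i)))"

lemma grl_word_carrier:
  assumes "A \<in> carrier_mat s s" shows "grl_word n s k a v A f \<in> carrier_vec (n + s)"
  using assms unfolding grl_word_def by (intro append_carrier_vec) auto

lemma grl_word_index:
  assumes A: "A \<in> carrier_mat s s" and j: "j < n + s"
  shows "grl_word n s k a v A f $ j = (if j < n then v $ j else 1) * grl_coord n s k a A f j"
proof (cases "j < n")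
  case True
  then show ?thesis unfolding grl_word_def grl_coord_def by (subst index_append_vec) (use A in auto)
next
  case False
  then have "grl_word n s k a v A f $ j = (transpose_mat A *\<^sub>v vec s (\<lambda>i. Polynomial.coeff f (k - s + i))) $ (j - n)"
    unfolding grl_word_def using A j by (subst index_append_vec) auto
  also have "\<dots> = (\<Sum>i<s. A $$ (i, j - n) * Polynomial.coeff f (k - s + i))"
    using A False j by (auto simp: scalar_prod_def atLeast0LessThan intro!: sum.cong)
  finally show ?thesis using False by (simp add: grl_coord_def)
qed

lemma grl_coord_add: "grl_coord n s k a A (f + g) j = grl_coord n s k a A f j + grl_coord n s k a A g j"
  by (simp add: grl_coord_def sum.distrib algebra_simps)

lemma grl_coord_smult: "grl_coord n s k a A (Polynomial.smult c f) j = c * grl_coord n s k a A f j"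
  by (simp add: grl_coord_def sum_distrib_left mult_ac)

lemma grl_coord_diff: "grl_coord n s k a A (f - g) j = grl_coord n s k a A f j - grl_coord n s k a A g j"
  by (simp add: grl_coord_def sum_subtractf algebra_simps)

lemma grl_coord_0: "grl_coord n s k a A 0 j = 0"
  by (simp add: grl_coord_def)

lemma grl_coord_sum: "grl_coord n s k a A (\<Sum>i\<in>I. f i) j = (\<Sum>i\<in>I. grl_coord n s k a A (f i) j)"
  by (induction I rule: infinite_finite_induct) (simp_all add: grl_coord_add grl_coord_0)

lemma poly_eq_0_of_distinct_roots:
  fixes f :: "'a::field poly"
  assumes a: "distinct_entries n a" and J: "J \<subseteq> {..<n}" "k \<le> card J"
    and f: "Polynomial.degree f < k" "\<And>j. j \<in> J \<Longrightarrow> poly f (a $ j) = 0"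
  shows "f = 0"
proof (rule ccontr)
  assume f0: "f \<noteq> 0"
  have "card J = card ((\<lambda>j. a $ j) ` J)"
    using a J(1) by (intro card_image[symmetric]) (auto simp: distinct_entries_def intro: inj_on_subset)
  also have "\<dots> \<le> card {x. poly f x = 0}"
    using f(2) poly_roots_finite[OF f0] by (intro card_mono) auto
  also have "\<dots> \<le> Polynomial.degree f" by (rule card_poly_roots_bound[OF f0])
  finally show False using J(2) f(1) by simp
qed

lemma lagrange_basis_exists:
  fixes a :: "'a::field vec"
  assumes a: "distinct_entries n a" and kn: "k \<le> n"
  obtains L where "\<And>i. i < k \<Longrightarrow> Polynomial.degree (L i) < k"
    "\<And>i j. i < k \<Longrightarrow> j < k \<Longrightarrow> poly (L i) (a $ j) = (if i = j then 1 else 0)"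
    "\<And>f. Polynomial.degree f < k \<Longrightarrow> f = (\<Sum>i<k. Polynomial.smult (poly f (a $ i)) (L i))"
proof -
  define P where "P i = (\<Prod>j\<in>{..<k} - {i}. [:- (a $ j), 1:])" for i
  define L where "L i = Polynomial.smult (inverse (poly (P i) (a $ i))) (P i)" for i
  have aij: "a $ i \<noteq> a $ j" if "i < k" "j < k" "i \<noteq> j" for i j
    using a kn that unfolding distinct_entries_def by (auto dest: inj_onD)
  have Pii: "poly (P i) (a $ i) \<noteq> 0" if "i < k" for i
    using that aij by (auto simp: P_def poly_prod)
  have Pij: "poly (P i) (a $ j) = 0" if "i < k" "j < k" "i \<noteq> j" for i j
    using that by (auto simp: P_def poly_prod)
  have deg: "Polynomial.degree (L i) < k" if "i < k" for i
  proof -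
    have "Polynomial.degree (P i) \<le> (\<Sum>j\<in>{..<k} - {i}. Polynomial.degree [:- (a $ j), 1:])"
      unfolding P_def using degree_prod_sum_le[of "{..<k} - {i}" "\<lambda>j. [:- (a $ j), 1:]"] by (simp add: o_def)
    then have "Polynomial.degree (P i) < k" using that by simp
    then show ?thesis unfolding L_def by (rule le_less_trans[OF degree_smult_le])
  qed
  have val: "poly (L i) (a $ j) = (if i = j then 1 else 0)" if "i < k" "j < k" for i j
    using Pii[OF that(1)] Pij[OF that] by (cases "i = j") (simp_all add: L_def)
  have "f = (\<Sum>i<k. Polynomial.smult (poly f (a $ i)) (L i))" if f: "Polynomial.degree f < k" for f
  proof -
    define g where "g = f - (\<Sum>i<k. Polynomial.smult (poly f (a $ i)) (L i))"
    have "Polynomial.degree (\<Sum>i<k. Polynomial.smult (poly f (a $ i)) (L i)) < k"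
      using deg f by (intro degree_sum_less) (auto intro: le_less_trans[OF degree_smult_le])
    then have "Polynomial.degree g < k" unfolding g_def using f by (rule degree_diff_less[rotated])
    moreover have "poly g (a $ j) = 0" if "j \<in> {..<k}" for j
    proof -
      have "(\<Sum>i<k. poly f (a $ i) * poly (L i) (a $ j)) = (\<Sum>i<k. if i = j then poly f (a $ i) else 0)"
        using that val by (intro sum.cong) auto
      then show ?thesis using that by (simp add: g_def poly_sum)
    qed
    ultimately have "g = 0" using poly_eq_0_of_distinct_roots[OF a, of "{..<k}" k g] kn by simp
    then show ?thesis by (simp add: g_def)
  qed
  then show ?thesis using that deg val by blast
qed

context galois_field
begin

text \<open>x^(r+1) - 1 has at most r + 1 roots, fewer than the q - 1 nonzero elements: for r = 2
  because q > 4, for larger r because 3 r \<le> r^2 \<le> q.\<close>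

lemma exists_norm_not_one:
  assumes "4 < CARD('a)" "2 * l \<le> e"
  obtains b :: 'a where "b \<noteq> 0" "b ^ (r + 1) \<noteq> 1"
proof -
  define q where "q = Polynomial.monom (1::'a) (r + 1) - 1"
  have "Polynomial.coeff q (r + 1) = 1" by (simp add: q_def)
  then have q0: "q \<noteq> 0" by auto
  have "Polynomial.degree q \<le> r + 1"
    unfolding q_def by (intro degree_diff_le order_trans[OF degree_monom_le]) simp_all
  then have roots: "card {x. poly q x = 0} \<le> r + 1" using card_poly_roots_bound[OF q0] by simp
  have "r\<^sup>2 = p ^ (2 * l)" by (simp add: r power_mult[symmetric] mult.commute)
  also have "\<dots> \<le> CARD('a)" unfolding card_a using assms(2) prime_ge_1_nat[OF p] by (rule power_increasing)
  finally have rq: "r\<^sup>2 \<le> CARD('a)" .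
  have "r + 1 < CARD('a) - 1"
  proof (cases "r \<le> 2")
    case False
    then have "r * 3 \<le> r * r" by (intro mult_le_mono2) simp
    then have "r * 3 \<le> CARD('a)" using rq by (simp only: power2_eq_square)
    then show ?thesis using False by linarith
  qed (use assms(1) in simp)
  also have "CARD('a) - 1 = card (UNIV - {0::'a})" by (simp add: card_Diff_singleton)
  finally have "\<not> UNIV - {0} \<subseteq> {x. poly q x = 0}"
    using roots card_mono[of "{x. poly q x = 0}" "UNIV - {0}"] by auto
  then obtain b where "b \<noteq> 0" "poly q b \<noteq> 0" by auto
  then show ?thesis using that by (simp add: q_def poly_monom)
qed

text \<open>Only the multipliers of the first \<open>k\<close> coordinates, an information set, are adjusted. In the
  Lagrange basis at these points the Gram matrix is a diagonal matrix of norms plus a fixed matrix.\<close>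

lemma grl_lcd_exists:
  fixes a :: "'a vec"
  assumes q4: "4 < CARD('a)" and l2: "2 * l \<le> e" and a: "distinct_entries n a" and kn: "k \<le> n"
  obtains v :: "'a vec" where "v \<in> carrier_vec n" "\<And>j. j < n \<Longrightarrow> v $ j \<noteq> 0"
    "\<And>f. Polynomial.degree f < k \<Longrightarrow>
      (\<And>g. Polynomial.degree g < k \<Longrightarrow>
        (\<Sum>j<n + s. ((if j < n then v $ j else 1) * grl_coord n s k a A g j) *
          ((if j < n then v $ j else 1) * grl_coord n s k a A f j) ^ r) = 0) \<Longrightarrow> f = 0"
proof -
  obtain b :: 'a where b: "b \<noteq> 0" "b ^ (r + 1) \<noteq> 1" using exists_norm_not_one[OF q4 l2] by blast
  obtain L where L: "\<And>i. i < k \<Longrightarrow> Polynomial.degree (L i) < k"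
    "\<And>i j. i < k \<Longrightarrow> j < k \<Longrightarrow> poly (L i) (a $ j) = (if i = j then 1 else 0)"
    "\<And>f. Polynomial.degree f < k \<Longrightarrow> f = (\<Sum>i<k. Polynomial.smult (poly f (a $ i)) (L i))"
    by (rule lagrange_basis_exists[OF a kn]) blast
  define E where "E = grl_coord n s k a A"
  \<comment> \<open>The part of the Gram matrix contributed by the coordinates from k on, including
    the s additional ones; their multipliers are 1.\<close>
  define M where "M m i = (\<Sum>j\<in>{k..<n + s}. E (L m) j * (E (L i) j) ^ r)" for m i
  have "1 \<noteq> b ^ (r + 1)" using b(2) by metis
  from diagonal_shift_nonsingular[OF this, of k M]
  obtain w where W: "(\<forall>i. w i \<in> {1, b ^ (r + 1)}) \<and>
      (\<forall>x. (\<forall>i<k. w i * x i + (\<Sum>j<k. M i j * x j) = 0) \<longrightarrow> (\<forall>i<k. x i = 0))" ..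
  have w: "w i \<in> {1, b ^ (r + 1)}" for i using W by blast
  have inj: "\<forall>i<k. x i = 0" if "\<And>i. i < k \<Longrightarrow> w i * x i + (\<Sum>j<k. M i j * x j) = 0" for x
    using conjunct2[OF W, rule_format, of x] that by simp
  define v where "v = vec n (\<lambda>j. if j < k \<and> w j \<noteq> 1 then b else 1)"
  have v: "v \<in> carrier_vec n" by (simp add: v_def)
  have v0: "v $ j \<noteq> 0" if "j < n" for j using that b(1) by (simp add: v_def)
  define V where "V j = (if j < n then v $ j else 1)" for j
  have Vw: "V j * V j ^ r = w j" if "j < k" for j
    using w[of j] that kn by (auto simp: V_def v_def)
  have V1: "V j = 1" if "k \<le> j" for j using that by (simp add: V_def v_def)
  have "f = 0" if f: "Polynomial.degree f < k"
    and orth: "\<And>g. Polynomial.degree g < k \<Longrightarrow> (\<Sum>j<n + s. (V j * E g j) * (V j * E f j) ^ r) = 0" for f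
  proof -
    \<comment> \<open>The second argument enters through its r-th power, so orthogonality is a
      linear system in the powers \<open>poly f (a $ i) ^ r\<close>; testing against
      \<open>L m\<close> yields row m.\<close>
    define x where "x i = (poly f (a $ i)) ^ r" for i
    have Ef: "E f j = (\<Sum>i<k. poly f (a $ i) * E (L i) j)" for j
      unfolding E_def by (subst L(3)[OF f]) (simp only: grl_coord_sum grl_coord_smult)
    have "\<forall>i<k. x i = 0"
    proof (rule inj)
      fix m assume m: "m < k"
      have "0 = (\<Sum>j<n + s. (V j * E (L m) j) * (V j * E f j) ^ r)" using orth[OF L(1)[OF m]] by simp
      also have "{..<n + s} = {..<k} \<union> {k..<n + s}" using kn by auto
      also have "(\<Sum>j\<in>{..<k} \<union> {k..<n + s}. (V j * E (L m) j) * (V j * E f j) ^ r) =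
          (\<Sum>j<k. (V j * E (L m) j) * (V j * E f j) ^ r) + (\<Sum>j\<in>{k..<n + s}. (V j * E (L m) j) * (V j * E f j) ^ r)"
        by (rule sum.union_disjoint) auto
      also have "(\<Sum>j<k. (V j * E (L m) j) * (V j * E f j) ^ r) = (\<Sum>j<k. if j = m then w m * x m else 0)"
      proof (intro sum.cong refl)
        fix j assume "j \<in> {..<k}"
        then have j: "j < k" by simp
        have "E (L m) j = (if m = j then 1 else 0)" "E f j = poly f (a $ j)"
          using j kn L(2)[OF m j] by (simp_all add: E_def grl_coord_def)
        then show "(V j * E (L m) j) * (V j * E f j) ^ r = (if j = m then w m * x m else 0)"
          using Vw[OF j] by (auto simp: x_def power_mult_distrib mult_ac)
      qed
      also have "\<dots> = w m * x m" using m by simp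
      also have "(\<Sum>j\<in>{k..<n + s}. (V j * E (L m) j) * (V j * E f j) ^ r) =
          (\<Sum>j\<in>{k..<n + s}. \<Sum>i<k. E (L m) j * (E (L i) j) ^ r * x i)"
      proof (intro sum.cong refl)
        fix j assume "j \<in> {k..<n + s}"
        then have "V j = 1" using V1 by simp
        moreover have "(E f j) ^ r = (\<Sum>i<k. x i * (E (L i) j) ^ r)"
          unfolding Ef frob_sum x_def power_mult_distrib ..
        ultimately show "(V j * E (L m) j) * (V j * E f j) ^ r = (\<Sum>i<k. E (L m) j * (E (L i) j) ^ r * x i)"
          by (simp add: sum_distrib_left mult_ac)
      qed
      also have "\<dots> = (\<Sum>i<k. M m i * x i)"
        by (subst sum.swap) (simp add: M_def sum_distrib_right)
      finally show "w m * x m + (\<Sum>j<k. M m j * x j) = 0" by simp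
    qed
    then have "poly f (a $ i) = 0" if "i < k" for i using that frob_0 by (auto simp: x_def)
    then show ?thesis using poly_eq_0_of_distinct_roots[OF a, of "{..<k}" k f] kn f by simp
  qed
  then show ?thesis using that[OF v v0] unfolding V_def E_def by blast
qed

end

section \<open>From weights of polynomials to classical and quantum codes\<close>

definition grl_weight :: "nat \<Rightarrow> nat \<Rightarrow> nat \<Rightarrow> 'a::field vec \<Rightarrow> 'a mat \<Rightarrow> 'a poly \<Rightarrow> nat" where
  "grl_weight n s k a A f = card {j. j < n + s \<and> grl_coord n s k a A f j \<noteq> 0}"

definition poly_of_fun :: "nat \<Rightarrow> (nat \<Rightarrow> 'a::comm_ring_1) \<Rightarrow> 'a poly" where
  "poly_of_fun k c = (\<Sum>i<k. Polynomial.monom (c i) i)"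

lemma coeff_poly_of_fun: "Polynomial.coeff (poly_of_fun k c) j = (if j < k then c j else 0)"
  by (simp add: poly_of_fun_def coeff_sum)

lemma degree_poly_of_fun: "0 < k \<Longrightarrow> Polynomial.degree (poly_of_fun k c) < k"
  by (intro degree_lessI) (simp_all add: coeff_poly_of_fun)

lemma poly_of_fun_coeff:
  assumes "Polynomial.degree f < k" "\<And>i. i < k \<Longrightarrow> c i = Polynomial.coeff f i"
  shows "poly_of_fun k c = f"
  by (rule poly_eqI) (use assms in \<open>auto simp: coeff_poly_of_fun coeff_eq_0\<close>)

text \<open>With the multipliers from \<open>grl_lcd_exists\<close>, what remains to be supplied in
  each family is a matrix together with the exact minimum of \<open>grl_weight\<close>. The code
  appears twice: as vectors for the classical notions, and as functions for the quantum
  theorems.\<close>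

theorem lcd_GRL_and_eaqecc_of_weights:
  fixes a :: "'a::{field,finite} vec"
  assumes p: "prime p" and card_a: "CARD('a) = p ^ e" and q4: "4 < p ^ e" and l: "0 < l" and le: "2 * l dvd e"
    and a: "distinct_entries n a" and s: "1 \<le> s" "s \<le> k" and kn: "k \<le> n" and A: "A \<in> GL s"
    and lower: "\<And>f. f \<noteq> 0 \<Longrightarrow> Polynomial.degree f < k \<Longrightarrow> d \<le> grl_weight n s k a A f"
    and attained: "f0 \<noteq> 0" "Polynomial.degree f0 < k" "grl_weight n s k a A f0 = d"
  shows "lcd_GRL_and_eaqecc p e l n s k a d"
proof -
  have k0: "0 < k" using s by simp
  have e0: "e \<noteq> 0" using q4 by (cases e) auto
  then have l2: "2 * l \<le> e" using le by (auto dest: dvd_imp_le)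
  interpret galois_field p e l "p ^ l" "TYPE('a)"
    by unfold_locales (use p card_a l l2 in auto)
  have As: "A \<in> carrier_mat s s" using A by (simp add: GL_def)
  have "4 < CARD('a)" using q4 card_a by simp
  then obtain v :: "'a vec" where v: "v \<in> carrier_vec n" "\<And>j. j < n \<Longrightarrow> v $ j \<noteq> 0"
    and lcd: "\<And>f. Polynomial.degree f < k \<Longrightarrow>
      (\<And>g. Polynomial.degree g < k \<Longrightarrow>
        (\<Sum>j<n + s. ((if j < n then v $ j else 1) * grl_coord n s k a A g j) *
          ((if j < n then v $ j else 1) * grl_coord n s k a A f j) ^ p ^ l) = 0) \<Longrightarrow> f = 0"
    by (rule grl_lcd_exists[OF _ l2 a kn, of s A]) blast
  define V where "V j = (if j < n then v $ j else 1)" for j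
  define E where "E = grl_coord n s k a A"
  define w where "w f = grl_word n s k a v A f" for f
  define C where "C = w ` {f. Polynomial.degree f < k}"
  have V0: "V j \<noteq> 0" for j using v(2) by (simp add: V_def)
  have lcd: "f = 0" if "Polynomial.degree f < k"
    "\<And>g. Polynomial.degree g < k \<Longrightarrow> (\<Sum>j<n + s. (V j * E g j) * (V j * E f j) ^ p ^ l) = 0" for f
    using lcd[of f] that unfolding V_def E_def by blast
  have GRL: "C = GRL n s k a v A"
    unfolding C_def GRL_def w_def grl_word_def by blast
  have wc: "w f \<in> carrier_vec (n + s)" for f unfolding w_def by (rule grl_word_carrier[OF As])
  have wi: "w f $ j = V j * E f j" if "j < n + s" for f j
    unfolding w_def V_def E_def by (rule grl_word_index[OF As that])
  have wdim: "dim_vec (w f) = n + s" for f using wc[of f] by (rule carrier_vecD)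
  have E_add: "E (f + g) j = E f j + E g j" and E_diff: "E (f - g) j = E f j - E g j"
    and E_smult: "E (Polynomial.smult c f) j = c * E f j" and E_0: "E 0 j = 0" for f g c j
    by (simp_all add: E_def grl_coord_add grl_coord_diff grl_coord_smult grl_coord_0)
  have E_inj: "f = 0" if "Polynomial.degree f < k" "\<And>j. j < n + s \<Longrightarrow> E f j = 0" for f
  proof (rule poly_eq_0_of_distinct_roots[OF a, of "{..<n}"])
    show "poly f (a $ j) = 0" if "j \<in> {..<n}" for j
      using \<open>\<And>j. j < n + s \<Longrightarrow> E f j = 0\<close>[of j] that by (simp add: E_def grl_coord_def)
  qed (use that kn in simp_all)
  have w_eq_iff: "w f = w g \<longleftrightarrow> (\<forall>j<n + s. E f j = E g j)" for f g
    using wi V0 wdim by (auto simp: vec_eq_iff)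
  have w_inj: "f = g" if "w f = w g" "Polynomial.degree f < k" "Polynomial.degree g < k" for f g
    using E_inj[of "f - g"] that degree_diff_less[OF that(2,3)] by (simp add: w_eq_iff E_diff)
  have w_add: "w (f + g) = w f + w g" for f g
    by (rule eq_vecI) (simp_all add: wi wdim E_add algebra_simps)
  have w_diff: "w (f - g) = w f - w g" for f g
    by (rule eq_vecI) (simp_all add: wi wdim E_diff algebra_simps)
  have w_smult: "w (Polynomial.smult c f) = c \<cdot>\<^sub>v w f" for c f
    by (rule eq_vecI) (simp_all add: wi wdim E_smult)
  have w_0: "w 0 = 0\<^sub>v (n + s)"
    by (rule eq_vecI) (simp_all add: wi wdim E_0)
  have C_sub: "C \<subseteq> carrier_vec (n + s)" using wc by (auto simp: C_def)
  \<comment> \<open>Linear and injective on coefficient vectors, which gives the dimension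
    k.\<close>
  define T where "T x = w (poly_of_fun k (\<lambda>i. x $ i))" for x
  have CT: "C = T ` carrier_vec k"
  proof (intro equalityI subsetI)
    fix x assume "x \<in> C"
    then obtain f where f: "Polynomial.degree f < k" "x = w f" by (auto simp: C_def)
    have "poly_of_fun k (\<lambda>i. vec k (Polynomial.coeff f) $ i) = f"
      by (rule poly_of_fun_coeff[OF f(1)]) simp
    then have "x = T (vec k (Polynomial.coeff f))" using f(2) by (simp add: T_def)
    then show "x \<in> T ` carrier_vec k" by simp
  next
    fix x assume "x \<in> T ` carrier_vec k"
    then show "x \<in> C" using degree_poly_of_fun[OF k0] by (auto simp: C_def T_def)
  qed
  have T_add: "T (x + y) = T x + T y" if "x \<in> carrier_vec k" "y \<in> carrier_vec k" for x y
  proof -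
    have "poly_of_fun k (\<lambda>i. (x + y) $ i) = poly_of_fun k (\<lambda>i. x $ i) + poly_of_fun k (\<lambda>i. y $ i)"
      by (rule poly_eqI) (use that in \<open>simp add: coeff_poly_of_fun\<close>)
    then show ?thesis by (simp add: T_def w_add)
  qed
  have T_smult: "T (c \<cdot>\<^sub>v x) = c \<cdot>\<^sub>v T x" if "x \<in> carrier_vec k" for c x
  proof -
    have "poly_of_fun k (\<lambda>i. (c \<cdot>\<^sub>v x) $ i) = Polynomial.smult c (poly_of_fun k (\<lambda>i. x $ i))"
      by (rule poly_eqI) (use that in \<open>simp add: coeff_poly_of_fun\<close>)
    then show ?thesis by (simp add: T_def w_smult)
  qed
  have T_inj: "inj_on T (carrier_vec k)"
  proof (rule inj_onI)
    fix x y :: "'a vec" assume x: "x \<in> carrier_vec k" and y: "y \<in> carrier_vec k" and "T x = T y"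
    then have e: "poly_of_fun k (\<lambda>i. x $ i) = poly_of_fun k (\<lambda>i. y $ i)"
      unfolding T_def by (intro w_inj degree_poly_of_fun[OF k0])
    show "x = y"
    proof (rule eq_vecI)
      show "dim_vec x = dim_vec y" using x y by simp
      fix i assume "i < dim_vec y"
      then show "x $ i = y $ i" using arg_cong[OF e, of "\<lambda>f. Polynomial.coeff f i"] y
        by (simp add: coeff_poly_of_fun)
    qed
  qed
  have T_carrier: "T x \<in> carrier_vec (n + s)" for x by (simp add: T_def wc)
  have weight: "card {j. j < n + s \<and> w f $ j \<noteq> 0} = grl_weight n s k a A f" for f
  proof -
    have "{j. j < n + s \<and> w f $ j \<noteq> 0} = {j. j < n + s \<and> grl_coord n s k a A f j \<noteq> 0}"
      using wi V0 by (auto simp: E_def)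
    then show ?thesis by (simp add: grl_weight_def)
  qed
  have "min_dist C = d"
  proof (rule min_dist_eqI[OF C_sub])
    show "0\<^sub>v (n + s) \<in> C" unfolding C_def w_0[symmetric] using k0 by (intro imageI) simp
    fix x y assume "x \<in> C" "y \<in> C"
    then obtain f g where fg: "Polynomial.degree f < k" "Polynomial.degree g < k" "x = w f" "y = w g"
      by (auto simp: C_def)
    then show "x - y \<in> C" unfolding C_def fg(3,4) w_diff[symmetric]
      by (intro imageI) (simp add: degree_diff_less)
  next
    fix x assume "x \<in> C" "x \<noteq> 0\<^sub>v (n + s)"
    then obtain f where f: "Polynomial.degree f < k" "x = w f" "f \<noteq> 0" using w_0 by (auto simp: C_def)
    then show "d \<le> card {i. i < n + s \<and> x $ i \<noteq> 0}" using lower[of f] weight[of f] by simp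
  next
    show "w f0 \<in> C" using attained(2) by (auto simp: C_def)
    show "w f0 \<noteq> 0\<^sub>v (n + s)" using w_inj[of f0 0] attained(1,2) k0 by (auto simp: w_0)
    show "card {i. i < n + s \<and> w f0 $ i \<noteq> 0} = d" using weight[of f0] attained(3) by simp
  qed
  then have lin: "linear_code (n + s) k d C"
    unfolding linear_code_def CT
    using linear_injective_image[of k T "n + s", OF T_carrier T_add T_smult T_inj] by simp
  have "C \<inter> galois_dual p l (n + s) C = {0\<^sub>v (n + s)}"
  proof (intro equalityI subsetI)
    fix x assume "x \<in> C \<inter> galois_dual p l (n + s) C"
    then obtain f where f: "Polynomial.degree f < k" "x = w f" and x: "\<And>c. c \<in> C \<Longrightarrow> galois_inner p l c x = 0"
      by (auto simp: C_def galois_dual_def)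
    have "f = 0"
    proof (rule lcd[OF f(1)])
      fix g :: "'a poly" assume "Polynomial.degree g < k"
      then have "w g \<in> C" by (auto simp: C_def)
      from x[OF this] show "(\<Sum>j<n + s. (V j * E g j) * (V j * E f j) ^ p ^ l) = 0"
        by (simp add: galois_inner_def f(2) wdim wi)
    qed
    then show "x \<in> {0\<^sub>v (n + s)}" using f(2) w_0 by simp
  next
    fix x :: "'a vec" assume "x \<in> {0\<^sub>v (n + s)}"
    then have x: "x = 0\<^sub>v (n + s)" by simp
    have "x \<in> C" unfolding x C_def w_0[symmetric] using k0 by (intro imageI) simp
    moreover have "galois_inner p l c x = 0" if "c \<in> C" for c
      unfolding galois_inner_def using that C_sub x p by (intro sum.neutral) (auto simp: prime_gt_0_nat)
    ultimately show "x \<in> C \<inter> galois_dual p l (n + s) C" unfolding galois_dual_def x by auto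
  qed
  then have glcd: "galois_lcd p l (n + s) C" by (simp add: galois_lcd_def)
  \<comment> \<open>The same codeword as a function vanishing from n + s on.\<close>
  define fw where "fw f = (\<lambda>j. if j < n + s then V j * E f j else 0)" for f
  define D where "D = fw ` {f. Polynomial.degree f < k}"
  have fw_0: "fw 0 = (\<lambda>_. 0)" by (auto simp: fw_def E_0)
  have fw_inj: "f = g" if "fw f = fw g" "Polynomial.degree f < k" "Polynomial.degree g < k" for f g
  proof (rule w_inj[OF _ that(2,3)])
    show "w f = w g" unfolding w_eq_iff
    proof (intro allI impI)
      fix j assume "j < n + s"
      then show "E f j = E g j" using fun_cong[OF that(1), of j] V0[of j] by (simp add: fw_def)
    qed
  qed
  have form: "(\<Sum>i<n + s. fw g i * fw f i ^ p ^ l) = (\<Sum>j<n + s. (V j * E g j) * (V j * E f j) ^ p ^ l)" for f g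
    by (intro sum.cong) (auto simp: fw_def)
  have fw_weight: "weight (n + s) (fw f) = grl_weight n s k a A f" for f
  proof -
    have "{j. j < n + s \<and> fw f j \<noteq> 0} = {j. j < n + s \<and> grl_coord n s k a A f j \<noteq> 0}"
      using V0 by (auto simp: fw_def E_def)
    then show ?thesis by (simp add: weight_def grl_weight_def)
  qed
  have "card D = CARD('a) ^ k"
  proof -
    define B where "B = box k (\<lambda>_. UNIV :: 'a set)"
    have "D = (\<lambda>c. fw (poly_of_fun k c)) ` B"
    proof (intro equalityI subsetI)
      fix x assume "x \<in> D"
      then obtain f where f: "Polynomial.degree f < k" "x = fw f" by (auto simp: D_def)
      have "Polynomial.coeff f \<in> B" using f(1) by (auto simp: B_def box_def coeff_eq_0)
      moreover have "poly_of_fun k (Polynomial.coeff f) = f" by (rule poly_of_fun_coeff[OF f(1)]) simp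
      ultimately show "x \<in> (\<lambda>c. fw (poly_of_fun k c)) ` B" using f(2) by (auto intro: image_eqI[of _ _ "Polynomial.coeff f"])
    next
      fix x assume "x \<in> (\<lambda>c. fw (poly_of_fun k c)) ` B"
      then show "x \<in> D" using degree_poly_of_fun[OF k0] by (auto simp: D_def)
    qed
    moreover have "inj_on (\<lambda>c. fw (poly_of_fun k c)) B"
    proof (rule inj_onI)
      fix b c assume b: "b \<in> B" and c: "c \<in> B" and "fw (poly_of_fun k b) = fw (poly_of_fun k c)"
      then have e: "poly_of_fun k b = poly_of_fun k c" by (intro fw_inj degree_poly_of_fun[OF k0])
      show "b = c"
      proof
        fix i show "b i = c i"
          using arg_cong[OF e, of "\<lambda>f. Polynomial.coeff f i"] b c
          by (cases "i < k") (simp_all add: coeff_poly_of_fun B_def box_def)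
      qed
    qed
    ultimately show ?thesis by (simp add: card_image B_def card_box)
  qed
  then interpret lcd_function_code p e l "p ^ l" "TYPE('a)" "n + s" k d D
  proof unfold_locales
    show "D \<subseteq> box (n + s) (\<lambda>_. UNIV)" by (auto simp: D_def fw_def box_def)
    show "(\<lambda>_. 0) \<in> D" unfolding D_def fw_0[symmetric] using k0 by (intro imageI) simp
    fix x assume "x \<in> D"
    then obtain f where f: "Polynomial.degree f < k" "x = fw f" by (auto simp: D_def)
    have "(\<lambda>i. b * x i) = fw (Polynomial.smult b f)" for b
      by (rule ext) (simp add: f(2) fw_def E_smult)
    then show "(\<lambda>i. b * x i) \<in> D" for b
      using f(1) by (auto simp: D_def intro: le_less_trans[OF degree_smult_le])
    show "d \<le> weight (n + s) x" if "x \<noteq> (\<lambda>_. 0)"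
      using that lower[OF _ f(1)] fw_weight[of f] fw_0 f(2) by auto
    show "x = (\<lambda>_. 0)" if orth: "\<And>c. c \<in> D \<Longrightarrow> (\<Sum>i<n + s. c i * x i ^ p ^ l) = 0"
    proof -
      have "f = 0"
      proof (rule lcd[OF f(1)])
        fix g :: "'a poly" assume "Polynomial.degree g < k"
        then have "fw g \<in> D" by (auto simp: D_def)
        from orth[OF this] show "(\<Sum>j<n + s. (V j * E g j) * (V j * E f j) ^ p ^ l) = 0"
          by (simp only: f(2) form)
      qed
      then show ?thesis using f(2) fw_0 by simp
    qed
    fix y assume "y \<in> D"
    then obtain g where g: "Polynomial.degree g < k" "y = fw g" by (auto simp: D_def)
    have "(\<lambda>i. x i + y i) = fw (f + g)"
      by (rule ext) (simp add: f(2) g(2) fw_def E_add algebra_simps)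
    then show "(\<lambda>i. x i + y i) \<in> D" using f(1) g(1) by (auto simp: D_def degree_add_less)
  qed (use kn in simp_all)
  have "eaqecc_exists CARD('a) (n + s) k d (n + s - k)" by (rule eaqecc_same_field)
  moreover have "eaqecc_exists (p ^ l) (n + s) k d (n + s - k)" if "e = 2 * l"
    by (rule eaqecc_hermitian[OF that])
  moreover have "is_GRL_code n s k a C"
    unfolding is_GRL_code_def using s kn a v A GRL by blast
  moreover have "hermitian_lcd p e (n + s) C" if "e = 2 * l"
    using glcd that by (simp add: hermitian_lcd_def)
  ultimately show ?thesis
    unfolding lcd_GRL_and_eaqecc_def maximally_entangled_eaqecc_exists_def using lin glcd by blast
qed

section \<open>Minimum distances\<close>

definition node_poly :: "'a::field vec \<Rightarrow> nat set \<Rightarrow> 'a poly" where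
  "node_poly a J = (\<Prod>j\<in>J. [:- (a $ j), 1:])"

lemma node_poly_0: "node_poly a {} = 1"
  by (simp add: node_poly_def)

lemma node_poly_insert:
  "finite J \<Longrightarrow> b \<notin> J \<Longrightarrow> node_poly a (insert b J) = [:- (a $ b), 1:] * node_poly a J"
  by (simp add: node_poly_def)

lemma poly_node_poly: "finite J \<Longrightarrow> j \<in> J \<Longrightarrow> poly (node_poly a J) (a $ j) = 0"
  by (auto simp: node_poly_def poly_prod)

lemma degree_node_poly_le: "finite J \<Longrightarrow> Polynomial.degree (node_poly a J) \<le> card J"
proof (induction J rule: finite_induct)
  case (insert b J)
  then show ?case
    using degree_mult_le[of "[:- (a $ b), 1:]" "node_poly a J"] by (simp add: node_poly_insert)
qed (simp add: node_poly_0)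

lemma coeff_linear_mult:
  "Polynomial.coeff ([:d, c:] * P) m = d * Polynomial.coeff P m + (case m of 0 \<Rightarrow> 0 | Suc i \<Rightarrow> c * Polynomial.coeff P i)"
  by (cases m) simp_all

lemma e1_insert: "finite J \<Longrightarrow> b \<notin> J \<Longrightarrow> e1 a (insert b J) = a $ b + e1 a J"
  by (simp add: e1_def)

lemma e2_insert_max:
  assumes "finite J" "\<And>j. j \<in> J \<Longrightarrow> j < b"
  shows "e2 a (insert b J) = e2 a J + a $ b * e1 a J"
proof -
  let ?P = "\<lambda>S. {(i, j). i \<in> S \<and> j \<in> S \<and> i < j}"
  have P: "?P (insert b J) = ?P J \<union> (\<lambda>i. (i, b)) ` J"
    using assms(2) by (auto dest: less_asym)
  have "finite (?P J)" by (rule finite_subset[of _ "J \<times> J"]) (use assms(1) in auto)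
  moreover have "?P J \<inter> (\<lambda>i. (i, b)) ` J = {}" using assms(2) by auto
  ultimately have "e2 a (insert b J) = e2 a J + (\<Sum>(i, j)\<in>(\<lambda>i. (i, b)) ` J. a $ i * a $ j)"
    unfolding e2_def P using assms(1) by (subst sum.union_disjoint) auto
  also have "(\<Sum>(i, j)\<in>(\<lambda>i. (i, b)) ` J. a $ i * a $ j) = (\<Sum>i\<in>J. a $ i * a $ b)"
    by (subst sum.reindex) (auto simp: inj_on_def)
  finally show ?thesis by (simp add: e1_def sum_distrib_left mult.commute)
qed

text \<open>Vieta for the three top coefficients, in one induction since each uses the one above it.
  Nodes are added in increasing order of index because \<open>e2\<close> sums over pairs i <
  j.\<close>

lemma coeff_node_poly:
  assumes "finite J"
  shows "Polynomial.coeff (node_poly a J) (card J) = 1"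
    and "card J = Suc m \<Longrightarrow> Polynomial.coeff (node_poly a J) m = - e1 a J"
    and "card J = Suc (Suc m) \<Longrightarrow> Polynomial.coeff (node_poly a J) m = e2 a J"
proof -
  have "Polynomial.coeff (node_poly a J) (card J) = 1 \<and>
    (\<forall>m. card J = Suc m \<longrightarrow> Polynomial.coeff (node_poly a J) m = - e1 a J) \<and>
    (\<forall>m. card J = Suc (Suc m) \<longrightarrow> Polynomial.coeff (node_poly a J) m = e2 a J)"
    using assms
  proof (induction J rule: finite_linorder_max_induct)
    case (insert b J)
    have b: "b \<notin> J" using insert by auto
    have P: "node_poly a (insert b J) = [:- (a $ b), 1:] * node_poly a J"
      by (rule node_poly_insert) (use insert b in auto)
    have c: "card (insert b J) = Suc (card J)" using insert b by simp
    have e2i: "e2 a (insert b J) = e2 a J + a $ b * e1 a J" using insert(1,2) by (intro e2_insert_max) auto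
    have top: "Polynomial.coeff (node_poly a J) (Suc (card J)) = 0"
      using degree_node_poly_le[OF insert(1), of a] by (intro coeff_eq_0) simp
    have "Polynomial.coeff (node_poly a (insert b J)) m = - e1 a (insert b J)" if "m = card J" for m
    proof (cases m)
      case 0
      then have "J = {}" using that insert(1) by simp
      then show ?thesis using 0 by (simp add: node_poly_def e1_def)
    next
      case (Suc i)
      then show ?thesis
        unfolding P coeff_linear_mult using insert that b by (auto simp: e1_insert)
    qed
    moreover have "Polynomial.coeff (node_poly a (insert b J)) m = e2 a (insert b J)" if m: "card J = Suc m" for m
    proof (cases m)
      case 0
      then obtain j where "J = {j}" using m by (auto simp: card_Suc_eq)
      then have "e2 a J = 0" by (auto simp: e2_def intro!: sum.neutral)
      then show ?thesis
        unfolding P coeff_linear_mult e2i using insert m 0 by simp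
    next
      case (Suc i)
      then show ?thesis
        unfolding P coeff_linear_mult e2i using insert m by simp
    qed
    ultimately show ?case
      unfolding c using insert top by (simp add: P coeff_linear_mult)
  qed (simp add: node_poly_0)
  then show "Polynomial.coeff (node_poly a J) (card J) = 1"
    and "card J = Suc m \<Longrightarrow> Polynomial.coeff (node_poly a J) m = - e1 a J"
    and "card J = Suc (Suc m) \<Longrightarrow> Polynomial.coeff (node_poly a J) m = e2 a J" by blast+
qed

section \<open>Roots among the evaluation points against zeros in the additional coordinates\<close>

definition zeros :: "nat \<Rightarrow> 'a::field vec \<Rightarrow> 'a poly \<Rightarrow> nat set" where
  "zeros n a f = {j. j < n \<and> poly f (a $ j) = 0}"

definition tail_coord :: "nat \<Rightarrow> nat \<Rightarrow> 'a::field mat \<Rightarrow> 'a poly \<Rightarrow> nat \<Rightarrow> 'a" where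
  "tail_coord s k A f i = (\<Sum>m<s. A $$ (m, i) * Polynomial.coeff f (k - s + m))"

definition tail_weight :: "nat \<Rightarrow> nat \<Rightarrow> 'a::field mat \<Rightarrow> 'a poly \<Rightarrow> nat" where
  "tail_weight s k A f = card {i. i < s \<and> tail_coord s k A f i \<noteq> 0}"

lemma zeros_finite: "finite (zeros n a f)" "zeros n a f \<subseteq> {..<n}"
  by (auto simp: zeros_def)

text \<open>Written additively so that no truncated subtraction occurs.\<close>

lemma grl_weight_eq: "grl_weight n s k a A f + card (zeros n a f) = n + tail_weight s k A f"
proof -
  let ?X = "{j. j < n \<and> poly f (a $ j) \<noteq> 0}" and ?Y = "{i. i < s \<and> tail_coord s k A f i \<noteq> 0}"
  have e: "{j. j < n + s \<and> grl_coord n s k a A f j \<noteq> 0} = ?X \<union> (\<lambda>i. n + i) ` ?Y"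
  proof (intro equalityI subsetI)
    fix j assume "j \<in> {j. j < n + s \<and> grl_coord n s k a A f j \<noteq> 0}"
    then show "j \<in> ?X \<union> (\<lambda>i. n + i) ` ?Y"
      by (cases "j < n") (auto simp: grl_coord_def tail_coord_def intro: image_eqI[of _ _ "j - n"])
  qed (auto simp: grl_coord_def tail_coord_def)
  have "grl_weight n s k a A f = card ?X + tail_weight s k A f"
    unfolding grl_weight_def e tail_weight_def by (subst card_Un_disjoint) (auto simp: card_image)
  moreover have "card ?X + card (zeros n a f) = n"
  proof -
    have "{..<n} = ?X \<union> zeros n a f" by (auto simp: zeros_def)
    then have "card {..<n} = card ?X + card (zeros n a f)"
      by (simp only:) (subst card_Un_disjoint, auto simp: zeros_def)
    then show ?thesis by simp
  qed
  ultimately show ?thesis by simp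
qed

lemma card_zeros_less:
  assumes "distinct_entries n a" "f \<noteq> 0" "Polynomial.degree f < m"
  shows "card (zeros n a f) < m"
proof (rule ccontr)
  assume "\<not> card (zeros n a f) < m"
  then have "m \<le> card (zeros n a f)" by simp
  then have "f = 0"
    by (rule poly_eq_0_of_distinct_roots[OF assms(1) zeros_finite(2) _ assms(3)]) (simp add: zeros_def)
  then show False using assms(2) by simp
qed

lemma tail_coord_eq_scalar_prod:
  assumes "A \<in> carrier_mat s s" "i < s"
  shows "tail_coord s k A f i = col A i \<bullet> vec s (\<lambda>m. Polynomial.coeff f (k - s + m))"
  using assms by (auto simp: tail_coord_def scalar_prod_def atLeast0LessThan intro!: sum.cong)

lemma tail_zero:
  assumes A: "A \<in> GL s" and t: "\<And>i. i < s \<Longrightarrow> tail_coord s k A f i = 0" and m: "m < s"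
  shows "Polynomial.coeff f (k - s + m) = 0"
proof -
  have As: "A \<in> carrier_mat s s" and inv: "invertible_mat A" using A by (auto simp: GL_def)
  obtain B where B: "B \<in> carrier_mat s s" "A * B = 1\<^sub>m s"
  proof -
    obtain B where "inverts_mat A B" "inverts_mat B A" using inv by (auto simp: invertible_mat_def)
    then have "A * B = 1\<^sub>m s" "B * A = 1\<^sub>m (dim_row B)" using As by (auto simp: inverts_mat_def)
    moreover have "dim_row B = s" "dim_col B = s"
      using arg_cong[OF calculation(1), of dim_col] arg_cong[OF calculation(2), of dim_col] As by auto
    ultimately show ?thesis using that by auto
  qed
  define x where "x = vec s (\<lambda>m. Polynomial.coeff f (k - s + m))"
  have x: "x \<in> carrier_vec s" by (simp add: x_def)
  have "transpose_mat A *\<^sub>v x = 0\<^sub>v s"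
  proof (rule eq_vecI)
    fix i assume "i < dim_vec (0\<^sub>v s :: 'a vec)"
    then have i: "i < s" by simp
    then show "(transpose_mat A *\<^sub>v x) $ i = 0\<^sub>v s $ i"
      using t[OF i] tail_coord_eq_scalar_prod[OF As i, of k f] As by (simp add: x_def)
  qed (use As in simp)
  moreover have "transpose_mat B * transpose_mat A = 1\<^sub>m s"
    using transpose_mult[OF As B(1)] B(2) by simp
  moreover have "(transpose_mat B * transpose_mat A) *\<^sub>v x = transpose_mat B *\<^sub>v (transpose_mat A *\<^sub>v x)"
    by (rule assoc_mult_mat_vec[of _ s s _ s]) (use As B x in auto)
  ultimately have "x = transpose_mat B *\<^sub>v 0\<^sub>v s" using x by simp
  then have "x = 0\<^sub>v s" using B(1) by (auto simp: vec_eq_iff)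
  then have "x $ m = 0" using m by simp
  then show ?thesis using m by (simp add: x_def)
qed

text \<open>Invertibility of A makes the top s coefficients vanish, so the degree drops below k - s
  and so does the number of roots.\<close>

lemma tail_weight_0:
  assumes a: "distinct_entries n a" and A: "A \<in> GL s" and s: "s \<le> k" 
    and f: "f \<noteq> 0" "Polynomial.degree f < k" and t: "tail_weight s k A f = 0"
  shows "card (zeros n a f) + s < k"
proof -
  have "tail_coord s k A f i = 0" if "i < s" for i
    using t that by (auto simp: tail_weight_def)
  then have c: "Polynomial.coeff f (k - s + m) = 0" if "m < s" for m using tail_zero[OF A _ that] by blast
  have c': "Polynomial.coeff f i = 0" if "k - s \<le> i" for i
  proof (cases "i < k")
    case True
    then show ?thesis using c[of "i - (k - s)"] that s by simp
  qed (use f(2) in \<open>auto intro: coeff_eq_0\<close>)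
  have "k - s \<noteq> 0" using c' f(1) by (metis bot_nat_0.extremum leading_coeff_0_iff)
  then have "Polynomial.degree f < k - s" using c' by (intro degree_lessI) auto
  from card_zeros_less[OF a f(1) this] show ?thesis by simp
qed

text \<open>There are at most k - 1 roots. Either some additional coordinate is nonzero, or all
  vanish and the number of roots is at most k - s - 1.\<close>

lemma grl_weight_ge:
  assumes a: "distinct_entries n a" and A: "A \<in> GL s" and s: "2 \<le> s" "s \<le> k" and kn: "k \<le> n"
    and f: "f \<noteq> 0" "Polynomial.degree f < k"
  shows "n - k + 2 \<le> grl_weight n s k a A f"
  using grl_weight_eq[of n s k a A f] card_zeros_less[OF a f] tail_weight_0[OF a A s(2) f] s kn
  by (cases "tail_weight s k A f = 0") auto

text \<open>Subtracting the right multiple of \<open>node_poly a J\<close> leaves degree below k - 1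
  with k - 1 roots. Polynomials with the most roots are thus known up to a scalar.\<close>

lemma eq_smult_node_poly:
  assumes a: "distinct_entries n a" and J: "J \<subseteq> zeros n a f" "Suc (card J) = k" and f: "Polynomial.degree f < k"
  shows "f = Polynomial.smult (Polynomial.coeff f (k - 1)) (node_poly a J)"
proof (cases "J = {}")
  case True
  then have "Polynomial.degree f = 0" "k = 1" using J(2) f by auto
  then show ?thesis using True by (auto simp: node_poly_0 elim: degree_eq_zeroE)
next
  case False
  have fin: "finite J" using J(1) zeros_finite(1) by (rule finite_subset)
  define g where "g = f - Polynomial.smult (Polynomial.coeff f (k - 1)) (node_poly a J)"
  have "Polynomial.coeff g i = 0" if "card J \<le> i" for i
  proof (cases "i = card J")
    case True
    then show ?thesis using coeff_node_poly(1)[OF fin, of a] J(2) by (auto simp: g_def)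
  next
    case False
    then have "card J < i" using that by simp
    then show ?thesis
      using degree_node_poly_le[OF fin, of a] f J(2) by (simp add: g_def coeff_eq_0)
  qed
  then have "Polynomial.degree g < card J" using False fin by (intro degree_lessI) auto
  moreover have "poly g (a $ j) = 0" if "j \<in> J" for j
    using that J(1) poly_node_poly[OF fin that, of a] by (auto simp: g_def zeros_def)
  ultimately have "g = 0"
    using poly_eq_0_of_distinct_roots[OF a, of J "card J" g] J(1) zeros_finite(2) by blast
  then show ?thesis by (simp add: g_def)
qed

lemma zeros_node_poly:
  assumes "J \<subseteq> {..<n}" shows "J \<subseteq> zeros n a (node_poly a J)"
  using assms poly_node_poly[of J _ a] finite_subset[OF assms] by (auto simp: zeros_def)

lemma node_poly_nonzero: "finite J \<Longrightarrow> node_poly a J \<noteq> 0"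
  using coeff_node_poly(1)[of J a] by auto

lemma card_zeros_node_poly:
  assumes a: "distinct_entries n a" and J: "J \<subseteq> {..<n}"
  shows "card (zeros n a (node_poly a J)) = card J"
proof -
  have fin: "finite J" using J by (rule finite_subset) simp
  have "card (zeros n a (node_poly a J)) < Suc (card J)"
    using degree_node_poly_le[OF fin, of a] by (intro card_zeros_less[OF a node_poly_nonzero[OF fin]]) simp
  moreover have "card J \<le> card (zeros n a (node_poly a J))"
    using zeros_node_poly[OF J] zeros_finite(1) by (rule card_mono[rotated])
  ultimately show ?thesis by simp
qed

lemma one_mat_GL: "1\<^sub>m s \<in> GL s"
  unfolding GL_def invertible_mat_def inverts_mat_def by (auto intro!: exI[of _ "1\<^sub>m s"])

text \<open>Columns (0, 1) and (1, \<tau>), the classical Roth-Lempel extension. On a multiple c of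
  the monic polynomial with roots J, the two coordinates are c and c (\<tau> - e1 J), so the
  distance depends on whether \<tau> is a subset sum.\<close>

definition two_columns :: "'a::field \<Rightarrow> 'a mat" where
  "two_columns \<tau> = mat 2 2 (\<lambda>(i, j). if i = 0 then (if j = 0 then 0 else 1) else (if j = 0 then 1 else \<tau>))"

lemma two_columns_GL: "two_columns \<tau> \<in> GL 2"
proof -
  define B where "B = mat 2 2 (\<lambda>(i, j). if i = 0 then (if j = 0 then - \<tau> else 1) else (if j = 0 then 1 else 0 :: 'a))"
  have "two_columns \<tau> * B = 1\<^sub>m 2" "B * two_columns \<tau> = 1\<^sub>m 2"
    by (rule eq_matI; auto simp: two_columns_def B_def scalar_prod_def less_2_cases_iff numeral_2_eq_2)+
  then show ?thesis
    unfolding GL_def invertible_mat_def inverts_mat_def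
    by (auto simp: two_columns_def B_def intro!: exI[of _ B])
qed

lemma tail_coord_two_columns:
  assumes "2 \<le> k"
  shows "tail_coord 2 k (two_columns \<tau>) f 0 = Polynomial.coeff f (k - 1)"
    and "tail_coord 2 k (two_columns \<tau>) f 1 = Polynomial.coeff f (k - 2) + \<tau> * Polynomial.coeff f (k - 1)"
proof -
  obtain i where "k = Suc (Suc i)" using assms by (metis Suc_le_D numeral_2_eq_2 Suc_le_mono)
  then show "tail_coord 2 k (two_columns \<tau>) f 0 = Polynomial.coeff f (k - 1)"
    and "tail_coord 2 k (two_columns \<tau>) f 1 = Polynomial.coeff f (k - 2) + \<tau> * Polynomial.coeff f (k - 1)"
    by (simp_all add: tail_coord_def two_columns_def numeral_2_eq_2)
qed

lemma tail_weight_eq: "tail_weight s k A f + card {i. i < s \<and> tail_coord s k A f i = 0} = s"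
proof -
  have "{..<s} = {i. i < s \<and> tail_coord s k A f i \<noteq> 0} \<union> {i. i < s \<and> tail_coord s k A f i = 0}" by auto
  then have "card {..<s} = card {i. i < s \<and> tail_coord s k A f i \<noteq> 0} + card {i. i < s \<and> tail_coord s k A f i = 0}"
    by (simp only:) (subst card_Un_disjoint, auto)
  then show ?thesis by (simp add: tail_weight_def)
qed

lemma tail_weight_full:
  assumes "\<And>i. i < s \<Longrightarrow> tail_coord s k A f i \<noteq> 0" shows "tail_weight s k A f = s"
proof -
  have e: "{i. i < s \<and> tail_coord s k A f i = 0} = {}" using assms by auto
  show ?thesis using tail_weight_eq[of s k A f] unfolding e by simp
qed

lemma tail_coord_eq_sum_3:
  assumes "3 \<le> k"
  shows "tail_coord 3 k A f r = A $$ (0, r) * Polynomial.coeff f (k - 3) + A $$ (1, r) * Polynomial.coeff f (k - 2)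
    + A $$ (2, r) * Polynomial.coeff f (k - 1)"
proof -
  obtain i where "k = Suc (Suc (Suc i))" using assms by (metis Suc_le_D numeral_3_eq_3 Suc_le_mono)
  then show ?thesis by (simp add: tail_coord_def numeral_3_eq_3 numeral_2_eq_2)
qed

lemma scalar_prod_3: "dim_vec w = 3 \<Longrightarrow> v \<bullet> w = v $ 0 * w $ 0 + v $ 1 * w $ 1 + v $ 2 * w $ 2"
  by (simp add: scalar_prod_def numeral_3_eq_3 numeral_2_eq_2)

lemma omega_vec_index: "dim_vec (omega_vec a I) = 3" "omega_vec a I $ 0 = 1" "omega_vec a I $ 1 = e1 a I"
  "omega_vec a I $ 2 = (e1 a I)\<^sup>2 - e2 a I"
  by (simp_all add: omega_vec_def numeral_2_eq_2)

lemma gamma_vec_index: "dim_vec (gamma_vec a J) = 3" "gamma_vec a J $ 0 = e2 a J" "gamma_vec a J $ 1 = - e1 a J"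
  "gamma_vec a J $ 2 = 1"
  by (simp_all add: gamma_vec_def numeral_2_eq_2)

text \<open>The entries of \<open>gamma_vec a J\<close> are the three top coefficients of
  \<open>node_poly a J\<close>.\<close>

lemma tail_coord_gamma:
  assumes a: "distinct_entries n a" and A: "A \<in> carrier_mat 3 3" and k: "3 \<le> k"
    and f: "Polynomial.degree f < k" and J: "J \<subseteq> zeros n a f" "Suc (card J) = k" and r: "r < 3"
  shows "tail_coord 3 k A f r = Polynomial.coeff f (k - 1) * (col A r \<bullet> gamma_vec a J)"
proof -
  define c where "c = Polynomial.coeff f (k - 1)"
  have fin: "finite J" using J(1) zeros_finite(1) by (rule finite_subset)
  have e: "f = Polynomial.smult c (node_poly a J)" unfolding c_def by (rule eq_smult_node_poly[OF a J f])
  have "card J = Suc (k - 2)" "card J = Suc (Suc (k - 3))" using J(2) k by auto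
  then have "Polynomial.coeff f (k - 2) = c * - e1 a J" "Polynomial.coeff f (k - 3) = c * e2 a J"
    using coeff_node_poly(2,3)[OF fin, of _ a] by (subst e, simp)+
  then show ?thesis
    unfolding tail_coord_eq_sum_3[OF k] using A r
    by (simp add: scalar_prod_3 gamma_vec_index c_def[symmetric] algebra_simps del: One_nat_def)
qed

text \<open>With \<open>k - 2\<close> zeros prescribed, \<open>f = (c x + d) \<Prod>(x - a i)\<close>, and the possible coefficient vectors
  \<open>(f\<^sub>k\<^sub>-\<^sub>3, f\<^sub>k\<^sub>-\<^sub>2, f\<^sub>k\<^sub>-\<^sub>1)\<close> form the orthogonal complement of \<open>\<omega>\<^sub>I\<close>.\<close>

lemma coeff_linear_times_node_poly:
  assumes k: "4 \<le> k" and I: "finite I" "Suc (Suc (card I)) = k"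
  shows "Polynomial.coeff ([:d, c:] * node_poly a I) (k - 1) = c"
    and "Polynomial.coeff ([:d, c:] * node_poly a I) (k - 2) = d - c * e1 a I"
    and "Polynomial.coeff ([:d, c:] * node_poly a I) (k - 3) = - d * e1 a I + c * e2 a I"
    and "Polynomial.degree ([:d, c:] * node_poly a I) < k"
proof -
  obtain m where m: "k = Suc (Suc (Suc (Suc m)))" "card I = Suc (Suc m)"
    by (rule that[of "card I - 2"]) (use k I(2) in linarith)+
  have "Polynomial.coeff (node_poly a I) (Suc (Suc (Suc m))) = 0"
    using degree_node_poly_le[OF I(1), of a] m by (intro coeff_eq_0) simp
  then show "Polynomial.coeff ([:d, c:] * node_poly a I) (k - 1) = c"
    and "Polynomial.coeff ([:d, c:] * node_poly a I) (k - 2) = d - c * e1 a I"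
    and "Polynomial.coeff ([:d, c:] * node_poly a I) (k - 3) = - d * e1 a I + c * e2 a I"
    unfolding coeff_linear_mult using coeff_node_poly(2,3)[OF I(1), of _ a] coeff_node_poly(1)[OF I(1), of a] m
    by (simp_all add: numeral_2_eq_2 numeral_3_eq_3)
  have "Polynomial.degree ([:d, c:] * node_poly a I) \<le> Polynomial.degree [:d, c:] + Polynomial.degree (node_poly a I)"
    by (rule degree_mult_le)
  then show "Polynomial.degree ([:d, c:] * node_poly a I) < k"
    using degree_node_poly_le[OF I(1), of a] m by (simp split: if_splits)
qed

text \<open>c and d are chosen to match the two top coefficients; the difference then has degree
  below k - 2 and k - 2 roots.\<close>

lemma eq_linear_times_node_poly:
  assumes a: "distinct_entries n a" and k: "4 \<le> k" and f: "Polynomial.degree f < k"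
    and I: "I \<subseteq> zeros n a f" "Suc (Suc (card I)) = k"
  shows "\<exists>d c. f = [:d, c:] * node_poly a I"
proof -
  have fin: "finite I" using I(1) zeros_finite(1) by (rule finite_subset)
  define c where "c = Polynomial.coeff f (k - 1)"
  define d where "d = Polynomial.coeff f (k - 2) + c * e1 a I"
  define g where "g = f - [:d, c:] * node_poly a I"
  note co = coeff_linear_times_node_poly[OF k fin I(2), of d c a]
  have "Polynomial.coeff g i = 0" if i: "card I \<le> i" for i
  proof -
    consider "i = k - 2" | "i = k - 1" | "k \<le> i" using i I(2) by linarith
    then show ?thesis
    proof cases
      case 3
      then show ?thesis using f co(4) by (simp add: g_def coeff_eq_0 del: mult_pCons_left)
    qed (use co(1,2) in \<open>simp_all add: g_def c_def d_def del: mult_pCons_left\<close>)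
  qed
  then have "Polynomial.degree g < card I" using I(2) k by (intro degree_lessI) auto
  moreover have "poly g (a $ j) = 0" if "j \<in> I" for j
    using that I(1) poly_node_poly[OF fin that, of a] by (auto simp: g_def zeros_def)
  ultimately have "g = 0"
    using poly_eq_0_of_distinct_roots[OF a, of I "card I" g] I(1) zeros_finite(2) by blast
  then have "f = [:d, c:] * node_poly a I" by (simp add: g_def)
  then show ?thesis by blast
qed

text \<open>Translates the determinant into a vector y orthogonal to three columns. In use, y is the
  triple of top coefficients of a polynomial vanishing on I for which additional coordinates r and t
  are zero.\<close>

lemma det_cols_eq_0_iff:
  assumes A: "A \<in> carrier_mat 3 3" and r: "r < 3" "t < 3"
  shows "det_cols a A r t I = 0 \<longleftrightarrow>
    (\<exists>y. y \<in> carrier_vec 3 \<and> y \<noteq> 0\<^sub>v 3 \<and> col A r \<bullet> y = 0 \<and> col A t \<bullet> y = 0 \<and> omega_vec a I \<bullet> y = 0)"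
proof -
  define M where "M = mat_of_cols 3 [col A r, col A t, omega_vec a I]"
  have M: "M \<in> carrier_mat 3 3" by (intro carrier_matI) (simp_all add: M_def)
  have om: "omega_vec a I \<in> carrier_vec 3" using omega_vec_index(1) by (rule carrier_vecI)
  have cr: "col A r \<in> carrier_vec 3" "col A t \<in> carrier_vec 3"
    by (rule carrier_vecI, simp only: dim_col carrier_matD(1)[OF A])+
  have c: "col M 0 = col A r" "col M 1 = col A t" "col M 2 = omega_vec a I"
    unfolding M_def using om cr by (simp_all add: col_mat_of_cols)
  have "transpose_mat M *\<^sub>v y = 0\<^sub>v 3 \<longleftrightarrow> col A r \<bullet> y = 0 \<and> col A t \<bullet> y = 0 \<and> omega_vec a I \<bullet> y = 0"
    if "y \<in> carrier_vec 3" for y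
  proof -
    have "transpose_mat M *\<^sub>v y = 0\<^sub>v 3 \<longleftrightarrow> (\<forall>i<3. col M i \<bullet> y = 0)"
      using M by (auto simp: vec_eq_iff)
    also have "\<dots> \<longleftrightarrow> col M 0 \<bullet> y = 0 \<and> col M 1 \<bullet> y = 0 \<and> col M 2 \<bullet> y = 0"
      by (simp add: numeral_3_eq_3 numeral_2_eq_2 less_Suc_eq all_conj_distrib)
    finally show ?thesis by (simp only: c)
  qed
  then show ?thesis
    unfolding det_cols_def M_def[symmetric] det_transpose[OF M, symmetric]
    using det_0_iff_vec_prod_zero_field[of "transpose_mat M" 3] M by auto
qed

lemma first_nodes: "m \<le> n \<Longrightarrow> {..<m} \<in> subsets_of_card n m"
  by (auto simp: subsets_of_card_def)

locale field_data =
  fixes p e l :: nat and F :: "'a::{field,finite} itself"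
  assumes p: "prime p" and card_a: "CARD('a) = p ^ e" and q4: "4 < p ^ e" and l: "0 < l" and le: "2 * l dvd e"
begin

lemmas of_weights = lcd_GRL_and_eaqecc_of_weights[OF p card_a q4 l le]

text \<open>For the identity matrix, d is the least weight that occurs.\<close>

lemma exists_min_weight:
  fixes a :: "'a vec"
  assumes a: "distinct_entries n a" and s: "2 \<le> s" "s \<le> k" and kn: "k \<le> n"
  shows "\<exists>d. n - k + 2 \<le> d \<and> lcd_GRL_and_eaqecc p e l n s k a d"
proof -
  have "\<exists>f. (f \<noteq> 0 \<and> Polynomial.degree f < k) \<and>
      (\<forall>g. g \<noteq> 0 \<and> Polynomial.degree g < k \<longrightarrow> grl_weight n s k a (1\<^sub>m s) f \<le> grl_weight n s k a (1\<^sub>m s) g)"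
    by (rule ex_has_least_nat[of _ "1 :: 'a poly"]) (use s in simp)
  then obtain f where f: "f \<noteq> 0" "Polynomial.degree f < k"
    and min: "\<And>g. g \<noteq> 0 \<Longrightarrow> Polynomial.degree g < k \<Longrightarrow> grl_weight n s k a (1\<^sub>m s) f \<le> grl_weight n s k a (1\<^sub>m s) g"
    by blast
  have "lcd_GRL_and_eaqecc p e l n s k a (grl_weight n s k a (1\<^sub>m s) f)"
    using s by (intro of_weights[OF a _ s(2) kn one_mat_GL min f refl]) auto
  then show ?thesis using grl_weight_ge[OF a one_mat_GL s kn f] by blast
qed

lemma two_columns_attained:
  fixes a :: "'a vec"
  assumes a: "distinct_entries n a" and k: "2 \<le> k" "k \<le> n" and J: "J \<in> subsets_of_card n (k - 1)"
  shows "grl_weight n 2 k a (two_columns \<tau>) (node_poly a J) = n - k + (if \<tau> = e1 a J then 2 else 3)"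
    and "node_poly a J \<noteq> 0" "Polynomial.degree (node_poly a J) < k"
proof -
  have J': "J \<subseteq> {..<n}" "card J = k - 1" "finite J"
    using J finite_subset by (auto simp: subsets_of_card_def)
  have "card J = Suc (k - 2)" using J'(2) k by simp
  then have c: "Polynomial.coeff (node_poly a J) (k - 1) = 1" "Polynomial.coeff (node_poly a J) (k - 2) = - e1 a J"
    using coeff_node_poly(1)[OF J'(3), of a] coeff_node_poly(2)[OF J'(3), of _ a] J'(2) by simp_all
  note t = tail_coord_two_columns[OF k(1), of \<tau> "node_poly a J", unfolded c]
  have "tail_coord 2 k (two_columns \<tau>) (node_poly a J) i = (if i = 0 then 1 else \<tau> - e1 a J)" if "i < 2" for i
    using t that by (auto simp: less_2_cases_iff)
  then have "{i. i < 2 \<and> tail_coord 2 k (two_columns \<tau>) (node_poly a J) i = 0} = {i. i < 2 \<and> i \<noteq> 0 \<and> \<tau> = e1 a J}"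
    by (auto split: if_splits)
  also have "\<dots> = (if \<tau> = e1 a J then {1} else {})" by (auto simp: less_2_cases_iff)
  finally have "{i. i < 2 \<and> tail_coord 2 k (two_columns \<tau>) (node_poly a J) i = 0} = (if \<tau> = e1 a J then {1} else {})" .
  then have "tail_weight 2 k (two_columns \<tau>) (node_poly a J) = (if \<tau> = e1 a J then 1 else 2)"
    using tail_weight_eq[of 2 k "two_columns \<tau>" "node_poly a J"] by (simp split: if_splits)
  then show "grl_weight n 2 k a (two_columns \<tau>) (node_poly a J) = n - k + (if \<tau> = e1 a J then 2 else 3)"
    using grl_weight_eq[of n 2 k a "two_columns \<tau>" "node_poly a J"] card_zeros_node_poly[OF a J'(1)] J'(2) k
    by (auto split: if_splits)
  show "node_poly a J \<noteq> 0" by (rule node_poly_nonzero[OF J'(3)])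
  show "Polynomial.degree (node_poly a J) < k" using degree_node_poly_le[OF J'(3), of a] J'(2) k by simp
qed

text \<open>Taking \<tau> to be the sum of the first k - 1 entries makes the general lower bound
  attained.\<close>

lemma almost_mds_2:
  fixes a :: "'a vec"
  assumes a: "distinct_entries n a" and k: "2 \<le> k" "k \<le> n"
  shows "lcd_GRL_and_eaqecc p e l n 2 k a (n - k + 2)"
proof -
  have J: "{..<k - 1} \<in> subsets_of_card n (k - 1)" using k by (intro first_nodes) simp
  note att = two_columns_attained(1)[OF a k J, of "e1 a {..<k - 1}"] two_columns_attained(2,3)[OF a k J]
  show ?thesis
    by (rule of_weights[OF a _ k two_columns_GL grl_weight_ge[OF a two_columns_GL _ k] att(2,3)])
      (use att(1) in simp_all)
qed

text \<open>With k - 1 roots both additional coordinates are nonzero, since \<tau> is no subset sum.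
  With fewer roots one nonzero coordinate is enough, and if both vanish there are at most k - 3
  roots.\<close>

lemma mds_2:
  fixes a :: "'a vec"
  assumes a: "distinct_entries n a" and k: "2 \<le> k" "k \<le> n" and \<tau>: "\<tau> \<notin> subset_sums n a (k - 1)"
  shows "lcd_GRL_and_eaqecc p e l n 2 k a (n - k + 3)"
proof -
  have \<tau>': "\<tau> \<noteq> e1 a J" if "J \<in> subsets_of_card n (k - 1)" for J
    using \<tau> that unfolding subset_sums_def subsets_of_card_def e1_def by blast
  have J: "{..<k - 1} \<in> subsets_of_card n (k - 1)" using k by (intro first_nodes) simp
  note att = two_columns_attained(1)[OF a k J, of \<tau>] two_columns_attained(2,3)[OF a k J]
  have lower: "n - k + 3 \<le> grl_weight n 2 k a (two_columns \<tau>) f" if f: "f \<noteq> 0" "Polynomial.degree f < k" for f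
  proof -
    note z = card_zeros_less[OF a f] grl_weight_eq[of n 2 k a "two_columns \<tau>" f]
    show ?thesis
    proof (cases "Suc (card (zeros n a f)) = k")
      case True
      let ?Z = "zeros n a f"
      define c where "c = Polynomial.coeff f (k - 1)"
      have fe: "f = Polynomial.smult c (node_poly a ?Z)"
        unfolding c_def by (rule eq_smult_node_poly[OF a order_refl True f(2)])
      then have c0: "c \<noteq> 0" using f(1) by auto
      have Z: "?Z \<in> subsets_of_card n (k - 1)" using True zeros_finite(2) by (auto simp: subsets_of_card_def)
      have "card ?Z = Suc (k - 2)" using True k by simp
      then have "Polynomial.coeff f (k - 2) = c * - e1 a ?Z"
        using coeff_node_poly(2)[where J = "zeros n a f" and m = "k - 2" and a = a, OF zeros_finite(1)] by (subst fe) simp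
      then have "Polynomial.coeff f (k - 2) + \<tau> * Polynomial.coeff f (k - 1) = c * (\<tau> - e1 a ?Z)"
        by (simp add: c_def algebra_simps)
      then have "tail_coord 2 k (two_columns \<tau>) f i \<noteq> 0" if "i < 2" for i
        using that c0 \<tau>'[OF Z] tail_coord_two_columns[OF k(1), of \<tau> f]
        by (auto simp: less_2_cases_iff c_def)
      then have "tail_weight 2 k (two_columns \<tau>) f = 2" by (rule tail_weight_full)
      then show ?thesis using z True k by simp
    next
      case False
      then show ?thesis using z tail_weight_0[OF a two_columns_GL k(1) f, of \<tau>] k
        by (cases "tail_weight 2 k (two_columns \<tau>) f = 0") auto
    qed
  qed
  show ?thesis
    by (rule of_weights[OF a _ k two_columns_GL lower att(2,3)]) (use att(1) \<tau>'[OF J] in simp_all)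
qed

text \<open>With k - 1 roots, (M2) keeps all three additional coordinates nonzero; with k - 2 roots,
  (M1) lets at most one vanish. With at most k - 3 roots one nonzero coordinate suffices, and if all
  three vanish at most k - 4 roots are possible. Every case gives n - k + 4.\<close>

lemma mds_3:
  fixes a :: "'a vec"
  assumes a: "distinct_entries n a" and k: "4 \<le> k" "k \<le> n" and A: "A \<in> GL 3"
    and M1: "condM1 n k a A" and M2: "condM2 n k a A"
  shows "lcd_GRL_and_eaqecc p e l n 3 k a (n - k + 4)"
proof -
  have As: "A \<in> carrier_mat 3 3" using A by (simp add: GL_def)
  have k3: "3 \<le> k" using k by simp
  have full: "tail_weight 3 k A f = 3"
    if f: "f \<noteq> 0" "Polynomial.degree f < k" and Z: "Suc (card (zeros n a f)) = k" for f
  proof (rule tail_weight_full)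
    fix r :: nat assume r: "r < 3"
    have "f = Polynomial.smult (Polynomial.coeff f (k - 1)) (node_poly a (zeros n a f))"
      by (rule eq_smult_node_poly[OF a order_refl Z f(2)])
    then have c0: "Polynomial.coeff f (k - 1) \<noteq> 0" using f(1) by (metis smult_0_left)
    have "zeros n a f \<in> subsets_of_card n (k - 1)" using Z zeros_finite(2) by (auto simp: subsets_of_card_def)
    then have "col A r \<bullet> gamma_vec a (zeros n a f) \<noteq> 0" using M2 r by (auto simp: condM2_def)
    then show "tail_coord 3 k A f r \<noteq> 0"
      unfolding tail_coord_gamma[OF a As k3 f(2) order_refl Z r] using c0 by simp
  qed
  have lower: "n - k + 4 \<le> grl_weight n 3 k a A f" if f: "f \<noteq> 0" "Polynomial.degree f < k" for f
  proof -
    note z = card_zeros_less[OF a f] grl_weight_eq[of n 3 k a A f]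
    consider "Suc (card (zeros n a f)) = k" | "Suc (Suc (card (zeros n a f))) = k" | "card (zeros n a f) + 3 \<le> k"
      using z(1) by linarith
    then show ?thesis
    proof cases
      case 1
      then show ?thesis using z full[OF f 1] k by simp
    next
      case 2
      let ?I = "zeros n a f"
      have I: "?I \<in> subsets_of_card n (k - 2)" using 2 zeros_finite(2) by (auto simp: subsets_of_card_def)
      have nz: "tail_weight 3 k A f \<noteq> 0" using tail_weight_0[OF a A k3 f] 2 by auto
      have two: "r = t" if r: "r < 3" "t < 3" and t0: "tail_coord 3 k A f r = 0" "tail_coord 3 k A f t = 0" for r t
      proof (rule ccontr)
        assume "r \<noteq> t"
        define y where "y = vec 3 (\<lambda>m. Polynomial.coeff f (k - 3 + m))"
        have yi: "y $ 0 = Polynomial.coeff f (k - 3)" "y $ 1 = Polynomial.coeff f (k - 2)" "y $ 2 = Polynomial.coeff f (k - 1)"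
        proof -
          have "k - 3 + 1 = k - 2" "k - 3 + 2 = k - 1" using k by auto
          then show "y $ 0 = Polynomial.coeff f (k - 3)" "y $ 1 = Polynomial.coeff f (k - 2)" "y $ 2 = Polynomial.coeff f (k - 1)"
            by (simp_all add: y_def)
        qed
        obtain d c where f': "f = [:d, c:] * node_poly a ?I"
          using eq_linear_times_node_poly[OF a k(1) f(2) order_refl 2] by blast
        note co = coeff_linear_times_node_poly[OF k(1) zeros_finite(1) 2, of d c a, folded f']
        \<comment> \<open>The sum (-d e1 + c e2) + e1 (d - c e1) + (e1^2 - e2) c cancels
          identically.\<close>
        have "omega_vec a ?I \<bullet> y = 0"
          by (subst scalar_prod_3) (simp_all add: y_def[THEN arg_cong[of _ _ dim_vec]] yi co omega_vec_index power2_eq_square algebra_simps del: One_nat_def)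
        moreover have "col A r \<bullet> y = 0" "col A t \<bullet> y = 0"
          using t0 tail_coord_eq_scalar_prod[OF As r(1), of k f] tail_coord_eq_scalar_prod[OF As r(2), of k f]
          by (simp_all add: y_def)
        moreover have "y \<noteq> 0\<^sub>v 3"
        proof
          assume "y = 0\<^sub>v 3"
          then have "y $ 0 = 0" "y $ 1 = 0" "y $ 2 = 0" by simp_all
          then have "tail_coord 3 k A f i = 0" for i unfolding tail_coord_eq_sum_3[OF k3] yi by simp
          then show False using nz by (simp add: tail_weight_def)
        qed
        moreover have "y \<in> carrier_vec 3" by (simp add: y_def)
        ultimately have "det_cols a A r t ?I = 0" "det_cols a A t r ?I = 0"
          using det_cols_eq_0_iff[OF As] r by blast+
        moreover have "r < t \<or> t < r" using \<open>r \<noteq> t\<close> by auto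
        ultimately show False using M1 I r unfolding condM1_def by blast
      qed
      have "card {i. i < 3 \<and> tail_coord 3 k A f i = 0} \<le> 1"
        using two by (auto simp: card_le_Suc0_iff_eq)
      then have "2 \<le> tail_weight 3 k A f" using tail_weight_eq[of 3 k A f] by simp
      then show ?thesis using z 2 k by simp
    next
      case 3
      then show ?thesis using z tail_weight_0[OF a A k3 f] k
        by (cases "tail_weight 3 k A f = 0") auto
    qed
  qed
  have J: "{..<k - 1} \<subseteq> {..<n}" "finite {..<k - 1}" using k by auto
  let ?f = "node_poly a {..<k - 1}"
  have f: "?f \<noteq> 0" "Polynomial.degree ?f < k"
    using node_poly_nonzero[OF J(2), of a] degree_node_poly_le[OF J(2), of a] k by simp_all
  have cz: "Suc (card (zeros n a ?f)) = k" using card_zeros_node_poly[OF a J(1)] k by simp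
  have "grl_weight n 3 k a A ?f = n - k + 4"
    using grl_weight_eq[of n 3 k a A ?f] full[OF f cz] cz k by simp
  then show ?thesis by (intro of_weights[OF a _ k3 k(2) A lower f]) simp_all
qed

text \<open>(N2) bounds the loss at k - 1 roots to one additional coordinate. Each alternative of
  (N1) gives a word of this weight: k - 1 roots with one vanishing coordinate, or k - 2 roots with
  two.\<close>

lemma almost_mds_3:
  fixes a :: "'a vec"
  assumes a: "distinct_entries n a" and k: "4 \<le> k" "k \<le> n" and A: "A \<in> GL 3"
    and N1: "condN1 n k a A" and N2: "condN2 n k a A"
  shows "lcd_GRL_and_eaqecc p e l n 3 k a (n - k + 3)"
proof -
  have As: "A \<in> carrier_mat 3 3" using A by (simp add: GL_def)
  have k3: "3 \<le> k" using k by simp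
  have lower: "n - k + 3 \<le> grl_weight n 3 k a A f" if f: "f \<noteq> 0" "Polynomial.degree f < k" for f
  proof -
    note z = card_zeros_less[OF a f] grl_weight_eq[of n 3 k a A f]
    show ?thesis
    proof (cases "Suc (card (zeros n a f)) = k")
      case True
      have "f = Polynomial.smult (Polynomial.coeff f (k - 1)) (node_poly a (zeros n a f))"
        by (rule eq_smult_node_poly[OF a order_refl True f(2)])
      then have c0: "Polynomial.coeff f (k - 1) \<noteq> 0" using f(1) by (metis smult_0_left)
      have Z: "zeros n a f \<in> subsets_of_card n (k - 1)" using True zeros_finite(2) by (auto simp: subsets_of_card_def)
      have "{i. i < 3 \<and> tail_coord 3 k A f i = 0} = {r. r < 3 \<and> col A r \<bullet> gamma_vec a (zeros n a f) = 0}"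
        using tail_coord_gamma[OF a As k3 f(2) order_refl True] c0 by auto
      then have "card {i. i < 3 \<and> tail_coord 3 k A f i = 0} \<le> 1" using N2 Z by (simp add: condN2_def)
      then show ?thesis using z True k tail_weight_eq[of 3 k A f] by simp
    next
      case False
      then show ?thesis using z tail_weight_0[OF a A k3 f] k
        by (cases "tail_weight 3 k A f = 0") auto
    qed
  qed
  have "\<exists>f. f \<noteq> 0 \<and> Polynomial.degree f < k \<and> grl_weight n 3 k a A f \<le> n - k + 3"
    using N1 unfolding condN1_def
  proof (elim disjE bexE exE conjE)
    fix J r assume J: "J \<in> subsets_of_card n (k - 1)" and r: "r < 3" "col A r \<bullet> gamma_vec a J = 0"
    have J': "J \<subseteq> {..<n}" "Suc (card J) = k" "finite J"
      using J k finite_subset by (auto simp: subsets_of_card_def)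
    have deg: "Polynomial.degree (node_poly a J) < k" using degree_node_poly_le[OF J'(3), of a] J'(2) by simp
    have "tail_coord 3 k A (node_poly a J) r = 0"
      unfolding tail_coord_gamma[OF a As k3 deg zeros_node_poly[OF J'(1)] J'(2) r(1)] using r(2) by simp
    then have "card {r} \<le> card {i. i < 3 \<and> tail_coord 3 k A (node_poly a J) i = 0}" using r(1) by (intro card_mono) auto
    then have "grl_weight n 3 k a A (node_poly a J) \<le> n - k + 3"
      using tail_weight_eq[of 3 k A "node_poly a J"] grl_weight_eq[of n 3 k a A "node_poly a J"]
        card_zeros_node_poly[OF a J'(1)] J'(2) k by simp
    then show ?thesis using node_poly_nonzero[OF J'(3)] deg by blast
  next
    fix I r t assume I: "I \<in> subsets_of_card n (k - 2)" and rt: "r < t" "t < 3" "det_cols a A r t I = 0"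
    have I': "I \<subseteq> {..<n}" "Suc (Suc (card I)) = k" "finite I"
      using I k finite_subset by (auto simp: subsets_of_card_def)
    have r: "r < 3" using rt by simp
    obtain y where y: "y \<in> carrier_vec 3" "y \<noteq> 0\<^sub>v 3" "col A r \<bullet> y = 0" "col A t \<bullet> y = 0" "omega_vec a I \<bullet> y = 0"
      using det_cols_eq_0_iff[OF As r rt(2)] rt(3) by blast
    have dy: "dim_vec y = 3" using y(1) by simp
    \<comment> \<open>The polynomial vanishing on I whose three top coefficients are the entries of
      y: c is y 2, d is solved from f_(k-2) = d - c e1, and orthogonality to
      \<open>omega_vec\<close> then fixes f_(k-3).\<close>
    define f where "f = [:y $ 1 + y $ 2 * e1 a I, y $ 2:] * node_poly a I"
    note co = coeff_linear_times_node_poly[OF k(1) I'(3,2), of "y $ 1 + y $ 2 * e1 a I" "y $ 2" a, folded f_def]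
    have y0: "y $ 0 = Polynomial.coeff f (k - 3)"
      using y(5) unfolding scalar_prod_3[OF dy] omega_vec_index co(3)
      by (simp add: power2_eq_square algebra_simps eq_neg_iff_add_eq_0 del: One_nat_def)
    have y12: "y $ 1 = Polynomial.coeff f (k - 2)" "y $ 2 = Polynomial.coeff f (k - 1)" using co(1,2) by simp_all
    have f0: "f \<noteq> 0"
    proof
      assume "f = 0"
      then have "y $ 0 = 0" "y $ 1 = 0" "y $ 2 = 0" using y0 y12 by simp_all
      then have "y = 0\<^sub>v 3" using dy by (auto simp: vec_eq_iff numeral_3_eq_3 numeral_2_eq_2 less_Suc_eq)
      then show False using y(2) by simp
    qed
    have tc: "tail_coord 3 k A f i = col A i \<bullet> y" if "i < 3" for i
      unfolding tail_coord_eq_sum_3[OF k3] scalar_prod_3[OF dy] y0[symmetric] y12[symmetric] using As that by simp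
    have "card {r, t} \<le> card {i. i < 3 \<and> tail_coord 3 k A f i = 0}"
      using r rt(2) y(3,4) tc by (intro card_mono) auto
    then have "tail_weight 3 k A f \<le> 1" using tail_weight_eq[of 3 k A f] rt(1) by simp
    moreover have "card I \<le> card (zeros n a f)"
    proof (rule card_mono[OF zeros_finite(1)])
      show "I \<subseteq> zeros n a f" using zeros_node_poly[OF I'(1), of a] by (auto simp: zeros_def f_def)
    qed
    ultimately have "grl_weight n 3 k a A f \<le> n - k + 3"
      using grl_weight_eq[of n 3 k a A f] I'(2) k by simp
    then show ?thesis using f0 co(4) by blast
  qed
  then obtain f where f: "f \<noteq> 0" "Polynomial.degree f < k" "grl_weight n 3 k a A f \<le> n - k + 3" by blast
  have "grl_weight n 3 k a A f = n - k + 3" using lower[OF f(1,2)] f(3) by simp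
  then show ?thesis by (intro of_weights[OF a _ k3 k(2) A lower f(1,2)]) simp_all
qed

end

section \<open>The families of data\<close>

text \<open>Cancel Q \<le> k Q in k (Q + 1) \<le> n + Q.\<close>

lemma range_le:
  fixes k n Q :: nat
  assumes "1 \<le> k" "k \<le> (n + Q) div (Q + 1)"
  shows "k \<le> n"
proof -
  have "k * (Q + 1) \<le> n + Q" using assms(2) by (simp add: less_eq_div_iff_mult_less_eq)
  moreover have "1 * Q \<le> k * Q" using assms(1) by (rule mult_le_mono1)
  moreover have "k * (Q + 1) = k * Q + k" by simp
  ultimately show ?thesis by linarith
qed

text \<open>Stated over the integers because n + Q - \<delta> + 1 can be negative; as \<delta> is
  positive, its quotient is at most that of \<open>range_le\<close>.\<close>

lemma int_range_le:
  fixes k n Q \<delta> :: nat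
  assumes "1 \<le> k" "0 < \<delta>" "int k \<le> (int n + int Q - int \<delta> + 1) div (int Q + 1)"
  shows "k \<le> n"
proof (rule range_le[OF assms(1)])
  have "(int n + int Q - int \<delta> + 1) div (int Q + 1) \<le> (int n + int Q) div (int Q + 1)"
    using assms(2) by (intro zdiv_mono1) auto
  also have "\<dots> = int ((n + Q) div (Q + 1))" by (simp add: zdiv_int add.commute)
  finally show "k \<le> (n + Q) div (Q + 1)" using assms(3) by linarith
qed

text \<open>Every range, also the one of (R9) that involves m, is contained in the widest
  one.\<close>

lemma listed_eval_setD:
  assumes "listed_eval_set p e l n s k a"
  shows "distinct_entries n a" and "k \<le> n"
proof -
  have le: "(n + p ^ l - m) div (p ^ l + 1) \<le> (n + p ^ l) div (p ^ l + 1)" for m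
    by (intro div_le_mono) simp
  show "distinct_entries n a" using assms by (auto simp: listed_eval_set_def lists_set_def)
  have "1 \<le> k" using assms by (auto simp: listed_eval_set_def)
  moreover have "k \<le> (n + p ^ l) div (p ^ l + 1)"
    using assms le[of 1] unfolding listed_eval_set_def by (meson le order_trans)
  ultimately show "k \<le> n" by (rule range_le)
qed

lemma identity_col_scalar_prod:
  fixes w :: "'a::field vec"
  shows "r < 3 \<Longrightarrow> w \<in> carrier_vec 3 \<Longrightarrow> col (1\<^sub>m 3) r \<bullet> w = w $ r"
  by simp

lemma gamma_vec_carrier: "gamma_vec a J \<in> carrier_vec 3"
  by (rule carrier_vecI) (rule gamma_vec_index(1))

lemma less_3_cases: "i < (3::nat) \<longleftrightarrow> i = 0 \<or> i = 1 \<or> i = 2"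
  by auto

text \<open>With two unit columns the determinant is, up to sign, the remaining entry of
  \<open>omega_vec\<close>.\<close>

lemma det_cols_identity_eq_0_iff:
  fixes a :: "'a::field vec"
  assumes "r < 3" "t < 3" "u < 3" "r \<noteq> t" "r \<noteq> u" "t \<noteq> u"
  shows "det_cols a (1\<^sub>m 3) r t I = 0 \<longleftrightarrow> omega_vec a I $ u = 0"
proof -
  have om: "omega_vec a I \<bullet> y = omega_vec a I $ u * y $ u"
    if y: "y \<in> carrier_vec 3" "y $ r = 0" "y $ t = 0" for y :: "'a vec"
  proof -
    have "{0..<3} = {r, t, u}" using assms by auto
    then show ?thesis using y assms(4-6) by (simp add: scalar_prod_def)
  qed
  show ?thesis
  proof
    assume "det_cols a (1\<^sub>m 3) r t I = 0"
    then obtain y where y: "y \<in> carrier_vec 3" "y \<noteq> 0\<^sub>v 3" "y $ r = 0" "y $ t = 0" "omega_vec a I \<bullet> y = 0"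
      using det_cols_eq_0_iff[OF one_carrier_mat assms(1,2)] identity_col_scalar_prod assms(1,2) by metis
    have "y $ u \<noteq> 0"
    proof
      assume "y $ u = 0"
      then have "y $ i = 0" if "i < 3" for i
      proof -
        have "i \<in> {0..<3}" using that by simp
        also have "{0..<3} = {r, t, u}" using assms by auto
        finally show ?thesis using y(3,4) \<open>y $ u = 0\<close> by auto
      qed
      then have "y = 0\<^sub>v 3" using y(1) by (intro eq_vecI) auto
      then show False using y(2) by simp
    qed
    then show "omega_vec a I $ u = 0" using om[OF y(1,3,4)] y(5) by simp
  next
    assume u0: "omega_vec a I $ u = 0"
    define y :: "'a vec" where "y = unit_vec 3 u"
    have y: "y \<in> carrier_vec 3" "y $ r = 0" "y $ t = 0" "y $ u = 1" using assms by (simp_all add: y_def)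
    have "y \<noteq> 0\<^sub>v 3" using y(4) assms(3) by auto
    moreover have "omega_vec a I \<bullet> y = 0" using om[OF y(1-3)] u0 by simp
    moreover have "col (1\<^sub>m 3) r \<bullet> y = 0" "col (1\<^sub>m 3) t \<bullet> y = 0"
      using identity_col_scalar_prod[OF _ y(1)] assms(1,2) y(2,3) by simp_all
    ultimately show "det_cols a (1\<^sub>m 3) r t I = 0"
      using det_cols_eq_0_iff[OF one_carrier_mat assms(1,2)] y(1) by blast
  qed
qed

text \<open>For the identity matrix, (M1) and (M2) say that no entry of \<open>omega_vec\<close> or
  \<open>gamma_vec\<close> vanishes. One entry of each is 1, and (D) is about the others.\<close>

lemma condD_imp_condM:
  assumes "condD n k a"
  shows "condM1 n k a (1\<^sub>m 3)" and "condM2 n k a (1\<^sub>m 3)"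
proof -
  show "condM1 n k a (1\<^sub>m 3)"
    unfolding condM1_def
  proof (intro ballI allI impI)
    fix I r t assume I: "I \<in> subsets_of_card n (k - 2)" and rt: "r < t \<and> t < (3::nat)"
    then have D: "e1 a I \<noteq> 0" "(e1 a I)\<^sup>2 - e2 a I \<noteq> 0" using assms by (auto simp: condD_def)
    from rt have "r = 0 \<and> t = 1 \<or> r = 0 \<and> t = 2 \<or> r = 1 \<and> t = 2" by presburger
    then consider "r = 0" "t = 1" | "r = 0" "t = 2" | "r = 1" "t = 2" by blast
    then show "det_cols a (1\<^sub>m 3) r t I \<noteq> 0"
    proof cases
      case 1
      then show ?thesis using det_cols_identity_eq_0_iff[of r t 2 a I] D by (simp add: omega_vec_index)
    next
      case 2
      then show ?thesis using det_cols_identity_eq_0_iff[of r t 1 a I] D omega_vec_index(3)[of a I] by simp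
    next
      case 3
      then show ?thesis using det_cols_identity_eq_0_iff[of r t 0 a I] D by (simp add: omega_vec_index)
    qed
  qed
  show "condM2 n k a (1\<^sub>m 3)"
    unfolding condM2_def
  proof (intro ballI allI impI)
    fix J and r :: nat assume J: "J \<in> subsets_of_card n (k - 1)" and r: "r < 3"
    have D: "e1 a J \<noteq> 0" "e2 a J \<noteq> 0" using assms J by (auto simp: condD_def)
    show "col (1\<^sub>m 3) r \<bullet> gamma_vec a J \<noteq> 0"
      unfolding identity_col_scalar_prod[OF r gamma_vec_carrier]
      using r D gamma_vec_index[of a J] by (auto simp: less_3_cases)
  qed
qed

text \<open>A failing condition in (D) is a zero entry of \<open>omega_vec\<close> or
  \<open>gamma_vec\<close>, which is (N1) for the identity matrix. The last entry of
  \<open>gamma_vec\<close> is 1, so excluding (0, 0) leaves at most one zero entry, which is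
  (N2).\<close>

lemma not_condD_imp_condN:
  assumes "\<not> condD n k a" and J: "\<forall>J\<in>subsets_of_card n (k - 1). (e1 a J, e2 a J) \<noteq> (0, 0)"
  shows "condN1 n k a (1\<^sub>m 3)" and "condN2 n k a (1\<^sub>m 3)"
proof -
  consider I where "I \<in> subsets_of_card n (k - 2)" "e1 a I = 0"
    | I where "I \<in> subsets_of_card n (k - 2)" "(e1 a I)\<^sup>2 - e2 a I = 0"
    | J where "J \<in> subsets_of_card n (k - 1)" "e1 a J = 0"
    | J where "J \<in> subsets_of_card n (k - 1)" "e2 a J = 0"
    using assms(1) unfolding condD_def by blast
  then show "condN1 n k a (1\<^sub>m 3)"
  proof cases
    case 1
    have "det_cols a (1\<^sub>m 3) 0 2 I = 0"
      using det_cols_identity_eq_0_iff[of 0 2 1 a I] 1(2) omega_vec_index(3)[of a I] by simp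
    moreover have "(0::nat) < 2" "2 < (3::nat)" by simp_all
    ultimately show ?thesis using 1(1) unfolding condN1_def by blast
  next
    case 2
    have "det_cols a (1\<^sub>m 3) 0 1 I = 0"
      using det_cols_identity_eq_0_iff[of 0 1 2 a I] 2(2) omega_vec_index(4)[of a I] by simp
    moreover have "(0::nat) < 1" "1 < (3::nat)" by simp_all
    ultimately show ?thesis using 2(1) unfolding condN1_def by blast
  next
    case 3
    have "col (1\<^sub>m 3) 1 \<bullet> gamma_vec a J = 0"
      using identity_col_scalar_prod[of 1 "gamma_vec a J", OF _ gamma_vec_carrier] 3(2) gamma_vec_index(3)[of a J] by simp
    moreover have "1 < (3::nat)" by simp
    ultimately show ?thesis using 3(1) unfolding condN1_def by blast
  next
    case 4
    have "col (1\<^sub>m 3) 0 \<bullet> gamma_vec a J = 0"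
      using identity_col_scalar_prod[of 0 "gamma_vec a J", OF _ gamma_vec_carrier] 4(2) gamma_vec_index(2)[of a J] by simp
    moreover have "0 < (3::nat)" by simp
    ultimately show ?thesis using 4(1) unfolding condN1_def by blast
  qed
  show "condN2 n k a (1\<^sub>m 3)"
    unfolding condN2_def
  proof
    fix S assume S: "S \<in> subsets_of_card n (k - 1)"
    let ?N = "{r. r < 3 \<and> col (1\<^sub>m 3) r \<bullet> gamma_vec a S = 0}"
    have N: "?N = {r. r < 3 \<and> gamma_vec a S $ r = 0}"
      using identity_col_scalar_prod[of _ "gamma_vec a S", OF _ gamma_vec_carrier] by auto
    have "r = t" if "r \<in> ?N" "t \<in> ?N" for r t
      using that J S gamma_vec_index[of a S] unfolding N by (auto simp: less_3_cases)
    then show "card ?N \<le> 1" by (auto simp: card_le_Suc0_iff_eq)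
  qed
qed

lemma exists_lists_UNIV: "\<exists>a :: 'a::finite vec. lists_set CARD('a) a UNIV"
proof -
  obtain xs :: "'a list" where xs: "set xs = UNIV" "distinct xs" using finite_distinct_list[OF finite[of "UNIV :: 'a set"]] by blast
  have len: "length xs = CARD('a)" using distinct_card[OF xs(2)] by (simp only: xs(1))
  have "lists_set CARD('a) (vec_of_list xs) UNIV"
    unfolding lists_set_def distinct_entries_def
  proof (intro conjI)
    show "vec_of_list xs \<in> carrier_vec CARD('a)" using len by (intro carrier_vecI) simp
    show "inj_on (\<lambda>j. vec_of_list xs $ j) {..<CARD('a)}"
      using xs(2) len by (auto simp: inj_on_def vec_of_list_index nth_eq_iff_index_eq)
    show "set\<^sub>v (vec_of_list xs) = UNIV"
      using set_list_of_vec[of "vec_of_list xs"] xs(1) by (simp add: list_vec)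
  qed
  then show ?thesis by blast
qed

theorem mainTheorem20:
  fixes p e l :: nat
  assumes "prime p" and "CARD('a::{field,finite}) = p ^ e" and "p ^ e > 4"
    and "0 < l" and "2 * l dvd e"
  shows
    "(\<comment> \<open>F1\<close> \<forall>n s k (a :: 'a vec).
        distinct_entries n a \<and> 2 \<le> s \<and>
        (\<forall>j<n. a $ j \<noteq> 0 \<and> inverse (a $ j) * u_coeff n a j \<in> subfield_of_order (p ^ l) - {0}) \<and>
        s < k \<and> k \<le> (n + p ^ l) div (p ^ l + 1) \<longrightarrow>
        (\<exists>d. d \<ge> n - k + 2 \<and> lcd_GRL_and_eaqecc p e l n s k a d)) \<and>
     (\<comment> \<open>F2\<close> \<forall>n s k (a :: 'a vec) \<delta> \<mu>.
        distinct_entries n a \<and> 2 \<le> s \<and> 0 < \<delta> \<and> \<mu> \<noteq> 0 \<and>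
        (\<forall>j<n. \<mu> * (a $ j) ^ (\<delta> - 1) * u_coeff n a j \<in> subfield_of_order (p ^ l) - {0}) \<and>
        s < k \<and> int k \<le> (int n + int (p ^ l) - int \<delta> + 1) div (int (p ^ l) + 1) \<longrightarrow>
        (\<exists>d. d \<ge> n - k + 2 \<and> lcd_GRL_and_eaqecc p e l n s k a d)) \<and>
     (\<comment> \<open>F3\<close> \<forall>n k (a :: 'a vec).
        3 \<le> k \<and> listed_eval_set p e l n 2 k a \<longrightarrow>
        lcd_GRL_and_eaqecc p e l n 2 k a (n - k + 2) \<and>
        (subset_sums n a (k - 1) \<noteq> UNIV \<longrightarrow> lcd_GRL_and_eaqecc p e l n 2 k a (n - k + 3))) \<and>
     (\<comment> \<open>F4\<close> \<forall>n k (a :: 'a vec) \<delta> \<mu>.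
        distinct_entries n a \<and> 3 \<le> k \<and> 0 < \<delta> \<and> \<mu> \<noteq> 0 \<and>
        (\<forall>j<n. \<mu> * (a $ j) ^ (\<delta> - 1) * u_coeff n a j \<in> subfield_of_order (p ^ l) - {0}) \<and>
        int \<delta> - 1 + int (p ^ l) * (int k - 1) = int n - int k \<longrightarrow>
        (0 \<notin> subset_sums n a (k - 1) \<longrightarrow> lcd_GRL_and_eaqecc p e l n 2 k a (n - k + 3)) \<and>
        (0 \<in> subset_sums n a (k - 1) \<longrightarrow> lcd_GRL_and_eaqecc p e l n 2 k a (n - k + 2))) \<and>
     (\<comment> \<open>F5\<close> \<forall>n k (a :: 'a vec).
        n = p ^ e \<and> lists_set n a UNIV \<and> 3 \<le> k \<and> k \<le> 1 + (p ^ e - 1) div (p ^ l + 1) \<longrightarrow>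
        lcd_GRL_and_eaqecc p e l n 2 k a (p ^ e - k + 2)) \<and>
     (\<comment> \<open>F6\<close> \<forall>n k (a :: 'a vec).
        4 \<le> k \<and> listed_eval_set p e l n 3 k a \<longrightarrow>
        ((\<exists>A\<in>GL 3. condM1 n k a A \<and> condM2 n k a A) \<longrightarrow>
           lcd_GRL_and_eaqecc p e l n 3 k a (n - k + 4)) \<and>
        ((\<exists>A\<in>GL 3. condN1 n k a A \<and> condN2 n k a A) \<longrightarrow>
           lcd_GRL_and_eaqecc p e l n 3 k a (n - k + 3))) \<and>
     (\<comment> \<open>F7\<close> \<forall>n k (a :: 'a vec) \<delta> \<mu>.
        distinct_entries n a \<and> 4 \<le> k \<and> 0 < \<delta> \<and> \<mu> \<noteq> 0 \<and>
        (\<forall>j<n. \<mu> * (a $ j) ^ (\<delta> - 1) * u_coeff n a j \<in> subfield_of_order (p ^ l) - {0}) \<and>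
        int \<delta> - 1 + int (p ^ l) * (int k - 1) = int n - int k \<longrightarrow>
        (condD n k a \<longrightarrow> lcd_GRL_and_eaqecc p e l n 3 k a (n - k + 4)) \<and>
        (\<not> condD n k a \<and> (\<forall>J\<in>subsets_of_card n (k - 1). (e1 a J, e2 a J) \<noteq> (0, 0)) \<longrightarrow>
           lcd_GRL_and_eaqecc p e l n 3 k a (n - k + 3))) \<and>
     (\<comment> \<open>particular case\<close> e = 2 * l \<longrightarrow>
        (\<forall>k. 3 \<le> k \<and> k \<le> p ^ l \<longrightarrow>
          (\<exists>(a :: 'a vec) C. lists_set (p ^ e) a UNIV \<and> is_GRL_code (p ^ e) 2 k a C \<and>
             linear_code (p ^ e + 2) k (p ^ e - k + 2) C \<and> amds_code (p ^ e + 2) k C \<and>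
             hermitian_lcd p e (p ^ e + 2) C) \<and>
          eaqecc_exists (p ^ l) (p ^ e + 2) k (p ^ e - k + 2) (p ^ e + 2 - k)))"
proof -
  interpret field_data p e l "TYPE('a)" by unfold_locales fact+
  have Q: "p ^ l \<le> p ^ e"
  proof (rule power_increasing)
    have "e \<noteq> 0" using assms(3) by (cases e) auto
    then show "l \<le> e" using assms(5) by (auto dest!: dvd_imp_le)
    show "1 \<le> p" using assms(1) by (rule prime_ge_1_nat)
  qed
  \<comment> \<open>Both summands on the left are nonnegative, hence so is n - k.\<close>
  have range_F4: "k \<le> n" if "0 < \<delta>" "1 \<le> k" "int \<delta> - 1 + int (p ^ l) * (int k - 1) = int n - int k" for \<delta> k n
  proof -
    have "0 \<le> int (p ^ l) * (int k - 1)" using that(2) by (intro mult_nonneg_nonneg) auto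
    then show ?thesis using that(1,3) by linarith
  qed
  show ?thesis
  proof (intro conjI allI impI, goal_cases)
    case (1 n s k a)
    then show ?case using range_le[of k n "p ^ l"] by (intro exists_min_weight) auto
  next
    case (2 n s k a \<delta> \<mu>)
    then show ?case using int_range_le[of k \<delta> n "p ^ l"] by (intro exists_min_weight) auto
  next
    case (3 n k a)
    then show ?case using listed_eval_setD[of p e l n 2 k a] by (intro almost_mds_2) auto
  next
    case (4 n k a)
    then obtain \<tau> where "\<tau> \<notin> subset_sums n a (k - 1)" by blast
    with 4 show ?case using listed_eval_setD[of p e l n 2 k a] by (intro mds_2) auto
  next
    case (5 n k a \<delta> \<mu>)
    \<comment> \<open>Here \<tau> = 0.\<close>
    then show ?case using range_F4[of \<delta> k n] by (intro mds_2) auto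
  next
    case (6 n k a \<delta> \<mu>)
    then show ?case using range_F4[of \<delta> k n] by (intro almost_mds_2) auto
  next
    case (7 n k a)
    \<comment> \<open>Hence k \<le> 1 + (q - 1) = n.\<close>
    have "(p ^ e - 1) div (p ^ l + 1) \<le> p ^ e - 1" by (rule div_le_dividend)
    then have kn: "k \<le> n" using 7 assms(3) by linarith
    then have "lcd_GRL_and_eaqecc p e l n 2 k a (n - k + 2)"
      using 7 by (intro almost_mds_2) (auto simp: lists_set_def)
    then show ?case using 7 by simp
  next
    case (8 n k a)
    then obtain A where "A \<in> GL 3" "condM1 n k a A" "condM2 n k a A" by blast
    with 8 show ?case using listed_eval_setD[of p e l n 3 k a] mds_3[of n a k A] by blast
  next
    case (9 n k a)
    then obtain A where "A \<in> GL 3" "condN1 n k a A" "condN2 n k a A" by blast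
    with 9 show ?case using listed_eval_setD[of p e l n 3 k a] almost_mds_3[of n a k A] by blast
  next
    case (10 n k a \<delta> \<mu>)
    then have "k \<le> n" using range_F4[of \<delta> k n] by simp
    then show ?case using 10 condD_imp_condM[of n k a] mds_3[OF _ _ _ one_mat_GL] by blast
  next
    case (11 n k a \<delta> \<mu>)
    then have "k \<le> n" using range_F4[of \<delta> k n] by simp
    then show ?case using 11 not_condD_imp_condN[of n k a] almost_mds_3[OF _ _ _ one_mat_GL] by blast
  next
    case (12 k)
    obtain a :: "'a vec" where a: "lists_set (p ^ e) a UNIV"
      using exists_lists_UNIV[where 'a = 'a] assms(2) by auto
    have k: "2 \<le> k" "k \<le> p ^ e" using 12 Q by auto
    have "lcd_GRL_and_eaqecc p e l (p ^ e) 2 k a (p ^ e - k + 2)"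
      using a k by (intro almost_mds_2) (auto simp: lists_set_def)
    then obtain C where "is_GRL_code (p ^ e) 2 k a C" "linear_code (p ^ e + 2) k (p ^ e - k + 2) C"
      "hermitian_lcd p e (p ^ e + 2) C"
      using 12(1) unfolding lcd_GRL_and_eaqecc_def by blast
    \<comment> \<open>The AMDS distance is length minus dimension; since k \<le> q, the truncated
      subtraction in q - k + 2 gives the same number.\<close>
    moreover have "p ^ e + 2 - k = p ^ e - k + 2" using k by simp
    ultimately show ?case using a unfolding amds_code_def by (metis (no_types, lifting))
  next
    case (13 k)
    obtain a :: "'a vec" where a: "lists_set (p ^ e) a UNIV"
      using exists_lists_UNIV[where 'a = 'a] assms(2) by auto
    have k: "2 \<le> k" "k \<le> p ^ e" using 13 Q by auto
    have "lcd_GRL_and_eaqecc p e l (p ^ e) 2 k a (p ^ e - k + 2)"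
      using a k by (intro almost_mds_2) (auto simp: lists_set_def)
    then show ?case
      using 13(1) unfolding lcd_GRL_and_eaqecc_def maximally_entangled_eaqecc_exists_def by blast
  qed
qed

end
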